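(* Let $n,m \geq 3$. Let $G$ be any reductive group acting algebraically on $\mathrm{Mat}_n^m$ by linear transformations. Then the null cone for the action of $G$ on $\mathrm{Mat}_n^m$ is not equal to $\mathrm{SING}_{n,m}$.
   Context: The ground field is $\mathbb{C}$. $\mathrm{Mat}_n$ is the space of $n\times n$ complex matrices and $\mathrm{Mat}_n^m$ is the space of $m$-tuples of such matrices, a complex vector space of dimension $mn^2$. With indeterminates $t_1,\dots,t_m$, $$\mathrm{SING}_{n,m}=\{(X_1,\dots,X_m)\in\mathrm{Mat}_n^m : \textstyle\sum_{i} t_iX_i \text{ is singular over } \mathbb{C}(t_1,\dots,t_m)\},$$ equivalently the set of tuples all of whose complex linear combinations are singular matrices. An algebraic group means a linear algebraic group over $\mathbb{C}$. It is reductive if every rational representation of it is a direct sum of irreducible representations. "Acting algebraically by linear transformations on $V$" means that the action is given by a rational representation, i.e. a morphism of algebraic groups $G\to \mathrm{GL}(V)$. The null cone of the action of $G$ on $V$ is $\mathcal{N}_G(V)=\{v\in V : 0\in\overline{G\cdot v}\}$, where the closure of the orbit may be taken in the Zariski or Euclidean topology. *)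

theory Defs
  imports
    "Jordan_Normal_Form.VS_Connect"
    "HOL-Library.Poly_Mapping"
    "HOL-Computational_Algebra.Fraction_Field"
begin

section \<open>Polynomial functions and the Zariski topology\<close>

text \<open>
  A finite-dimensional space is given by its carrier \<open>X\<close> together with a set \<open>C\<close> of coordinate
  functions on it. Since the ground field is infinite, polynomials are identified with polynomial
  functions, i.e. with the elements of the complex algebra generated by the coordinates.
\<close>

inductive_set gen_algebra :: "('a \<Rightarrow> complex) set \<Rightarrow> ('a \<Rightarrow> complex) set"
  for C :: "('a \<Rightarrow> complex) set" where
  const: "(\<lambda>_. c) \<in> gen_algebra C"
| coord: "f \<in> C \<Longrightarrow> f \<in> gen_algebra C"
| add: "f \<in> gen_algebra C \<Longrightarrow> g \<in> gen_algebra C \<Longrightarrow> (\<lambda>x. f x + g x) \<in> gen_algebra C"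
| mult: "f \<in> gen_algebra C \<Longrightarrow> g \<in> gen_algebra C \<Longrightarrow> (\<lambda>x. f x * g x) \<in> gen_algebra C"

definition zariski_closed :: "('a \<Rightarrow> complex) set \<Rightarrow> 'a set \<Rightarrow> 'a set \<Rightarrow> bool" where
  "zariski_closed C X S \<longleftrightarrow> (\<exists>P \<subseteq> gen_algebra C. S = {x \<in> X. \<forall>p\<in>P. p x = 0})"

definition zariski_closure :: "('a \<Rightarrow> complex) set \<Rightarrow> 'a set \<Rightarrow> 'a set \<Rightarrow> 'a set" where
  "zariski_closure C X S = \<Inter>{T. zariski_closed C X T \<and> S \<subseteq> T}"

definition mat_coords :: "nat \<Rightarrow> (complex mat \<Rightarrow> complex) set" where
  "mat_coords k = {(\<lambda>A. A $$ (i, j)) | i j. i < k \<and> j < k}"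


section \<open>Linear algebraic groups and rational representations\<close>

definition GL :: "nat \<Rightarrow> complex mat monoid" where
  "GL k = units_of (ring_mat TYPE(complex) k ())"

text \<open>Linear algebraic groups are the Zariski closed subgroups of some \<open>GL k\<close>.\<close>

definition linear_algebraic_group :: "nat \<Rightarrow> complex mat set \<Rightarrow> bool" where
  "linear_algebraic_group k G \<longleftrightarrow>
     subgroup G (GL k) \<and> zariski_closed (mat_coords k) (carrier (GL k)) G"

text \<open>
  The coordinate ring of \<open>GL k\<close> is generated by the matrix entries and the inverse of the
  determinant; the regular functions on a closed subgroup are the restrictions of its elements.
\<close>

definition regular_on :: "nat \<Rightarrow> complex mat set \<Rightarrow> (complex mat \<Rightarrow> complex) \<Rightarrow> bool" where
  "regular_on k G f \<longleftrightarrow>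
     (\<exists>p \<in> gen_algebra (insert (\<lambda>A. inverse (det A)) (mat_coords k)). \<forall>g\<in>G. f g = p g)"

text \<open>
  A rational representation on \<open>\<complex>\<^sup>d\<close> is a morphism of algebraic groups from \<open>G\<close> to \<open>GL d\<close>.
  Regularity of \<open>1 / det (\<rho> g) = det (\<rho> (g\<^sup>-\<^sup>1))\<close> follows from that of the entries of \<open>\<rho>\<close>.
\<close>

definition rational_rep ::
    "nat \<Rightarrow> complex mat set \<Rightarrow> nat \<Rightarrow> (complex mat \<Rightarrow> complex mat) \<Rightarrow> bool" where
  "rational_rep k G d \<rho> \<longleftrightarrow>
     \<rho> \<in> hom ((GL k)\<lparr>carrier := G\<rparr>) (GL d) \<and>
     (\<forall>i<d. \<forall>j<d. regular_on k G (\<lambda>g. \<rho> g $$ (i, j)))"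

definition invariant_subspace ::
    "complex mat set \<Rightarrow> nat \<Rightarrow> (complex mat \<Rightarrow> complex mat) \<Rightarrow> complex vec set \<Rightarrow> bool" where
  "invariant_subspace G d \<rho> W \<longleftrightarrow>
     VectorSpace.subspace class_ring W (module_vec TYPE(complex) d) \<and>
     (\<forall>g\<in>G. \<forall>w\<in>W. \<rho> g *\<^sub>v w \<in> W)"

definition irreducible_subrep ::
    "complex mat set \<Rightarrow> nat \<Rightarrow> (complex mat \<Rightarrow> complex mat) \<Rightarrow> complex vec set \<Rightarrow> bool" where
  "irreducible_subrep G d \<rho> W \<longleftrightarrow>
     invariant_subspace G d \<rho> W \<and> W \<noteq> {0\<^sub>v d} \<and>
     (\<forall>U. invariant_subspace G d \<rho> U \<and> U \<subseteq> W \<longrightarrow> U = {0\<^sub>v d} \<or> U = W)"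

text \<open>
  The sum of the \<open>W i\<close> is all of \<open>\<complex>\<^sup>d\<close> and is direct. The empty family (\<open>r = 0\<close>) accounts for the
  zero representation.
\<close>

definition direct_sum_of_irreducibles ::
    "complex mat set \<Rightarrow> nat \<Rightarrow> (complex mat \<Rightarrow> complex mat) \<Rightarrow> bool" where
  "direct_sum_of_irreducibles G d \<rho> \<longleftrightarrow>
     (\<exists>(r::nat) W. (\<forall>i<r. irreducible_subrep G d \<rho> (W i)) \<and>
        (\<forall>v\<in>carrier_vec d. \<exists>!w. w \<in> (\<Pi>\<^sub>E i\<in>{..<r}. W i) \<and>
           v = finsum_vec TYPE(complex) d w {..<r}))"

definition reductive_group :: "nat \<Rightarrow> complex mat set \<Rightarrow> bool" where
  "reductive_group k G \<longleftrightarrow>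
     linear_algebraic_group k G \<and>
     (\<forall>d \<rho>. rational_rep k G d \<rho> \<longrightarrow> direct_sum_of_irreducibles G d \<rho>)"


section \<open>Tuples of matrices\<close>

definition Mat_tuples :: "nat \<Rightarrow> nat \<Rightarrow> complex mat list set" where
  "Mat_tuples n m = {X. length X = m \<and> set X \<subseteq> carrier_mat n n}"

definition zero_tuple :: "nat \<Rightarrow> nat \<Rightarrow> complex mat list" where
  "zero_tuple n m = replicate m (0\<^sub>m n n)"

definition tuple_coords :: "nat \<Rightarrow> nat \<Rightarrow> (complex mat list \<Rightarrow> complex) set" where
  "tuple_coords n m = {(\<lambda>X. (X ! l) $$ (i, j)) | l i j. l < m \<and> i < n \<and> j < n}"

text \<open>
  The coordinate vector of a tuple with respect to the basis of matrix units: the entry \<open>(i, j)\<close> of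
  the \<open>l\<close>-th matrix is put at position \<open>l * n\<^sup>2 + i * n + j\<close>.
\<close>

definition flatten :: "nat \<Rightarrow> nat \<Rightarrow> complex mat list \<Rightarrow> complex vec" where
  "flatten n m X = vec (m * n\<^sup>2) (\<lambda>q. (X ! (q div n\<^sup>2)) $$ (q mod n\<^sup>2 div n, q mod n))"

lemma flatten_index:
  assumes "l < m" "i < n" "j < n"
  shows "l * n\<^sup>2 + i * n + j < m * n\<^sup>2"
    and "flatten n m X $ (l * n\<^sup>2 + i * n + j) = (X ! l) $$ (i, j)"
proof -
  have "i * n + j < (i + 1) * n" using assms by simp
  also have "\<dots> \<le> n * n" using assms by (intro mult_right_mono) auto
  finally have ij: "i * n + j < n\<^sup>2" by (simp add: power2_eq_square)
  have "l * n\<^sup>2 + i * n + j < (l + 1) * n\<^sup>2" using ij by simp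
  also have "\<dots> \<le> m * n\<^sup>2" using assms by (intro mult_right_mono) auto
  finally show lt: "l * n\<^sup>2 + i * n + j < m * n\<^sup>2" .
  have q: "l * n\<^sup>2 + i * n + j = (i * n + j) + l * n\<^sup>2" by simp
  have d: "(l * n\<^sup>2 + i * n + j) div n\<^sup>2 = l"
    unfolding q using ij assms by simp
  have r: "(l * n\<^sup>2 + i * n + j) mod n\<^sup>2 = i * n + j"
    unfolding q using ij by simp
  have s: "(l * n\<^sup>2 + i * n + j) mod n = j"
  proof -
    have "l * n\<^sup>2 + i * n + j = j + (l * n + i) * n" by (simp add: power2_eq_square algebra_simps)
    then show ?thesis using assms by simp
  qed
  show "flatten n m X $ (l * n\<^sup>2 + i * n + j) = (X ! l) $$ (i, j)"
    using lt assms by (simp add: flatten_def d r s)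
qed

lemma bij_betw_flatten: "bij_betw (flatten n m) (Mat_tuples n m) (carrier_vec (m * n\<^sup>2))"
proof (rule bij_betw_imageI)
  show "inj_on (flatten n m) (Mat_tuples n m)"
  proof (rule inj_onI)
    fix X Y assume X: "X \<in> Mat_tuples n m" and Y: "Y \<in> Mat_tuples n m"
      and eq: "flatten n m X = flatten n m Y"
    show "X = Y"
    proof (rule nth_equalityI)
      show "length X = length Y" using X Y by (simp add: Mat_tuples_def)
      fix l assume "l < length X"
      then have l: "l < m" using X by (simp add: Mat_tuples_def)
      have XY: "X ! l \<in> carrier_mat n n" "Y ! l \<in> carrier_mat n n"
        using X Y l by (auto simp: Mat_tuples_def)
      show "X ! l = Y ! l"
      proof (rule eq_matI)
        fix i j assume "i < dim_row (Y ! l)" "j < dim_col (Y ! l)"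
        then have "i < n" "j < n" using XY by auto
        then show "(X ! l) $$ (i, j) = (Y ! l) $$ (i, j)"
          using flatten_index(2)[OF l, of i n j] eq by metis
      qed (use XY in auto)
    qed
  qed
  show "flatten n m ` Mat_tuples n m = carrier_vec (m * n\<^sup>2)"
  proof
    show "flatten n m ` Mat_tuples n m \<subseteq> carrier_vec (m * n\<^sup>2)"
      by (auto simp: flatten_def)
    show "carrier_vec (m * n\<^sup>2) \<subseteq> flatten n m ` Mat_tuples n m"
    proof
      fix v :: "complex vec" assume v: "v \<in> carrier_vec (m * n\<^sup>2)"
      define X where "X = map (\<lambda>l. mat n n (\<lambda>(i, j). v $ (l * n\<^sup>2 + i * n + j))) [0..<m]"
      have "X \<in> Mat_tuples n m" by (auto simp: X_def Mat_tuples_def)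
      moreover have "v = flatten n m X"
      proof (rule eq_vecI)
        show "dim_vec v = dim_vec (flatten n m X)" using v by (simp add: flatten_def)
        fix q assume "q < dim_vec (flatten n m X)"
        then have q: "q < m * n\<^sup>2" by (simp add: flatten_def)
        then have n: "0 < n" by (cases n) auto
        have l: "q div n\<^sup>2 < m" using q by (simp add: less_mult_imp_div_less)
        have "q mod n\<^sup>2 < n * n" using n by (simp add: power2_eq_square)
        then have i: "q mod n\<^sup>2 div n < n" by (rule less_mult_imp_div_less)
        have j: "q mod n < n" using n by simp
        have "q mod n\<^sup>2 mod n = q mod n" by (simp add: power2_eq_square mod_mod_cancel)
        then have "q mod n\<^sup>2 div n * n + q mod n = q mod n\<^sup>2" by (metis div_mult_mod_eq)
        then have "q div n\<^sup>2 * n\<^sup>2 + q mod n\<^sup>2 div n * n + q mod n = q"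
          by (metis add.assoc div_mult_mod_eq)
        then show "v $ q = flatten n m X $ q"
          using q l i j by (simp add: flatten_def X_def)
      qed
      ultimately show "v \<in> flatten n m ` Mat_tuples n m" by blast
    qed
  qed
qed

text \<open>
  An algebraic action by linear transformations on the space of tuples: the action given by a
  rational representation, with linear transformations of the space of tuples written as matrices in
  the basis of matrix units.
\<close>

definition algebraic_linear_action ::
    "nat \<Rightarrow> complex mat set \<Rightarrow> nat \<Rightarrow> nat \<Rightarrow>
      (complex mat \<Rightarrow> complex mat list \<Rightarrow> complex mat list) \<Rightarrow> bool" where
  "algebraic_linear_action k G n m \<alpha> \<longleftrightarrow>
     (\<exists>\<rho>. rational_rep k G (m * n\<^sup>2) \<rho> \<and>
        (\<forall>g\<in>G. \<forall>X\<in>Mat_tuples n m.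
           \<alpha> g X \<in> Mat_tuples n m \<and> flatten n m (\<alpha> g X) = \<rho> g *\<^sub>v flatten n m X))"

definition null_cone ::
    "complex mat set \<Rightarrow> nat \<Rightarrow> nat \<Rightarrow>
      (complex mat \<Rightarrow> complex mat list \<Rightarrow> complex mat list) \<Rightarrow> complex mat list set" where
  "null_cone G n m \<alpha> =
     {X \<in> Mat_tuples n m.
        zero_tuple n m \<in> zariski_closure (tuple_coords n m) (Mat_tuples n m) {\<alpha> g X | g. g \<in> G}}"


section \<open>Singular tuples\<close>

text \<open>
  The field of rational functions in indeterminates \<open>t\<^sub>0, t\<^sub>1, \<dots>\<close>: the fraction field of the polynomial
  ring, whose elements are finitely supported maps from exponents to coefficients. Only the
  first \<open>m\<close> indeterminates occur in the definition of \<open>SING n m\<close>; singularity of a matrix does not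
  depend on whether it is considered over \<open>\<complex>(t\<^sub>0, \<dots>, t\<^sub>m\<^sub>-\<^sub>1)\<close> or over this extension field.
\<close>

type_synonym rat_fun = "((nat \<Rightarrow>\<^sub>0 nat) \<Rightarrow>\<^sub>0 complex) fract"

definition rf_const :: "complex \<Rightarrow> rat_fun" where
  "rf_const c = Fract (Poly_Mapping.single 0 c) 1"

definition rf_var :: "nat \<Rightarrow> rat_fun" where
  "rf_var l = Fract (Poly_Mapping.single (Poly_Mapping.single l 1) 1) 1"

definition generic_combination :: "nat \<Rightarrow> nat \<Rightarrow> complex mat list \<Rightarrow> rat_fun mat" where
  "generic_combination n m X =
     mat n n (\<lambda>(i, j). \<Sum>l<m. rf_var l * rf_const ((X ! l) $$ (i, j)))"

definition SING :: "nat \<Rightarrow> nat \<Rightarrow> complex mat list set" where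
  "SING n m = {X \<in> Mat_tuples n m. \<not> invertible_mat (generic_combination n m X)}"

end

(*
Suppose that the null cone of G is SING. Then every g in G maps SING to itself, and the linear maps with
this property are the maps P (x) Q (x) A, possibly composed with the transposition of all matrices.
Reductivity says that a tuple outside SING is separated from 0 by a G-invariant polynomial.

On the other hand the generic 3 x 3 skew-symmetric matrix, padded by a diagonal block, is in SING, so that 0 lies
in the Zariski closure of its orbit. Evaluation at 0 of the polynomial functions on the orbit extends to a
place of the ring of all functions on G with values in the complex numbers and infinity, a
substitute for the limit along a sequence g in G that drives the skew-symmetric tuple S to 0. Over the
valuation ring of the place P, Q and A can be brought to diagonal form with entries p, q, r sorted by
valuation. If all products p_a q_(n-1-a) r_(m-1) have limit 0, then g drives a tuple with an invertible limit to
0, which contradicts the existence of the invariants. If one of them has not, then in suitable bases all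
matrices of S share a block of zeros of size (a + 1) x (n - a), which is impossible for S.
*)

theory Submission
  imports
    Defs
    "HOL-Library.Function_Algebras"
    "HOL-Computational_Algebra.Fundamental_Theorem_Algebra"
begin

section \<open>Places on rings of complex functions\<close>

text \<open>The maps \<open>P\<close>, \<open>Q\<close>, \<open>A\<close> come from a classification
  that treats one linear map at a time. They are chosen separately for each g and need not depend
  algebraically on it, so a curve through the orbit or a valuation of the coordinate ring of G would
  not control their entries. A place of the ring of all functions on G does, and it also settles
  every case distinction on g, such as whether the matrices are transposed. The three factors are
  determined only up to scalars and may be unbounded; hence the diagonalization for arbitrary
  functions, in which the changes of basis are finite but the diagonal entries are arbitrary. The
  skew-symmetric tuple is singular without having a common block of zeros in any bases. Such blocks
  describe the null cone of the left-right action of SL_n x SL_n, which is a proper subset of SING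
  as soon as there are three matrices of size 3. Both bounds of the theorem come from here.\<close>

definition limit_ring :: "(('w \<Rightarrow> complex) \<times> complex) set \<Rightarrow> bool" where
  "limit_ring R \<longleftrightarrow>
     (\<forall>c. (\<lambda>_. c, c) \<in> R) \<and>
     (\<forall>x c y d. (x, c) \<in> R \<longrightarrow> (y, d) \<in> R \<longrightarrow> (x + y, c + d) \<in> R \<and> (x * y, c * d) \<in> R) \<and>
     (\<forall>c. (0, c) \<in> R \<longrightarrow> c = 0)"

text \<open>\<open>lim x c\<close> says that x has the value c; a function without value is
  infinite. The ring of all functions is a product of fields and not a field, so the reciprocal in
  the dichotomy is the pointwise one with \<open>1 / 0 = 0\<close>.\<close>

locale place =
  fixes lim :: "('w \<Rightarrow> complex) \<Rightarrow> complex \<Rightarrow> bool"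
  assumes lim_const: "lim (\<lambda>_. c) c"
    and lim_add: "lim x c \<Longrightarrow> lim y d \<Longrightarrow> lim (\<lambda>w. x w + y w) (c + d)"
    and lim_mult: "lim x c \<Longrightarrow> lim y d \<Longrightarrow> lim (\<lambda>w. x w * y w) (c * d)"
    and lim_unique: "lim x c \<Longrightarrow> lim x d \<Longrightarrow> c = d"
    and dichotomy: "(\<exists>c. lim x c) \<or> lim (\<lambda>w. 1 / x w) 0"

definition lim_poly ::
    "(('w \<Rightarrow> complex) \<times> complex) set \<Rightarrow> ('w \<Rightarrow> complex) poly \<Rightarrow> complex poly \<Rightarrow> bool" where
  "lim_poly R p q \<longleftrightarrow> (\<forall>i. (coeff p i, coeff q i) \<in> R)"

context
  fixes R :: "(('w \<Rightarrow> complex) \<times> complex) set"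
  assumes R: "limit_ring R"
begin

lemma lr_const: "(\<lambda>_. c, c) \<in> R"
  and lr_add: "(x, c) \<in> R \<Longrightarrow> (y, d) \<in> R \<Longrightarrow> (x + y, c + d) \<in> R"
  and lr_mult: "(x, c) \<in> R \<Longrightarrow> (y, d) \<in> R \<Longrightarrow> (x * y, c * d) \<in> R"
  and lr_zeroD: "(0, c) \<in> R \<Longrightarrow> c = 0"
  using R unfolding limit_ring_def by auto

lemma lr_zero: "(0, 0) \<in> R" and lr_one: "(1, 1) \<in> R"
  using lr_const[of 0] lr_const[of 1] by (simp_all add: zero_fun_def one_fun_def)

lemma lr_uminus: "(x, c) \<in> R \<Longrightarrow> (- x, - c) \<in> R"
proof -
  assume "(x, c) \<in> R"
  from lr_mult[OF lr_const[of "-1"] this] show ?thesis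
    by (simp add: times_fun_def fun_Compl_def)
qed

lemma lr_diff: "(x, c) \<in> R \<Longrightarrow> (y, d) \<in> R \<Longrightarrow> (x - y, c - d) \<in> R"
  using lr_add[OF _ lr_uminus, of x c y d] by simp

lemma lr_sum: "finite I \<Longrightarrow> (\<And>i. i \<in> I \<Longrightarrow> (x i, c i) \<in> R) \<Longrightarrow> (sum x I, sum c I) \<in> R"
  by (induction I rule: finite_induct) (auto simp: lr_zero lr_add)

lemma lr_power: "(x, c) \<in> R \<Longrightarrow> (x ^ k, c ^ k) \<in> R"
  by (induction k) (auto simp: lr_one lr_mult)

lemma lr_poly:
  assumes "lim_poly R p q" "(x, c) \<in> R"
  shows "(poly p x, poly q c) \<in> R"
proof -
  let ?n = "max (degree p) (degree q)"
  have "poly p x = (\<Sum>i\<le>?n. coeff p i * x ^ i)"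
    unfolding poly_altdef by (rule sum.mono_neutral_left) (auto simp: coeff_eq_0)
  moreover have "poly q c = (\<Sum>i\<le>?n. coeff q i * c ^ i)"
    unfolding poly_altdef by (rule sum.mono_neutral_left) (auto simp: coeff_eq_0)
  moreover have "((\<Sum>i\<le>?n. coeff p i * x ^ i), (\<Sum>i\<le>?n. coeff q i * c ^ i)) \<in> R"
    using assms by (intro lr_sum lr_mult lr_power) (auto simp: lim_poly_def)
  ultimately show ?thesis by simp
qed

lemma lim_poly_add: "lim_poly R p q \<Longrightarrow> lim_poly R p' q' \<Longrightarrow> lim_poly R (p + p') (q + q')"
  by (simp add: lim_poly_def lr_add)

lemma lim_poly_mult: "lim_poly R p q \<Longrightarrow> lim_poly R p' q' \<Longrightarrow> lim_poly R (p * p') (q * q')"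
  unfolding lim_poly_def coeff_mult by (intro allI lr_sum lr_mult) auto

lemma lim_poly_const: "(x, c) \<in> R \<Longrightarrow> lim_poly R [:x:] [:c:]"
  by (auto simp: lim_poly_def coeff_pCons lr_zero split: nat.split)

lemma lim_poly_map: "lim_poly R (map_poly (\<lambda>c _. c) q) q"
proof -
  have "coeff (map_poly (\<lambda>c _. c) q) i = ((\<lambda>_. coeff q i) :: 'w \<Rightarrow> complex)" for i
    by (subst coeff_map_poly) (auto simp: zero_fun_def)
  then show ?thesis by (simp add: lim_poly_def lr_const)
qed

end

lemma sum_fun_apply: "(\<Sum>i\<in>I. f i) w = (\<Sum>i\<in>I. f i w)"
  for f :: "'i \<Rightarrow> 'w \<Rightarrow> 'b :: comm_monoid_add"
  by (induction I rule: infinite_finite_induct) auto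

lemma poly_fun_apply:
  fixes p :: "('w \<Rightarrow> complex) poly"
  shows "poly p x w = poly (map_poly (\<lambda>f. f w) p) (x w)"
proof -
  have p: "(x ^ i) w = x w ^ i" for i by (induction i) auto
  have "degree (map_poly (\<lambda>f. f w) p) \<le> degree p"
    by (rule map_poly_degree_leq) 
  then have "poly (map_poly (\<lambda>f. f w) p) (x w) = (\<Sum>i\<le>degree p. coeff (map_poly (\<lambda>f. f w) p) i * x w ^ i)"
    unfolding poly_altdef by (intro sum.mono_neutral_left) (auto simp: coeff_eq_0)
  also have "\<dots> = (\<Sum>i\<le>degree p. coeff p i w * x w ^ i)"
    by (simp add: coeff_map_poly)
  also have "\<dots> = poly p x w"
    unfolding poly_altdef by (simp add: p sum_fun_apply)
  finally show ?thesis by simp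
qed

section \<open>Maximal limit rings are places\<close>

context
  fixes R :: "(('w \<Rightarrow> complex) \<times> complex) set"
  assumes R: "limit_ring R"
    and maximal: "\<And>R'. limit_ring R' \<Longrightarrow> R \<subseteq> R' \<Longrightarrow> R' = R"
begin

text \<open>The values at x of polynomials over the ring, paired with the values at c of their
  residue polynomials, extend R by the pair (x, c). The hypothesis is the single-valuedness of this
  extension, and maximality then forces it to be R.\<close>

lemma adjoin:
  assumes "\<And>p q. lim_poly R p q \<Longrightarrow> poly p x = 0 \<Longrightarrow> poly q c = 0"
  shows "(x, c) \<in> R"
proof -
  define R' where "R' = {(poly p x, poly q c) | p q. lim_poly R p q}"
  have sub: "R \<subseteq> R'"
  proof
    fix z assume "z \<in> R"
    then obtain y d where "z = (y, d)" "(y, d) \<in> R" by (cases z) auto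
    then show "z \<in> R'" unfolding R'_def using lim_poly_const[OF R]
      by (auto intro!: exI[of _ "[:y:]"] exI[of _ "[:d:]"])
  qed
  have "limit_ring R'" unfolding limit_ring_def
  proof (intro conjI allI impI)
    fix d show "(\<lambda>_. d, d) \<in> R'" using sub lr_const[OF R] by auto
  next
    fix y d z e assume "(y, d) \<in> R'" "(z, e) \<in> R'"
    then obtain p q p' q' where "y = poly p x" "d = poly q c" "lim_poly R p q"
      "z = poly p' x" "e = poly q' c" "lim_poly R p' q'" unfolding R'_def by auto
    then show "(y + z, d + e) \<in> R'" "(y * z, d * e) \<in> R'"
      unfolding R'_def using lim_poly_add[OF R] lim_poly_mult[OF R]
      by (metis (mono_tags, lifting) mem_Collect_eq poly_add, metis (mono_tags, lifting) mem_Collect_eq poly_mult)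
  next
    fix d assume "(0, d) \<in> R'"
    then show "d = 0" unfolding R'_def using assms by auto
  qed
  then have "R' = R" using sub by (rule maximal)
  moreover have "lim_poly R [:0, 1:] [:0, 1:]"
    unfolding lim_poly_def
    by (auto simp: coeff_pCons lr_zero[OF R] lr_one[OF R] split: nat.split)
  then have "(poly [:0, 1:] x, poly [:0, 1:] c) \<in> R'" unfolding R'_def by blast
  ultimately show ?thesis by simp
qed

text \<open>If neither value can be adjoined, there are relations for e whose residues do not vanish
  at 0 and at 1, respectively. At each point \<open>poly p 0\<close> or \<open>poly p' 1\<close>
  vanishes, since e is 0 or 1 there, but their product has a nonzero limit.\<close>

lemma idempotent_limit:
  assumes e: "\<And>w. e w = 0 \<or> e w = 1"
  shows "(e, 0) \<in> R \<or> (e, 1) \<in> R"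
proof (rule ccontr)
  assume "\<not> ?thesis"
  with adjoin[of e 0] adjoin[of e 1] obtain p q p' q' where
    pq: "lim_poly R p q" "poly p e = 0" "poly q 0 \<noteq> 0" and
    pq': "lim_poly R p' q'" "poly p' e = 0" "poly q' 1 \<noteq> 0" by blast
  have "poly p 0 * poly p' 1 = 0"
  proof
    fix w show "(poly p 0 * poly p' 1) w = 0 w"
      using e[of w] fun_cong[OF pq(2), of w] fun_cong[OF pq'(2), of w]
      by (auto simp: poly_fun_apply)
  qed
  moreover have "(poly p 0 * poly p' 1, poly q 0 * poly q' 1) \<in> R"
    by (intro lr_mult[OF R] lr_poly[OF R] pq pq' lr_zero[OF R] lr_one[OF R])
  ultimately show False using lr_zeroD[OF R] pq(3) pq'(3) by fastforce
qed

text \<open>The residues of the relations of x form an ideal of the complex polynomials. By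
  \<open>adjoin\<close> they have no common root, so the generator of the ideal is constant by the
  fundamental theorem of algebra.\<close>

lemma infinite_relation:
  assumes "\<And>c. (x, c) \<notin> R"
  obtains p where "lim_poly R p 1" "poly p x = 0"
proof -
  define J where "J = {q. \<exists>p. lim_poly R p q \<and> poly p x = 0}"
  have Jmult: "r * q \<in> J" if "q \<in> J" for q r
  proof -
    from that obtain p where "lim_poly R p q" "poly p x = 0" unfolding J_def by auto
    then have "lim_poly R (map_poly (\<lambda>c _. c) r * p) (r * q)" "poly (map_poly (\<lambda>c _. c) r * p) x = 0"
      using lim_poly_mult[OF R lim_poly_map[OF R]] by auto
    then show ?thesis unfolding J_def by auto
  qed
  have Jadd: "q + q' \<in> J" if "q \<in> J" "q' \<in> J" for q q'
  proof -
    from that obtain p p' where "lim_poly R p q" "poly p x = 0" "lim_poly R p' q'" "poly p' x = 0"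
      unfolding J_def by auto
    then have "lim_poly R (p + p') (q + q')" "poly (p + p') x = 0"
      using lim_poly_add[OF R] by auto
    then show ?thesis unfolding J_def by auto
  qed
  have ex: "\<exists>q\<in>J. poly q c \<noteq> 0" for c
    using adjoin[of x c] assms unfolding J_def by blast
  then have "\<exists>q. q \<in> J \<and> q \<noteq> 0" by fastforce
  then obtain q0 where q0: "q0 \<in> J" "q0 \<noteq> 0" and min: "\<And>q. q \<in> J \<Longrightarrow> q \<noteq> 0 \<Longrightarrow> degree q0 \<le> degree q"
    using ex_has_least_nat[of "\<lambda>q. q \<in> J \<and> q \<noteq> 0" _ degree] by blast
  have dvd: "q0 dvd q" if "q \<in> J" for q
  proof -
    have "q mod q0 = q + (- (q div q0)) * q0" by (simp add: minus_div_mult_eq_mod)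
    then have "q mod q0 \<in> J" using Jadd Jmult that q0 by metis
    then have "q mod q0 = 0" using min[of "q mod q0"] degree_mod_less[OF q0(2), of q] by force
    then show ?thesis by (simp add: dvd_eq_mod_eq_0)
  qed
  have "degree q0 = 0"
  proof (rule ccontr)
    assume "degree q0 \<noteq> 0"
    then have "\<not> constant (poly q0)" by (simp add: constant_degree)
    then obtain c where "poly q0 c = 0" using fundamental_theorem_of_algebra by blast
    then show False using ex[of c] dvd by fastforce
  qed
  then obtain a where a: "q0 = [:a:]" "a \<noteq> 0" using q0(2) degree_eq_zeroE by (metis pCons_0_0)
  have "[:1 / a:] * q0 \<in> J" using Jmult q0(1) by blast
  moreover have "[:1 / a:] * q0 = 1" using a by (simp add: one_pCons)
  ultimately show ?thesis using that unfolding J_def by auto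
qed

text \<open>The elimination familiar from the existence of valuation rings: of a relation for x and
  one for \<open>1 / x\<close>, the longer is shortened by means of the other until one of them is
  constant. The relations are assumed only where x does not vanish; at the end, multiplication by
  the indicator of this set, whose limit is 1, gives an honest identity.\<close>

lemma no_double_relation:
  assumes e: "((\<lambda>w. if x w = 0 then 0 else 1), 1) \<in> R"
    and "\<And>i. (a i, \<alpha> i) \<in> R" "\<alpha> 0 \<noteq> 0" "\<And>i. i > 0 \<Longrightarrow> \<alpha> i = 0"
    and "\<And>w. x w \<noteq> 0 \<Longrightarrow> (\<Sum>i\<le>n. a i w * x w ^ i) = 0"
    and "\<And>i. (b i, \<beta> i) \<in> R" "\<beta> 0 \<noteq> 0"
    and "\<And>w. x w \<noteq> 0 \<Longrightarrow> (\<Sum>i\<le>k. b i w * (1 / x w) ^ i) = 0"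
  shows False
  using assms(2-)
proof (induction "n + k" arbitrary: n k a \<alpha> b \<beta> rule: less_induct)
  case (less n k a \<alpha> b \<beta>)
  have triv: False if "(u, \<gamma>) \<in> R" "\<gamma> \<noteq> 0" "\<And>w. x w \<noteq> 0 \<Longrightarrow> u w = 0" for u \<gamma>
  proof -
    have "u * (\<lambda>w. if x w = 0 then 0 else 1) = 0" using that(3) by (auto simp: fun_eq_iff)
    then show False using lr_zeroD[OF R] lr_mult[OF R that(1) e] that(2) by auto
  qed
  \<comment> \<open>The tie k = n is put into the third case, where the correction of the constant
    residue has the factor \<open>\<alpha> n = 0\<close>. In the fourth case n < k, and the
    correction does not reach index 0.\<close>
  consider "n = 0" | "k = 0" | "k \<le> n" "k > 0" | "n < k" "n > 0" by linarith
  then show ?case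
  proof cases
    case 1
    then show ?thesis using less.prems(4) by (intro triv[OF less.prems(1)[of 0] less.prems(2)]) auto
  next
    case 2
    then show ?thesis using less.prems(7) by (intro triv[OF less.prems(5)[of 0] less.prems(6)]) auto
  next
    case 3
    \<comment> \<open>\<open>b 0\<close> times the relation for x minus \<open>a n * x ^ n\<close>
      times the relation for \<open>1 / x\<close>. The factor \<open>x ^ n\<close> turns the index i
      of the latter into \<open>n - i\<close>, and the terms of degree n cancel.\<close>
    define a' where "a' i = b 0 * a i - (if i \<ge> n - k \<and> i \<le> n then a n * b (n - i) else 0)" for i
    define \<alpha>' where "\<alpha>' i = \<beta> 0 * \<alpha> i - (if i \<ge> n - k \<and> i \<le> n then \<alpha> n * \<beta> (n - i) else 0)" for i
    show ?thesis
    proof (rule less.hyps[of "n - 1" k a' \<alpha>' b \<beta>])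
      show "n - 1 + k < n + k" using 3 by simp
      show "(a' i, \<alpha>' i) \<in> R" for i
        unfolding a'_def \<alpha>'_def using less.prems(1,5)
        by (auto simp: lr_diff[OF R] lr_mult[OF R])
      have n: "\<alpha> n = 0" using 3 less.prems(3) by simp
      show "\<alpha>' 0 \<noteq> 0" using less.prems(2,6) n by (simp add: \<alpha>'_def)
      show "\<alpha>' i = 0" if "i > 0" for i using less.prems(3)[OF that] n by (simp add: \<alpha>'_def)
      fix w assume w: "x w \<noteq> 0"
      have "(\<Sum>i\<le>n. a' i w * x w ^ i) = b 0 w * (\<Sum>i\<le>n. a i w * x w ^ i)
          - (\<Sum>i\<le>n. (if i \<ge> n - k \<and> i \<le> n then a n w * b (n - i) w else 0) * x w ^ i)"
        unfolding sum_distrib_left sum_subtractf[symmetric]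
        by (rule sum.cong) (auto simp: a'_def algebra_simps)
      also have "(\<Sum>i\<le>n. (if i \<ge> n - k \<and> i \<le> n then a n w * b (n - i) w else 0) * x w ^ i)
          = (\<Sum>i\<in>{n-k..n}. a n w * b (n - i) w * x w ^ i)"
        by (rule sum.mono_neutral_cong_right) auto
      also have "\<dots> = (\<Sum>i\<le>k. a n w * b i w * x w ^ (n - i))"
        by (rule sum.reindex_bij_witness[of _ "\<lambda>i. n - i" "\<lambda>i. n - i"]) (use 3 in auto)
      also have "\<dots> = (\<Sum>i\<le>k. a n w * x w ^ n * (b i w * (1 / x w) ^ i))"
        by (rule sum.cong) (use 3 w in \<open>auto simp: power_diff power_divide\<close>)
      also have "\<dots> = 0" using less.prems(7)[OF w] by (simp flip: sum_distrib_left)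
      finally have "(\<Sum>i\<le>n. a' i w * x w ^ i) = 0" using less.prems(4)[OF w] by simp
      moreover have "a' n w = 0" by (simp add: a'_def)
      moreover have "{..n} = insert n {..n - 1}" "n \<notin> {..n - 1}" using 3 by auto
      ultimately show "(\<Sum>i\<le>n - 1. a' i w * x w ^ i) = 0" by simp
    qed (use less.prems in auto)
  next
    case 4
    define b' where "b' i = a 0 * b i - (if i \<ge> k - n \<and> i \<le> k then b k * a (k - i) else 0)" for i
    define \<beta>' where "\<beta>' i = \<alpha> 0 * \<beta> i - (if i \<ge> k - n \<and> i \<le> k then \<beta> k * \<alpha> (k - i) else 0)" for i
    show ?thesis
    proof (rule less.hyps[of n "k - 1" a \<alpha> b' \<beta>'])
      show "n + (k - 1) < n + k" using 4 by simp
      show "(b' i, \<beta>' i) \<in> R" for i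
        unfolding b'_def \<beta>'_def using less.prems(1,5)
        by (auto simp: lr_diff[OF R] lr_mult[OF R])
      show "\<beta>' 0 \<noteq> 0" using less.prems(2,6) 4 by (simp add: \<beta>'_def)
      fix w assume w: "x w \<noteq> 0"
      have "(\<Sum>i\<le>k. b' i w * (1 / x w) ^ i) = a 0 w * (\<Sum>i\<le>k. b i w * (1 / x w) ^ i)
          - (\<Sum>i\<le>k. (if i \<ge> k - n \<and> i \<le> k then b k w * a (k - i) w else 0) * (1 / x w) ^ i)"
        unfolding sum_distrib_left sum_subtractf[symmetric]
        by (rule sum.cong) (auto simp: b'_def algebra_simps)
      also have "(\<Sum>i\<le>k. (if i \<ge> k - n \<and> i \<le> k then b k w * a (k - i) w else 0) * (1 / x w) ^ i)
          = (\<Sum>i\<in>{k-n..k}. b k w * a (k - i) w * (1 / x w) ^ i)"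
        by (rule sum.mono_neutral_cong_right) auto
      also have "\<dots> = (\<Sum>i\<le>n. b k w * a i w * (1 / x w) ^ (k - i))"
        by (rule sum.reindex_bij_witness[of _ "\<lambda>i. k - i" "\<lambda>i. k - i"]) (use 4 in auto)
      also have "\<dots> = (\<Sum>i\<le>n. b k w * (1 / x w) ^ k * (a i w * x w ^ i))"
        by (rule sum.cong) (use 4 w in \<open>auto simp: power_diff power_divide\<close>)
      also have "\<dots> = 0" using less.prems(4)[OF w] by (simp flip: sum_distrib_left)
      finally have "(\<Sum>i\<le>k. b' i w * (1 / x w) ^ i) = 0" using less.prems(7)[OF w] by simp
      moreover have "b' k w = 0" by (simp add: b'_def)
      moreover have "{..k} = insert k {..k - 1}" "k \<notin> {..k - 1}" using 4 by auto
      ultimately show "(\<Sum>i\<le>k - 1. b' i w * (1 / x w) ^ i) = 0" by simp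
    qed (use less.prems in auto)
  qed
qed

text \<open>If the indicator e of the support of x has limit 0, then 0 can be adjoined as limit of
  x. Otherwise e has limit 1, and if both alternatives failed, \<open>infinite_relation\<close> for
  x and \<open>adjoin\<close> for \<open>1 / x\<close> would provide the two relations excluded by
  \<open>no_double_relation\<close>.\<close>

lemma maximal_dichotomy: "(\<exists>c. (x, c) \<in> R) \<or> ((\<lambda>w. 1 / x w), 0) \<in> R"
proof (rule ccontr)
  assume neg: "\<not> ?thesis"
  define e where "e = (\<lambda>w. if x w = 0 then 0 else 1 :: complex)"
  have "(e, 1) \<in> R"
  proof (rule ccontr)
    assume "(e, 1) \<notin> R"
    then have e: "(e, 0) \<in> R" using idempotent_limit[of e] by (auto simp: e_def)
    \<comment> \<open>The constant coefficient of a relation vanishes wherever x does, hence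
      everywhere after multiplication by \<open>1 - e\<close>, which has limit 1.\<close>
    have "(x, 0) \<in> R"
    proof (rule adjoin)
      fix p q assume pq: "lim_poly R p q" "poly p x = 0"
      have "coeff p 0 * (1 - e) = 0"
      proof
        fix w show "(coeff p 0 * (1 - e)) w = 0 w"
          using fun_cong[OF pq(2), of w]
          by (auto simp: poly_fun_apply e_def poly_0_coeff_0 coeff_map_poly)
      qed
      moreover have "(coeff p 0 * (1 - e), coeff q 0 * (1 - 0)) \<in> R"
        using pq(1) by (intro lr_mult[OF R] lr_diff[OF R] lr_one[OF R] e) (auto simp: lim_poly_def)
      ultimately show "poly q 0 = 0" using lr_zeroD[OF R] by (auto simp: poly_0_coeff_0)
    qed
    then show False using neg by blast
  qed
  obtain p where p: "lim_poly R p 1" "poly p x = 0"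
    using infinite_relation[of x] neg by blast
  obtain r s where r: "lim_poly R r s" "poly r (\<lambda>w. 1 / x w) = 0" "poly s 0 \<noteq> 0"
    using adjoin[of "\<lambda>w. 1 / x w" 0] neg by blast
  have P: "(\<Sum>i\<le>degree p. coeff p i w * y w ^ i) = poly p y w"
    for p :: "('w \<Rightarrow> complex) poly" and y w
  proof -
    have p: "(y ^ i) w = y w ^ i" for i by (induction i) auto
    show ?thesis unfolding poly_altdef by (simp add: p sum_fun_apply)
  qed
  show False
  proof (rule no_double_relation[of x "coeff p" "coeff 1" "degree p" "coeff r" "coeff s" "degree r"])
    show "(\<Sum>i\<le>degree p. coeff p i w * x w ^ i) = 0" for w
      using P[of p w x] p(2) by simp
    show "(\<Sum>i\<le>degree r. coeff r i w * (1 / x w) ^ i) = 0" for w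
      using P[of r w "\<lambda>w. 1 / x w"] r(2) by simp
  qed (use \<open>(e, 1) \<in> R\<close> p r in \<open>auto simp: e_def lim_poly_def poly_0_coeff_0\<close>)
qed

lemma maximal_place: "place (\<lambda>x c. (x, c) \<in> R)"
proof
  show "c = d" if "(x, c) \<in> R" "(x, d) \<in> R" for x c d
    using lr_zeroD[OF R, of "c - d"] lr_diff[OF R that] by auto
qed (use lr_const[OF R] lr_add[OF R] lr_mult[OF R] maximal_dichotomy in
      \<open>auto simp: plus_fun_def times_fun_def\<close>)

end

text \<open>Partial homomorphisms are kept as sets of pairs so that Zorn's lemma applies to plain
  inclusion; the condition on pairs \<open>(0, c)\<close> in \<open>limit_ring\<close> is their
  single-valuedness.\<close>

lemma place_extends:
  assumes "limit_ring R0"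
  obtains lim where "place lim" "\<And>x c. (x, c) \<in> R0 \<Longrightarrow> lim x c"
proof -
  define \<A> where "\<A> = {R. limit_ring R \<and> R0 \<subseteq> R}"
  have "\<exists>M\<in>\<A>. \<forall>X\<in>\<A>. M \<subseteq> X \<longrightarrow> X = M"
  proof (rule subset_Zorn_nonempty)
    show "\<A> \<noteq> {}" using assms by (auto simp: \<A>_def)
    fix C assume "C \<noteq> {}" and C: "subset.chain \<A> C"
    then obtain R1 where R1: "R1 \<in> C" by auto
    have lr: "limit_ring R" if "R \<in> C" for R using C that by (auto simp: subset.chain_def \<A>_def)
    have "R1 \<subseteq> \<Union>C" "R0 \<subseteq> R1" using R1 C by (auto simp: subset.chain_def \<A>_def)
    have common: "\<exists>R\<in>C. z \<in> R \<and> z' \<in> R" if "z \<in> \<Union>C" "z' \<in> \<Union>C" for z z'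
    proof -
      from that obtain A B where "A \<in> C" "B \<in> C" "z \<in> A" "z' \<in> B" by auto
      moreover have "A \<subseteq> B \<or> B \<subseteq> A" using C calculation by (auto simp: subset_chain_def)
      ultimately show ?thesis by blast
    qed
    have "limit_ring (\<Union>C)" unfolding limit_ring_def
    proof (intro conjI allI impI)
      show "(\<lambda>_. c, c) \<in> \<Union>C" for c using lr_const[OF lr[OF R1]] R1 by blast
      show "(x + y, c + d) \<in> \<Union>C" "(x * y, c * d) \<in> \<Union>C"
        if "(x, c) \<in> \<Union>C" "(y, d) \<in> \<Union>C" for x c y d
        using common[OF that] lr_add[OF lr] lr_mult[OF lr] by blast+
      show "c = 0" if "(0, c) \<in> \<Union>C" for c using that lr_zeroD[OF lr] by blast
    qed
    then show "\<Union>C \<in> \<A>" using \<open>R1 \<subseteq> \<Union>C\<close> \<open>R0 \<subseteq> R1\<close> by (auto simp: \<A>_def)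
  qed
  then obtain M where "M \<in> \<A>" and max: "\<And>X. X \<in> \<A> \<Longrightarrow> M \<subseteq> X \<Longrightarrow> X = M" by blast
  then have M: "limit_ring M" "R0 \<subseteq> M" by (simp_all add: \<A>_def)
  have "X = M" if "limit_ring X" "M \<subseteq> X" for X
    using max[of X] that M(2) by (simp add: \<A>_def order_trans[OF M(2)])
  note M = M this
  show ?thesis by (rule that[OF maximal_place[OF M(1,3)]]) (use M in auto)
qed

section \<open>Diagonalization over the valuation ring of a place\<close>

lemma mat_mult_entry:
  "A \<in> carrier_mat n k \<Longrightarrow> B \<in> carrier_mat k m \<Longrightarrow> i < n \<Longrightarrow> j < m \<Longrightarrow>
   (A * B) $$ (i, j) = (\<Sum>l<k. A $$ (i, l) * B $$ (l, j))"
  by (auto simp: scalar_prod_def lessThan_atLeast0)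

section \<open>Limits, validity almost everywhere, and divisibility\<close>

context place
begin

definition fin :: "('w \<Rightarrow> complex) \<Rightarrow> bool" where
  "fin x \<longleftrightarrow> (\<exists>c. lim x c)"

text \<open>The sets whose indicator has limit 1 form an ultrafilter, as \<open>ev_conj\<close>,
  \<open>ev_mono\<close> and \<open>ev_or_not\<close> show; \<open>ev Q\<close> means that Q holds
  almost everywhere.\<close>

definition ev :: "('w \<Rightarrow> bool) \<Rightarrow> bool" where
  "ev Q \<longleftrightarrow> lim (\<lambda>w. if Q w then 1 else 0) 1"

text \<open>Divisibility of y by x over the ring of finite functions, almost everywhere; in terms of
  a valuation, y is at least x. A multiplier instead of a quotient covers the zeros of x.\<close>

definition dom :: "('w \<Rightarrow> complex) \<Rightarrow> ('w \<Rightarrow> complex) \<Rightarrow> bool" where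
  "dom x y \<longleftrightarrow> (\<exists>z. fin z \<and> ev (\<lambda>w. y w = z w * x w))"

lemma lim_uminus: "lim x c \<Longrightarrow> lim (\<lambda>w. - x w) (- c)"
  using lim_mult[OF lim_const[of "-1"], of x c] by simp

lemma lim_diff: "lim x c \<Longrightarrow> lim y d \<Longrightarrow> lim (\<lambda>w. x w - y w) (c - d)"
  using lim_add[OF _ lim_uminus, of x c y d] by simp

lemma lim_sum:
  "finite I \<Longrightarrow> (\<And>i. i \<in> I \<Longrightarrow> lim (x i) (c i)) \<Longrightarrow> lim (\<lambda>w. \<Sum>i\<in>I. x i w) (\<Sum>i\<in>I. c i)"
  by (induction I rule: finite_induct) (auto intro: lim_const[of 0] lim_add)

text \<open>An indicator is its own reciprocal because \<open>1 / 0 = 0\<close>, so both cases of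
  the dichotomy give it a limit, and this limit is idempotent.\<close>

lemma lim_indicator: "lim (\<lambda>w. if Q w then 1 else 0) 0 \<or> lim (\<lambda>w. if Q w then 1 else 0) 1"
proof -
  let ?e = "\<lambda>w. if Q w then 1 else 0 :: complex"
  have 1: "(\<lambda>w. 1 / ?e w) = ?e" and 2: "(\<lambda>w. ?e w * ?e w) = ?e" by auto
  from dichotomy[of ?e] consider c where "lim ?e c" | "lim ?e 0" unfolding 1 by blast
  then show ?thesis
  proof cases
    case (1 c)
    from lim_mult[OF 1 1] have "c * c = c" unfolding 2 using 1 by (rule lim_unique)
    then show ?thesis using 1 by auto
  qed auto
qed

text \<open>A finite limit of x is 0 because its product with d is. The point is that x cannot be
  infinite; the indicator of its support annihilates y and therefore has limit 0.\<close>

lemma lim_vanish: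
  assumes xy: "\<And>w. x w * y w = 0" and y: "lim y d" "d \<noteq> 0"
  shows "lim x 0"
proof -
  have fin: "c = 0" if "lim x c" for c
    using lim_unique[OF lim_mult[OF that y(1), unfolded xy] lim_const[of 0]] y(2) by simp
  let ?e = "\<lambda>w. if x w \<noteq> 0 then 1 else 0 :: complex"
  have "(\<lambda>w. ?e w * y w) = (\<lambda>_. 0)" using xy by (auto simp: fun_eq_iff)
  then have "\<not> lim ?e 1"
    using lim_mult[of ?e 1, OF _ y(1)] lim_unique[OF _ lim_const[of 0], of d] y(2) by auto
  then have e: "lim ?e 0" using lim_indicator[of "\<lambda>w. x w \<noteq> 0"] by auto
  from dichotomy[of x] consider c where "lim x c" | "lim (\<lambda>w. 1 / x w) 0" by blast
  then show ?thesis
  proof cases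
    case (1 c)
    then show ?thesis using fin by auto
  next
    case 2
    \<comment> \<open>\<open>1 / x\<close> made invertible by adding 1 off the support of x. The
      limit 1 of u makes \<open>1 / u\<close> finite, and \<open>1 / u\<close> minus the indicator
      of the zero set of x is x again.\<close>
    define u where "u = (\<lambda>w. 1 / x w + (1 - ?e w))"
    have u: "lim u 1" unfolding u_def using lim_add[OF 2 lim_diff[OF lim_const[of 1] e]] by simp
    have "\<not> lim (\<lambda>w. 1 / (1 / u w)) 0" using lim_unique[OF u, of 0] by auto
    then obtain c where "lim (\<lambda>w. 1 / u w) c" using dichotomy[of "\<lambda>w. 1 / u w"] by auto
    moreover have "(\<lambda>w. 1 / u w - (1 - ?e w)) = x" by (auto simp: u_def)
    ultimately have "lim x (c - 1)"
      using lim_diff[OF _ lim_diff[OF lim_const[of 1] e], of "\<lambda>w. 1 / u w" c] by simp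
    then show ?thesis using fin[of "c - 1"] by simp
  qed
qed

lemma ev_True: "ev (\<lambda>_. True)"
  using lim_const[of 1] by (simp add: ev_def)

lemma ev_conj: "ev P \<Longrightarrow> ev Q \<Longrightarrow> ev (\<lambda>w. P w \<and> Q w)"
proof -
  assume "ev P" "ev Q"
  from lim_mult[OF this[unfolded ev_def]]
  have "lim (\<lambda>w. (if P w then 1 else 0) * (if Q w then 1 else 0)) 1" by simp
  moreover have "(\<lambda>w. (if P w then 1 else 0) * (if Q w then 1 else 0)) = (\<lambda>w. if P w \<and> Q w then 1 else 0 :: complex)"
    by auto
  ultimately show ?thesis by (simp add: ev_def)
qed

lemma ev_mono: "ev P \<Longrightarrow> (\<And>w. P w \<Longrightarrow> Q w) \<Longrightarrow> ev Q"
proof -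
  assume P: "ev P" and PQ: "\<And>w. P w \<Longrightarrow> Q w"
  have "lim (\<lambda>w. (if Q w then 1 else 0) - 1) 0"
    using lim_vanish[of "\<lambda>w. (if Q w then 1 else 0) - 1", OF _ P[unfolded ev_def]] PQ by auto
  from lim_add[OF this lim_const[of 1]] show ?thesis by (simp add: ev_def)
qed

lemma ev_or_not: "ev Q \<or> ev (\<lambda>w. \<not> Q w)"
proof -
  have "ev (\<lambda>w. \<not> Q w)" if "lim (\<lambda>w. if Q w then 1 else 0) 0"
  proof -
    from lim_diff[OF lim_const[of 1] that] have "lim (\<lambda>w. 1 - (if Q w then 1 else 0)) 1" by simp
    moreover have "(\<lambda>w. 1 - (if Q w then 1 else 0)) = (\<lambda>w. if \<not> Q w then 1 else 0 :: complex)" by auto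
    ultimately show ?thesis by (simp add: ev_def)
  qed
  then show ?thesis using lim_indicator[of Q] by (auto simp: ev_def)
qed

lemma ev_all: "finite I \<Longrightarrow> (\<And>i. i \<in> I \<Longrightarrow> ev (Q i)) \<Longrightarrow> ev (\<lambda>w. \<forall>i\<in>I. Q i w)"
  by (induction I rule: finite_induct) (auto simp: ev_True ev_conj)

lemma lim_cong_ev: "ev (\<lambda>w. x w = y w) \<Longrightarrow> lim x c \<Longrightarrow> lim y c"
proof -
  assume e: "ev (\<lambda>w. x w = y w)" and x: "lim x c"
  have "lim (\<lambda>w. y w - x w) 0"
    using lim_vanish[of "\<lambda>w. y w - x w", OF _ e[unfolded ev_def]] by auto
  from lim_add[OF this x] show ?thesis by simp
qed

lemma fin_const: "fin (\<lambda>_. c)"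
  and fin_add: "fin x \<Longrightarrow> fin y \<Longrightarrow> fin (\<lambda>w. x w + y w)"
  and fin_mult: "fin x \<Longrightarrow> fin y \<Longrightarrow> fin (\<lambda>w. x w * y w)"
  and fin_uminus: "fin x \<Longrightarrow> fin (\<lambda>w. - x w)"
  unfolding fin_def using lim_const lim_add lim_mult lim_uminus by blast+

lemma fin_sum: "finite I \<Longrightarrow> (\<And>i. i \<in> I \<Longrightarrow> fin (x i)) \<Longrightarrow> fin (\<lambda>w. \<Sum>i\<in>I. x i w)"
  by (induction I rule: finite_induct) (auto intro: fin_const fin_add)

lemma lim_fin_mult_0: "fin x \<Longrightarrow> lim y 0 \<Longrightarrow> lim (\<lambda>w. x w * y w) 0"
  unfolding fin_def using lim_mult[of x _ y 0] by auto

lemma dom_refl: "dom x x"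
  unfolding dom_def by (rule exI[of _ "\<lambda>_. 1"]) (auto simp: fin_const ev_True)

lemma dom_trans: "dom x y \<Longrightarrow> dom y z \<Longrightarrow> dom x z"
proof -
  assume "dom x y" "dom y z"
  then obtain a b where ab: "fin a" "ev (\<lambda>w. y w = a w * x w)" "fin b" "ev (\<lambda>w. z w = b w * y w)"
    unfolding dom_def by auto
  have "ev (\<lambda>w. z w = (b w * a w) * x w)"
    by (rule ev_mono[OF ev_conj[OF ab(2,4)]]) auto
  then show ?thesis unfolding dom_def using fin_mult[OF ab(3,1)] by blast
qed

lemma dom_zero: "dom x (\<lambda>_. 0)"
  unfolding dom_def by (rule exI[of _ "\<lambda>_. 0"]) (auto simp: fin_const ev_True)

lemma dom_add: "dom x y \<Longrightarrow> dom x y' \<Longrightarrow> dom x (\<lambda>w. y w + y' w)"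
proof -
  assume "dom x y" "dom x y'"
  then obtain a b where ab: "fin a" "ev (\<lambda>w. y w = a w * x w)" "fin b" "ev (\<lambda>w. y' w = b w * x w)"
    unfolding dom_def by auto
  have "ev (\<lambda>w. y w + y' w = (a w + b w) * x w)"
    by (rule ev_mono[OF ev_conj[OF ab(2,4)]]) (auto simp: algebra_simps)
  then show ?thesis unfolding dom_def using fin_add[OF ab(1,3)] by blast
qed

lemma dom_mult: "fin a \<Longrightarrow> dom x y \<Longrightarrow> dom x (\<lambda>w. a w * y w)"
proof -
  assume a: "fin a" and "dom x y"
  then obtain b where b: "fin b" "ev (\<lambda>w. y w = b w * x w)"
    unfolding dom_def by auto
  have "ev (\<lambda>w. a w * y w = (a w * b w) * x w)"
    by (rule ev_mono[OF b(2)]) auto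
  then show ?thesis unfolding dom_def using fin_mult[OF a b(1)] by blast
qed

lemma dom_total: "dom x y \<or> dom y x"
proof -
  have z: "dom u v" if "ev (\<lambda>w. v w = 0)" for u v
    unfolding dom_def by (rule exI[of _ "\<lambda>_. 0"]) (use that in \<open>auto simp: fin_const\<close>)
  have r: "dom u v" if "fin (\<lambda>w. v w / u w)" "ev (\<lambda>w. u w \<noteq> 0)" for u v
    unfolding dom_def by (intro exI[of _ "\<lambda>w. v w / u w"] conjI that(1) ev_mono[OF that(2)]) auto
  consider "ev (\<lambda>w. x w = 0)" | "ev (\<lambda>w. y w = 0)" | "ev (\<lambda>w. x w \<noteq> 0)" "ev (\<lambda>w. y w \<noteq> 0)"
    using ev_or_not[of "\<lambda>w. x w = 0"] ev_or_not[of "\<lambda>w. y w = 0"] by blast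
  then show ?thesis
  proof cases
    case 3
    from dichotomy[of "\<lambda>w. x w / y w"] have "fin (\<lambda>w. x w / y w) \<or> fin (\<lambda>w. y w / x w)"
      unfolding fin_def by auto
    then show ?thesis using r 3 by blast
  qed (use z in auto)
qed

lemma dom_max:
  assumes "finite I" "I \<noteq> {}"
  shows "\<exists>i\<in>I. \<forall>j\<in>I. dom (f i) (f j)"
  using assms
proof (induction I rule: finite_ne_induct)
  case (singleton i)
  then show ?case by (auto simp: dom_refl)
next
  case (insert k I)
  then obtain i where i: "i \<in> I" "\<forall>j\<in>I. dom (f i) (f j)" by auto
  from dom_total[of "f i" "f k"] show ?case
  proof
    assume "dom (f i) (f k)"
    then show ?thesis using i by auto
  next
    assume "dom (f k) (f i)"
    then have "\<forall>j\<in>insert k I. dom (f k) (f j)" using i dom_trans dom_refl by auto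
    then show ?thesis by auto
  qed
qed

text \<open>\<open>gl n L L'\<close> says that \<open>L\<close> is invertible over the ring of finite functions.\<close>

definition gl :: "nat \<Rightarrow> ('w \<Rightarrow> complex mat) \<Rightarrow> ('w \<Rightarrow> complex mat) \<Rightarrow> bool" where
  "gl n L L' \<longleftrightarrow>
     (\<forall>w. L w \<in> carrier_mat n n \<and> L' w \<in> carrier_mat n n \<and> L w * L' w = 1\<^sub>m n) \<and>
     (\<forall>i<n. \<forall>j<n. fin (\<lambda>w. L w $$ (i, j)) \<and> fin (\<lambda>w. L' w $$ (i, j)))"

lemma gl_carrier: "gl n L L' \<Longrightarrow> L w \<in> carrier_mat n n" "gl n L L' \<Longrightarrow> L' w \<in> carrier_mat n n"
  and gl_inv: "gl n L L' \<Longrightarrow> L w * L' w = 1\<^sub>m n"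
  and gl_fin: "gl n L L' \<Longrightarrow> i < n \<Longrightarrow> j < n \<Longrightarrow> fin (\<lambda>w. L w $$ (i, j))"
    "gl n L L' \<Longrightarrow> i < n \<Longrightarrow> j < n \<Longrightarrow> fin (\<lambda>w. L' w $$ (i, j))"
  by (auto simp: gl_def)

lemma gl_inv': "gl n L L' \<Longrightarrow> L' w * L w = 1\<^sub>m n"
  using gl_inv gl_carrier mat_mult_left_right_inverse by metis

lemma fin_mat_mult:
  assumes "\<And>w. A w \<in> carrier_mat n k" "\<And>w. B w \<in> carrier_mat k m" "i < n" "j < m"
    and "\<And>l. l < k \<Longrightarrow> fin (\<lambda>w. A w $$ (i, l))" "\<And>l. l < k \<Longrightarrow> fin (\<lambda>w. B w $$ (l, j))"
  shows "fin (\<lambda>w. (A w * B w) $$ (i, j))"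
  unfolding mat_mult_entry[OF assms(1-4)] using assms(5,6) by (intro fin_sum fin_mult) auto

lemma gl_mult:
  assumes L: "gl n L L'" and K: "gl n K K'"
  shows "gl n (\<lambda>w. L w * K w) (\<lambda>w. K' w * L' w)"
proof -
  note c = gl_carrier[OF L] gl_carrier[OF K]
  have "(L w * K w) * (K' w * L' w) = 1\<^sub>m n" for w
  proof -
    have "(L w * K w) * (K' w * L' w) = L w * ((K w * K' w) * L' w)"
      using c by (simp add: assoc_mult_mat[of _ n n _ n _ n] mult_carrier_mat[of _ n n _ n])
    then show ?thesis using c gl_inv[OF L] gl_inv[OF K] by (simp add: left_mult_one_mat[of _ n n])
  qed
  then show ?thesis
    using c gl_fin[OF L] gl_fin[OF K] unfolding gl_def
    by (auto intro!: fin_mat_mult mult_carrier_mat[of _ n n _ n])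
qed

lemma gl_one: "gl n (\<lambda>_. 1\<^sub>m n) (\<lambda>_. 1\<^sub>m n)"
  unfolding gl_def by (auto simp: fin_const)

lemma gl_swaprows: "k < n \<Longrightarrow> a < n \<Longrightarrow> gl n (\<lambda>_. swaprows_mat n k a) (\<lambda>_. swaprows_mat n k a)"
proof -
  assume ka: "k < n" "a < n"
  have "swaprows_mat n k a = swaprows_mat n a k" by (rule eq_matI) auto
  then show ?thesis
    unfolding gl_def using swaprows_mat_inv[OF ka] by (auto simp: fin_const)
qed

section \<open>Elementary matrices and Smith normal form over the finite functions\<close>

definition elim :: "nat \<Rightarrow> nat \<Rightarrow> (nat \<Rightarrow> 'w \<Rightarrow> complex) \<Rightarrow> 'w \<Rightarrow> complex mat" where
  "elim n k z w = mat n n (\<lambda>(i, j). (if i = j then 1 else 0) + (if j = k then z i w else 0))"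

lemma elim_carrier: "elim n k z w \<in> carrier_mat n n"
  by (simp add: elim_def)

lemma elim_mult:
  assumes "A \<in> carrier_mat n n" "i < n" "j < n" "k < n"
  shows "(elim n k z w * A) $$ (i, j) = A $$ (i, j) + z i w * A $$ (k, j)"
proof -
  have "(elim n k z w * A) $$ (i, j) =
      (\<Sum>l<n. ((if i = l then 1 else 0) + (if l = k then z i w else 0)) * A $$ (l, j))"
    using assms by (subst mat_mult_entry[of _ n n _ n]) (auto simp: elim_def)
  also have "\<dots> = (\<Sum>l<n. if i = l then A $$ (l, j) else 0) + (\<Sum>l<n. if l = k then z i w * A $$ (l, j) else 0)"
    unfolding sum.distrib[symmetric] by (rule sum.cong) (auto simp: algebra_simps)
  finally show ?thesis using assms by simp
qed

lemma elim_mult_right: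
  assumes A: "A \<in> carrier_mat n n" and ij: "i < n" "j < n" "k < n"
  shows "(A * (elim n k z w)\<^sup>T) $$ (i, j) = A $$ (i, j) + z j w * A $$ (i, k)"
proof -
  have "(A * (elim n k z w)\<^sup>T)\<^sup>T = elim n k z w * A\<^sup>T"
    using A elim_carrier[of n k z w] by (simp add: transpose_mult[of _ n n _ n] Matrix.transpose_transpose)
  moreover have "(A * (elim n k z w)\<^sup>T) $$ (i, j) = (A * (elim n k z w)\<^sup>T)\<^sup>T $$ (j, i)"
    using A ij elim_carrier[of n k z w] by (subst index_transpose_mat) auto
  ultimately show ?thesis using A ij by (simp add: elim_mult)
qed

text \<open>Because \<open>z k = 0\<close>, the matrix with z in column k and zeros elsewhere
  squares to zero, so negating z inverts the identity plus this matrix.\<close>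

lemma gl_elim:
  assumes k: "k < n" and z: "\<And>i. i < n \<Longrightarrow> fin (z i)" "\<And>w. z k w = 0"
  shows "gl n (elim n k z) (elim n k (\<lambda>i w. - z i w))"
proof -
  have "elim n k z w * elim n k (\<lambda>i w. - z i w) w = 1\<^sub>m n" for w
    by (rule eq_matI)
      (use k z(2) elim_carrier in \<open>auto simp: elim_mult[OF elim_carrier] simp del: index_mult_mat(1)\<close>,
       auto simp: elim_def)
  moreover have "fin (\<lambda>w. elim n k z w $$ (i, j))" if "i < n" "j < n" "\<And>i. i < n \<Longrightarrow> fin (z i)" for i j z
    using that by (cases "j = k") (auto simp: elim_def intro: fin_const fin_add)
  ultimately show ?thesis unfolding gl_def
    using z(1) fin_uminus by (auto simp: elim_carrier)
qed

lemma gl_transpose: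
  assumes "gl n L L'" shows "gl n (\<lambda>w. (L w)\<^sup>T) (\<lambda>w. (L' w)\<^sup>T)"
proof -
  have "(L w)\<^sup>T * (L' w)\<^sup>T = 1\<^sub>m n" for w
    using gl_inv'[OF assms, of w] gl_carrier[OF assms, of w]
    by (metis transpose_mult transpose_one)
  moreover have "(\<lambda>w. (L w)\<^sup>T $$ (i, j)) = (\<lambda>w. L w $$ (j, i))" "(\<lambda>w. (L' w)\<^sup>T $$ (i, j)) = (\<lambda>w. L' w $$ (j, i))"
    if "i < n" "j < n" for i j
    using that carrier_matD[OF gl_carrier(1)[OF assms]] carrier_matD[OF gl_carrier(2)[OF assms]] by auto
  ultimately show ?thesis
    using assms unfolding gl_def by auto
qed

text \<open>The state of the Smith normal form after k pivots. Each pivot divides all of the block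
  that starts at it, so the divisibility chain of the pivots is included.\<close>

definition diagonal_up_to :: "nat \<Rightarrow> nat \<Rightarrow> ('w \<Rightarrow> complex mat) \<Rightarrow> bool" where
  "diagonal_up_to n k N \<longleftrightarrow>
     (\<forall>w. N w \<in> carrier_mat n n) \<and>
     (\<forall>w. \<forall>i<n. \<forall>j<n. i \<noteq> j \<longrightarrow> i < k \<or> j < k \<longrightarrow> N w $$ (i, j) = 0) \<and>
     (\<forall>i<k. \<forall>a<n. \<forall>b<n. i \<le> a \<longrightarrow> i \<le> b \<longrightarrow> dom (\<lambda>w. N w $$ (i, i)) (\<lambda>w. N w $$ (a, b)))"

text \<open>Divisibility is total, also among infinite functions, so some entry of the remaining
  block divides all others. Permutations bring it to the diagonal, and its row and column are
  cleared with finite multipliers. The factorization of M holds only almost everywhere because the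
  divisibility relations do.\<close>

lemma diagonalize_step:
  assumes M: "\<And>w. M w \<in> carrier_mat n n" and "k \<le> n"
  shows "\<exists>L L' R R' N. gl n L L' \<and> gl n R R' \<and> diagonal_up_to n k N \<and>
     ev (\<lambda>w. M w = L w * (N w * R w))"
  using \<open>k \<le> n\<close>
proof (induction k)
  case 0
  show ?case
    by (rule exI[of _ "\<lambda>_. 1\<^sub>m n"], rule exI[of _ "\<lambda>_. 1\<^sub>m n"], rule exI[of _ "\<lambda>_. 1\<^sub>m n"],
        rule exI[of _ "\<lambda>_. 1\<^sub>m n"], rule exI[of _ M])
      (use M in \<open>auto simp: gl_one ev_True diagonal_up_to_def
         left_mult_one_mat[of _ n n] right_mult_one_mat[of _ n n]\<close>)
next
  case (Suc k)
  from Suc.IH[OF Suc_leD[OF Suc.prems]] obtain L L' R R' N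
    where L: "gl n L L'" and R: "gl n R R'" and D: "diagonal_up_to n k N"
      and MN: "ev (\<lambda>w. M w = L w * (N w * R w))"
    by blast
  have N: "N w \<in> carrier_mat n n" for w using D by (simp add: diagonal_up_to_def)
  have zero: "N w $$ (i, j) = 0" if "i < n" "j < n" "i \<noteq> j" "i < k \<or> j < k" for w i j
    using D that by (auto simp: diagonal_up_to_def)
  have domN: "dom (\<lambda>w. N w $$ (i, i)) (\<lambda>w. N w $$ (a, b))"
    if "i < k" "a < n" "b < n" "i \<le> a" "i \<le> b" for i a b
    using D that by (simp add: diagonal_up_to_def)
  have k: "k < n" using Suc.prems by simp
  have "\<exists>p\<in>{k..<n}\<times>{k..<n}. \<forall>q\<in>{k..<n}\<times>{k..<n}. dom (\<lambda>w. N w $$ p) (\<lambda>w. N w $$ q)"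
    by (rule dom_max) (use k in auto)
  then obtain a b where ab: "k \<le> a" "a < n" "k \<le> b" "b < n"
    and max: "\<And>i j. k \<le> i \<Longrightarrow> i < n \<Longrightarrow> k \<le> j \<Longrightarrow> j < n \<Longrightarrow> dom (\<lambda>w. N w $$ (a, b)) (\<lambda>w. N w $$ (i, j))"
    by fastforce
  let ?S = "swaprows_mat n k a" and ?T = "swaprows_mat n k b"
  define s where "s = Transposition.transpose k a"
  define t where "t = Transposition.transpose k b"
  define N2 where "N2 w = mat n n (\<lambda>(i, j). N w $$ (s i, t j))" for w
  have st: "s i < n" "t i < n" if "i < n" for i
    using that ab k by (auto simp: s_def t_def Transposition.transpose_def)
  have st_less: "s i = i" "t i = i" if "i < k" for i
    using that ab by (auto simp: s_def t_def Transposition.transpose_def)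
  have st_ge: "k \<le> s i" "k \<le> t i" if "k \<le> i" for i
    using that ab by (auto simp: s_def t_def Transposition.transpose_def)
  have N_N2: "N w = ?S * (N2 w * ?T)" for w
  proof -
    have "N2 w * ?T = swapcols k b (N2 w)" "swapcols k b (N2 w) \<in> carrier_mat n n"
      using swapcols_mat[of "N2 w" n n k b] k ab by (auto simp: N2_def)
    then have "?S * (N2 w * ?T) = swaprows k a (swapcols k b (N2 w))"
      using swaprows_mat[of "swapcols k b (N2 w)" n n k a] k ab by metis
    also have "\<dots> = N w"
      by (rule eq_matI)
        (use k ab N[of w] in \<open>auto simp: N2_def s_def t_def Transposition.transpose_def\<close>)
    finally show ?thesis by simp
  qed
  have zero2: "N2 w $$ (i, j) = 0" if "i < n" "j < n" "i \<noteq> j" "i < k \<or> j < k" for w i j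
  proof -
    have "s i \<noteq> t j" using that st_less st_ge
      by (metis leD le_less_linear)
    moreover have "s i < k \<or> t j < k" using that st_less by auto
    ultimately show ?thesis using zero that st by (simp add: N2_def)
  qed
  have dom2: "dom (\<lambda>w. N2 w $$ (i, i)) (\<lambda>w. N2 w $$ (a, b))"
    if "i \<le> k" "a < n" "b < n" "i \<le> a" "i \<le> b" for i a b
  proof (cases "i < k")
    case True
    then have "i \<le> s a" "i \<le> t b" using that st_less[of a] st_less[of b] st_ge[of a] st_ge[of b]
      by (metis le_less_linear order_trans that(1))+
    then show ?thesis using domN[OF True] that st k True st_less by (simp add: N2_def)
  next
    case False
    then have "i = k" using that by simp
    moreover have "s k = a'" "t k = b'" if "a' = s k" "b' = t k" for a' b' using that by auto
    ultimately show ?thesis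
      using max[of "s a" "t b"] that st st_ge k by (simp add: N2_def s_def[of] t_def)
  qed
  define pv where "pv = (\<lambda>w. N2 w $$ (k, k))"
  have "\<exists>z. fin z \<and> ev (\<lambda>w. N2 w $$ (i, k) = z w * pv w)" if "k < i" "i < n" for i
    using dom2[of k i k] that k unfolding dom_def pv_def by simp
  then obtain z0 where z0: "\<And>i. k < i \<Longrightarrow> i < n \<Longrightarrow> fin (z0 i)"
    "\<And>i. k < i \<Longrightarrow> i < n \<Longrightarrow> ev (\<lambda>w. N2 w $$ (i, k) = z0 i w * pv w)" by metis
  have "\<exists>y. fin y \<and> ev (\<lambda>w. N2 w $$ (k, i) = y w * pv w)" if "k < i" "i < n" for i
    using dom2[of k k i] that k unfolding dom_def pv_def by simp
  then obtain y0 where y0: "\<And>i. k < i \<Longrightarrow> i < n \<Longrightarrow> fin (y0 i)"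
    "\<And>i. k < i \<Longrightarrow> i < n \<Longrightarrow> ev (\<lambda>w. N2 w $$ (k, i) = y0 i w * pv w)" by metis
  define z where "z i = (if k < i then z0 i else (\<lambda>_. 0))" for i
  define y where "y i = (if k < i then y0 i else (\<lambda>_. 0))" for i
  have zy: "fin (z i)" "fin (y i)" if "i < n" for i
    using that z0(1) y0(1) by (auto simp: z_def y_def fin_const)
  have zyk: "z k w = 0" "y k w = 0" for w by (auto simp: z_def y_def)
  \<comment> \<open>Row and column k are cleared by definition and for every w, as
    \<open>diagonal_up_to\<close> demands; the divisibility relations enter only in the comparison
    \<open>EF\<close> with \<open>N2\<close>. The last summand compensates the product of the row
    and the column elimination.\<close>
  define N3 where "N3 w = mat n n (\<lambda>(i, j). if (i = k) \<noteq> (j = k) then 0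
     else if i = k then pv w else N2 w $$ (i, j) + (- z i w * y j w) * pv w)" for w
  have N3: "N3 w \<in> carrier_mat n n" for w by (simp add: N3_def)
  have EF: "ev (\<lambda>w. N2 w = elim n k z w * (N3 w * (elim n k y w)\<^sup>T))"
  proof (rule ev_mono)
    show "ev (\<lambda>w. (\<forall>i\<in>{k<..<n}. N2 w $$ (i, k) = z0 i w * pv w) \<and> (\<forall>i\<in>{k<..<n}. N2 w $$ (k, i) = y0 i w * pv w))"
      by (intro ev_conj ev_all) (auto simp: z0 y0)
    fix w assume w: "(\<forall>i\<in>{k<..<n}. N2 w $$ (i, k) = z0 i w * pv w) \<and> (\<forall>i\<in>{k<..<n}. N2 w $$ (k, i) = y0 i w * pv w)"
    have zw: "N2 w $$ (i, k) = z i w * pv w" "N2 w $$ (k, i) = y i w * pv w" if "i < n" "i \<noteq> k" for i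
    proof -
      have "N2 w $$ (i, k) = z i w * pv w \<and> N2 w $$ (k, i) = y i w * pv w"
        using that w zero2[of i k w] zero2[of k i w] k by (cases "k < i") (auto simp: z_def y_def)
      then show "N2 w $$ (i, k) = z i w * pv w" "N2 w $$ (k, i) = y i w * pv w" by auto
    qed
    show "N2 w = elim n k z w * (N3 w * (elim n k y w)\<^sup>T)"
    proof (rule eq_matI)
      fix i j assume "i < dim_row (elim n k z w * (N3 w * (elim n k y w)\<^sup>T))"
        "j < dim_col (elim n k z w * (N3 w * (elim n k y w)\<^sup>T))"
      then have ij: "i < n" "j < n" by (auto simp: elim_def)
      have c: "N3 w * (elim n k y w)\<^sup>T \<in> carrier_mat n n"
        by (rule mult_carrier_mat[OF N3]) (simp add: elim_def)
      show "N2 w $$ (i, j) = (elim n k z w * (N3 w * (elim n k y w)\<^sup>T)) $$ (i, j)"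
        unfolding elim_mult[OF c ij k] elim_mult_right[OF N3 ij k] elim_mult_right[OF N3 k ij(2) k]
        using zw ij zyk k by (auto simp: N3_def pv_def algebra_simps)
    qed (auto simp: N2_def elim_def)
  qed
  have dom3: "dom (\<lambda>w. N3 w $$ (i, i)) (\<lambda>w. N3 w $$ (a, b))"
    if "i \<le> k" "a < n" "b < n" "i \<le> a" "i \<le> b" for i a b
  proof -
    have ii: "(\<lambda>w. N3 w $$ (i, i)) = (\<lambda>w. N2 w $$ (i, i))"
      using that k by (auto simp: N3_def pv_def z_def)
    have pv: "dom (\<lambda>w. N2 w $$ (i, i)) pv" unfolding pv_def using dom2[of i k k] that k by simp
    have "dom (\<lambda>w. N2 w $$ (i, i)) (\<lambda>w. N2 w $$ (a, b) + (- z a w * y b w) * pv w)"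
      by (rule dom_add[OF dom2[OF that]], rule dom_mult[OF _ pv])
        (use that zy in \<open>auto intro!: fin_mult fin_uminus\<close>)
    then show ?thesis
      unfolding ii using that pv dom_zero by (cases "a = k"; cases "b = k") (auto simp: N3_def)
  qed
  have zero3: "N3 w $$ (i, j) = 0" if "i < n" "j < n" "i \<noteq> j" "i < Suc k \<or> j < Suc k" for w i j
  proof -
    have "i < k \<or> j < k" if "i \<noteq> k" "j \<noteq> k" using \<open>i < Suc k \<or> j < Suc k\<close> that by linarith
    then show ?thesis using that zero2[of i j w] by (auto simp: N3_def z_def y_def)
  qed
  define L3 where "L3 = (\<lambda>w. L w * (?S * elim n k z w))"
  define R3 where "R3 = (\<lambda>w. ((elim n k y w)\<^sup>T * ?T) * R w)"
  have "gl n L3 (\<lambda>w. (elim n k (\<lambda>i w. - z i w) w * ?S) * L' w)"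
    unfolding L3_def by (intro gl_mult L gl_swaprows gl_elim k ab zy zyk)
  moreover have "gl n R3 (\<lambda>w. R' w * (?T * (elim n k (\<lambda>i w. - y i w) w)\<^sup>T))"
    unfolding R3_def by (intro gl_mult R gl_swaprows gl_transpose gl_elim k ab zy zyk)
  moreover have "ev (\<lambda>w. M w = L3 w * (N3 w * R3 w))"
  proof (rule ev_mono[OF ev_conj[OF MN EF]])
    fix w assume w: "M w = L w * (N w * R w) \<and> N2 w = elim n k z w * (N3 w * (elim n k y w)\<^sup>T)"
    have c: "L w \<in> carrier_mat n n" "R w \<in> carrier_mat n n" "N3 w \<in> carrier_mat n n"
      "elim n k z w \<in> carrier_mat n n" "(elim n k y w)\<^sup>T \<in> carrier_mat n n"
      "?S \<in> carrier_mat n n" "?T \<in> carrier_mat n n"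
      using gl_carrier[OF L] gl_carrier[OF R] N3 elim_carrier[of n k] by auto
    have "M w = L w * ((?S * ((elim n k z w * (N3 w * (elim n k y w)\<^sup>T)) * ?T)) * R w)"
      using w N_N2 by metis
    also have "\<dots> = L3 w * (N3 w * R3 w)" unfolding L3_def R3_def
      using c by (simp add: assoc_mult_mat[of _ n n _ n _ n] mult_carrier_mat[of _ n n _ n])
    finally show "M w = L3 w * (N3 w * R3 w)" .
  qed
  moreover have "diagonal_up_to n (Suc k) N3"
    unfolding diagonal_up_to_def using N3 zero3 dom3 by (simp add: less_Suc_eq_le)
  ultimately show ?case by blast
qed

lemma diagonalize:
  assumes M: "\<And>w. M w \<in> carrier_mat n n"
  obtains L L' R R' d where "gl n L L'" "gl n R R'"
    "ev (\<lambda>w. M w = L w * (mat_diag n (\<lambda>i. d i w) * R w))"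
    "\<And>i j. i \<le> j \<Longrightarrow> j < n \<Longrightarrow> dom (d i) (d j)"
proof -
  from diagonalize_step[of M n n, OF M order_refl] obtain L L' R R' N
    where *: "gl n L L'" "gl n R R'" and D: "diagonal_up_to n n N"
      and MN: "ev (\<lambda>w. M w = L w * (N w * R w))"
    by blast
  have N: "N w = mat_diag n (\<lambda>i. N w $$ (i, i))" for w
    by (rule eq_matI) (use D in \<open>auto simp: mat_diag_def diagonal_up_to_def\<close>)
  show ?thesis
  proof (rule that[OF *, of "\<lambda>i w. N w $$ (i, i)"])
    show "ev (\<lambda>w. M w = L w * (mat_diag n (\<lambda>i. N w $$ (i, i)) * R w))" using MN by (simp flip: N)
    show "dom (\<lambda>w. N w $$ (i, i)) (\<lambda>w. N w $$ (j, j))" if "i \<le> j" "j < n" for i j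
      using D that by (simp add: diagonal_up_to_def)
  qed
qed

lemma gl_limit:
  assumes "gl n L L'"
  obtains A A' where "A \<in> carrier_mat n n" "A' \<in> carrier_mat n n" "A * A' = 1\<^sub>m n"
    "\<And>i j. i < n \<Longrightarrow> j < n \<Longrightarrow> lim (\<lambda>w. L w $$ (i, j)) (A $$ (i, j))"
    "\<And>i j. i < n \<Longrightarrow> j < n \<Longrightarrow> lim (\<lambda>w. L' w $$ (i, j)) (A' $$ (i, j))"
proof -
  define A where "A = mat n n (\<lambda>(i, j). SOME c. lim (\<lambda>w. L w $$ (i, j)) c)"
  define A' where "A' = mat n n (\<lambda>(i, j). SOME c. lim (\<lambda>w. L' w $$ (i, j)) c)"
  have A: "A \<in> carrier_mat n n" "A' \<in> carrier_mat n n" by (auto simp: A_def A'_def)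
  have l: "lim (\<lambda>w. L w $$ (i, j)) (A $$ (i, j))" "lim (\<lambda>w. L' w $$ (i, j)) (A' $$ (i, j))"
    if "i < n" "j < n" for i j
    using gl_fin[OF assms that] that by (auto simp: A_def A'_def fin_def intro: someI)
  have "A * A' = 1\<^sub>m n"
  proof (rule eq_matI)
    fix i j assume "i < dim_row (1\<^sub>m n :: complex mat)" "j < dim_col (1\<^sub>m n :: complex mat)"
    then have ij: "i < n" "j < n" by auto
    have "lim (\<lambda>w. \<Sum>l<n. L w $$ (i, l) * L' w $$ (l, j)) (\<Sum>l<n. A $$ (i, l) * A' $$ (l, j))"
      using ij by (intro lim_sum lim_mult l) auto
    also have "(\<lambda>w. \<Sum>l<n. L w $$ (i, l) * L' w $$ (l, j)) = (\<lambda>_. 1\<^sub>m n $$ (i, j))"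
      using mat_mult_entry[OF gl_carrier(1)[OF assms] gl_carrier(2)[OF assms] ij, symmetric]
      by (simp add: gl_inv[OF assms])
    finally show "(A * A') $$ (i, j) = 1\<^sub>m n $$ (i, j)"
      unfolding mat_mult_entry[OF A ij] using lim_unique lim_const by blast
  qed (use A in auto)
  then show ?thesis using that A l by blast
qed

end

section \<open>Determinants and spaces of matrices of rank one\<close>

definition msum :: "nat \<Rightarrow> 'i set \<Rightarrow> ('i \<Rightarrow> complex mat) \<Rightarrow> complex mat" where
  "msum n I N = mat n n (\<lambda>p. \<Sum>a\<in>I. N a $$ p)"

lemma msum_carrier [simp]: "msum n I N \<in> carrier_mat n n"
  by (simp add: msum_def)

text \<open>The determinant of the matrix whose i-th row is the i-th row of
  \<open>N (k i)\<close>.\<close>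

definition mixed :: "nat \<Rightarrow> (nat \<Rightarrow> complex mat) \<Rightarrow> (nat \<Rightarrow> nat) \<Rightarrow> complex" where
  "mixed n N k = (\<Sum>p | p permutes {0..<n}. signof p * (\<Prod>i = 0..<n. N (k i) $$ (i, p i)))"

lemma det_msum:
  assumes "finite I"
  shows "det (msum n I N) = (\<Sum>k \<in> {0..<n} \<rightarrow>\<^sub>E I. mixed n N k)"
proof -
  have "det (msum n I N) = (\<Sum>p | p permutes {0..<n}. signof p * (\<Prod>i = 0..<n. \<Sum>a\<in>I. N a $$ (i, p i)))"
    unfolding det_def'[OF msum_carrier]
  proof (rule sum.cong[OF refl], rule arg_cong2[of _ _ _ _ "(*)", OF refl], rule prod.cong[OF refl])
    fix p i assume "p \<in> {p. p permutes {0..<n}}" "i \<in> {0..<n}"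
    then have "p i \<in> {0..<n}" using permutes_in_image[of p "{0..<n}" i] by blast
    then show "msum n I N $$ (i, p i) = (\<Sum>a\<in>I. N a $$ (i, p i))"
      using \<open>i \<in> {0..<n}\<close> by (simp add: msum_def)
  qed
  also have "\<dots> = (\<Sum>p | p permutes {0..<n}. signof p * (\<Sum>k \<in> {0..<n} \<rightarrow>\<^sub>E I. \<Prod>i = 0..<n. N (k i) $$ (i, p i)))"
    by (subst prod_sum_PiE) (auto simp: assms)
  also have "\<dots> = (\<Sum>k \<in> {0..<n} \<rightarrow>\<^sub>E I. mixed n N k)"
    unfolding mixed_def sum_distrib_left by (rule sum.swap)
  finally show ?thesis .
qed

text \<open>The row expansion is grouped by the image of k. The determinant over I collects the
  groups with image inside I, so by induction on I every group with a proper image vanishes, and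
  only surjective choices remain.\<close>

lemma det_msum_bijections:
  assumes "\<And>I. I \<subset> {0..<n} \<Longrightarrow> det (msum n I N) = 0"
  shows "det (msum n {0..<n} N) = (\<Sum>k \<in> {k \<in> {0..<n} \<rightarrow>\<^sub>E {0..<n}. k ` {0..<n} = {0..<n}}. mixed n N k)"
proof -
  define G where "G I = (\<Sum>k \<in> {k \<in> {0..<n} \<rightarrow>\<^sub>E {0..<n}. k ` {0..<n} = I}. mixed n N k)" for I
  have F: "det (msum n I N) = (\<Sum>K\<in>Pow I. G K)" if "I \<subseteq> {0..<n}" for I
  proof -
    have fin: "finite I" using that finite_subset by blast
    have "(\<Sum>K\<in>Pow I. G K) = (\<Sum>K\<in>Pow I. \<Sum>k | k \<in> {0..<n} \<rightarrow>\<^sub>E I \<and> k ` {0..<n} = K. mixed n N k)"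
      unfolding G_def
    proof (rule sum.cong[OF refl], rule sum.cong[OF _ refl])
      fix K assume "K \<in> Pow I"
      then show "{k \<in> {0..<n} \<rightarrow>\<^sub>E {0..<n}. k ` {0..<n} = K} = {k. k \<in> {0..<n} \<rightarrow>\<^sub>E I \<and> k ` {0..<n} = K}"
        using that by (auto simp: PiE_def Pi_def)
    qed
    also have "\<dots> = (\<Sum>k \<in> {0..<n} \<rightarrow>\<^sub>E I. mixed n N k)"
      by (rule sum.group) (use fin in \<open>auto intro!: finite_PiE\<close>)
    finally show ?thesis using det_msum[OF fin] by simp
  qed
  have G0: "G I = 0" if "I \<subset> {0..<n}" for I
  proof -
    have "finite I" using that finite_subset by blast
    then show ?thesis using that
    proof (induction I rule: finite_psubset_induct)
      case (psubset I)
      have "0 = (\<Sum>K\<in>Pow I. G K)" using F[of I] assms[OF psubset.prems] psubset.prems by auto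
      also have "\<dots> = G I + (\<Sum>K\<in>Pow I - {I}. G K)"
        using psubset.hyps by (intro sum.remove) auto
      also have "(\<Sum>K\<in>Pow I - {I}. G K) = 0"
        by (rule sum.neutral) (use psubset in auto)
      finally show ?case by simp
    qed
  qed
  have "det (msum n {0..<n} N) = G {0..<n} + (\<Sum>K\<in>Pow {0..<n} - {{0..<n}}. G K)"
    using F[of "{0..<n}"] sum.remove[of "Pow {0..<n}" "{0..<n}" G] by simp
  also have "(\<Sum>K\<in>Pow {0..<n} - {{0..<n}}. G K) = 0"
    by (rule sum.neutral) (use G0 in auto)
  finally show ?thesis by (simp add: G_def)
qed

text \<open>A bijective choice takes exactly one row from the matrix with index l, so each term that
  survives in \<open>det_msum_bijections\<close> is linear in this matrix.\<close>

lemma det_msum_additive: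
  assumes A: "A \<in> carrier_mat n n" and B: "B \<in> carrier_mat n n" and l: "l < n"
    and 0: "\<And>I C. I \<subset> {0..<n} \<Longrightarrow> C \<in> {A, B, A + B} \<Longrightarrow> det (msum n I (N(l := C))) = 0"
  shows "det (msum n {0..<n} (N(l := A + B))) =
    det (msum n {0..<n} (N(l := A))) + det (msum n {0..<n} (N(l := B)))"
proof -
  have "mixed n (N(l := A + B)) k = mixed n (N(l := A)) k + mixed n (N(l := B)) k"
    if k: "k ` {0..<n} = {0..<n}" for k
  proof -
    obtain i0 where i0: "i0 < n" "k i0 = l" using k l by (metis atLeastLessThan_iff imageE zero_le)
    have "inj_on k {0..<n}" using k by (simp add: eq_card_imp_inj_on)
    then have ne: "k i \<noteq> l" if "i < n" "i \<noteq> i0" for i using that i0 by (auto dest: inj_onD)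
    have P: "(\<Prod>i = 0..<n. (N(l := C)) (k i) $$ (i, p i)) =
        C $$ (i0, p i0) * (\<Prod>i\<in>{0..<n} - {i0}. N (k i) $$ (i, p i))" for C p
    proof -
      have "(\<Prod>i\<in>{0..<n} - {i0}. (N(l := C)) (k i) $$ (i, p i)) = (\<Prod>i\<in>{0..<n} - {i0}. N (k i) $$ (i, p i))"
        by (rule prod.cong) (use ne in auto)
      then show ?thesis using i0 by (subst prod.remove[of _ i0]) auto
    qed
    have "(A + B) $$ (i0, p i0) = A $$ (i0, p i0) + B $$ (i0, p i0)" if "p permutes {0..<n}" for p
      using permutes_in_image[OF that, of i0] i0 A B by simp
    then show ?thesis
      unfolding mixed_def P sum.distrib[symmetric] by (intro sum.cong) (auto simp: algebra_simps)
  qed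
  note mixed_add = this
  have D: "det (msum n {0..<n} (N(l := C))) =
      (\<Sum>k \<in> {k \<in> {0..<n} \<rightarrow>\<^sub>E {0..<n}. k ` {0..<n} = {0..<n}}. mixed n (N(l := C)) k)"
    if "C \<in> {A, B, A + B}" for C
    by (rule det_msum_bijections) (rule 0[OF _ that])
  have "C \<in> {A, B, A + B}" if "C = A \<or> C = B \<or> C = A + B" for C using that by blast
  note D = D[OF this]
  show ?thesis
    unfolding D[of A, simplified] D[of B, simplified] D[of "A + B", simplified] sum.distrib[symmetric]
    by (rule sum.cong[OF refl]) (rule mixed_add, blast)
qed

section \<open>Matrices of rank one\<close>

lemma det_mat_diag: "det (mat_diag n f) = (\<Prod>i = 0..<n. f i)"
  for f :: "nat \<Rightarrow> complex"
proof -
  have "det (mat_diag n f) = prod_list (diag_mat (mat_diag n f))"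
    by (rule det_upper_triangular[of _ n]) (auto simp: mat_diag_def upper_triangular_def)
  also have "\<dots> = (\<Prod>i = 0..<n. f i)" unfolding prod_list_diag_prod by (simp add: mat_diag_def)
  finally show ?thesis .
qed

lemma diag_sandwich_entry:
  fixes L R :: "complex mat"
  assumes "L \<in> carrier_mat n n" "R \<in> carrier_mat n n" "i < n" "j < n"
  shows "(L * (mat_diag n f * R)) $$ (i, j) = (\<Sum>l<n. L $$ (i, l) * (f l * R $$ (l, j)))"
proof -
  have "mat_diag n f * R \<in> carrier_mat n n" using assms(2) by (intro mult_carrier_mat[of _ n n]) auto
  then show ?thesis
    using assms by (subst mat_mult_entry[of _ n n _ n]) (auto simp: mat_diag_mult_left[of _ n n])
qed

text \<open>On a one-point set evaluation is a place, for which \<open>ev\<close> is truth and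
  \<open>dom\<close> is divisibility in the field. The Smith form becomes the rank normal form, with
  the zeros of d at the end.\<close>

lemma complex_diagonalize:
  fixes N :: "complex mat"
  assumes N: "N \<in> carrier_mat n n"
  obtains L R and d :: "nat \<Rightarrow> complex" where "L \<in> carrier_mat n n" "R \<in> carrier_mat n n" "det L \<noteq> 0" "det R \<noteq> 0"
    "N = L * (mat_diag n d * R)" "\<forall>i j. i \<le> j \<longrightarrow> j < n \<longrightarrow> d i = 0 \<longrightarrow> d j = 0"
proof -
  interpret P: place "\<lambda>x c. x () = c" by unfold_locales auto
  have ev: "P.ev Q \<longleftrightarrow> Q ()" for Q by (simp add: P.ev_def)
  show ?thesis
  proof (rule P.diagonalize[where M="\<lambda>_. N" and n=n, OF N])
    fix L L' R R' and d :: "nat \<Rightarrow> unit \<Rightarrow> complex"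
    assume *: "P.gl n L L'" "P.gl n R R'" "P.ev (\<lambda>w. N = L w * (mat_diag n (\<lambda>i. d i w) * R w))"
      "\<And>i j. i \<le> j \<Longrightarrow> j < n \<Longrightarrow> P.dom (d i) (d j)"
    have det: "det (L ()) \<noteq> 0" "det (R ()) \<noteq> 0"
      using det_mult[OF P.gl_carrier(1)[OF *(1), of "()"] P.gl_carrier(2)[OF *(1), of "()"]]
        det_mult[OF P.gl_carrier(1)[OF *(2), of "()"] P.gl_carrier(2)[OF *(2), of "()"]]
        P.gl_inv[OF *(1), of "()"] P.gl_inv[OF *(2), of "()"] by auto
    have d: "d j () = 0" if "i \<le> j" "j < n" "d i () = 0" for i j
      using *(4)[OF that(1,2)] that(3) by (auto simp: P.dom_def ev)
    show ?thesis
    proof (rule that[of "L ()" "R ()" "\<lambda>i. d i ()"])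
      show "N = L () * (mat_diag n (\<lambda>i. d i ()) * R ())" using *(3) by (simp add: ev)
    qed (use P.gl_carrier[OF *(1)] P.gl_carrier[OF *(2)] det d in blast)+
  qed
qed

text \<open>If \<open>N\<close> had rank at least two, then \<open>s \<mapsto> det (M + s N)\<close> would not be affine for a suitable
  diagonal \<open>M\<close> in a basis in which \<open>N\<close> is diagonal.\<close>

lemma rank_one_of_det:
  fixes N :: "complex mat"
  assumes N: "N \<in> carrier_mat n n" and n: "n \<ge> 1"
    and aff: "\<And>M. M \<in> carrier_mat n n \<Longrightarrow> det (M + N) + det (M - N) = 2 * det M"
  shows "\<exists>x y. \<forall>i<n. \<forall>j<n. N $$ (i, j) = x i * y j"
proof -
  obtain L R and d :: "nat \<Rightarrow> complex" where LR: "L \<in> carrier_mat n n" "R \<in> carrier_mat n n" "det L \<noteq> 0" "det R \<noteq> 0"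
    and N_eq: "N = L * (mat_diag n d * R)" and d': "\<forall>i j. i \<le> j \<longrightarrow> j < n \<longrightarrow> d i = 0 \<longrightarrow> d j = 0"
    using complex_diagonalize[OF N] .
  have d: "d j = 0" if "i \<le> j" "j < n" "d i = 0" for i j using d' that by blast
  have d0: "d i = 0" if "i \<ge> 1" "i < n" for i
  proof (rule ccontr)
    assume "d i \<noteq> 0"
    then have d01: "d 0 \<noteq> 0" "d 1 \<noteq> 0" and n2: "2 \<le> n" using d[of 0 i] d[of 1 i] that by auto
    \<comment> \<open>With e zero in two positions where d is not, \<open>det M\<close> vanishes and
      the other two determinants both have the factor \<open>d 0 * d 1\<close>, as the two signs
      cancel. The remaining values make the quotients of \<open>e i + d i\<close> by
      \<open>e i - d i\<close> equal to 1 or 3, so the two remaining products have a positive ratio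
      and their sum is not 0.\<close>
    define e where "e i = (if i < 2 then 0 else if d i = 0 then 1 else 2 * d i)" for i
    define M where "M = L * (mat_diag n e * R)"
    have M: "M \<in> carrier_mat n n" unfolding M_def using LR by (auto intro!: mult_carrier_mat[of _ n n _ n])
    have det_LDR: "det (L * (mat_diag n f * R)) = det L * ((\<Prod>i = 0..<n. f i) * det R)" for f
      using LR by (simp add: det_mult[of _ n] mult_carrier_mat[of _ n n _ n] det_mat_diag)
    have c: "L * (mat_diag n f * R) \<in> carrier_mat n n" for f
      using LR by (intro mult_carrier_mat[of _ n n _ n]) auto
    have plus: "M + N = L * (mat_diag n (\<lambda>i. e i + d i) * R)"
    proof (rule eq_matI)
      fix i j assume "i < dim_row (L * (mat_diag n (\<lambda>i. e i + d i) * R))"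
        "j < dim_col (L * (mat_diag n (\<lambda>i. e i + d i) * R))"
      then have ij: "i < n" "j < n" using LR by auto
      show "(M + N) $$ (i, j) = (L * (mat_diag n (\<lambda>i. e i + d i) * R)) $$ (i, j)"
        unfolding index_add_mat(1)[of i N j M, unfolded carrier_matD[OF N], OF ij] diag_sandwich_entry[OF LR(1,2) ij]
        unfolding M_def N_eq diag_sandwich_entry[OF LR(1,2) ij] sum.distrib[symmetric]
        by (rule sum.cong) (auto simp: algebra_simps)
    qed (use M N LR in auto)
    have minus: "M - N = L * (mat_diag n (\<lambda>i. e i - d i) * R)"
    proof (rule eq_matI)
      fix i j assume "i < dim_row (L * (mat_diag n (\<lambda>i. e i - d i) * R))"
        "j < dim_col (L * (mat_diag n (\<lambda>i. e i - d i) * R))"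
      then have ij: "i < n" "j < n" using LR by auto
      show "(M - N) $$ (i, j) = (L * (mat_diag n (\<lambda>i. e i - d i) * R)) $$ (i, j)"
        unfolding index_minus_mat(1)[of i N j M, unfolded carrier_matD[OF N], OF ij] diag_sandwich_entry[OF LR(1,2) ij]
        unfolding M_def N_eq diag_sandwich_entry[OF LR(1,2) ij] sum_subtractf[symmetric]
        by (rule sum.cong) (auto simp: algebra_simps)
    qed (use M N LR in auto)
    have split: "(\<Prod>i = 0..<n. f i) = f 0 * f 1 * (\<Prod>i = 2..<n. f i)" for f :: "nat \<Rightarrow> complex"
    proof -
      have "{0..<n} = insert 0 (insert 1 {2..<n})" using n2 by auto
      then show ?thesis by simp
    qed
    define c where "c i = (if d i = 0 then 1 else 3 :: real)" for i
    have "(\<Prod>i = 2..<n. e i + d i) = (\<Prod>i = 2..<n. of_real (c i) * (e i - d i))"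
      by (rule prod.cong) (auto simp: e_def c_def)
    also have "\<dots> = of_real (\<Prod>i = 2..<n. c i) * (\<Prod>i = 2..<n. e i - d i)"
      by (simp add: prod.distrib)
    finally have ratio: "(\<Prod>i = 2..<n. e i + d i) = of_real (\<Prod>i = 2..<n. c i) * (\<Prod>i = 2..<n. e i - d i)" .
    have pos: "(\<Prod>i = 2..<n. c i) > 0" by (rule prod_pos) (auto simp: c_def)
    have "(\<Prod>i = 2..<n. e i - d i) \<noteq> 0" by (auto simp: e_def)
    moreover have "complex_of_real ((\<Prod>i = 2..<n. c i) + 1) \<noteq> 0"
      using pos unfolding of_real_eq_0_iff by linarith
    moreover have "(\<Prod>i = 2..<n. e i + d i) + (\<Prod>i = 2..<n. e i - d i) =
        complex_of_real ((\<Prod>i = 2..<n. c i) + 1) * (\<Prod>i = 2..<n. e i - d i)"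
      unfolding ratio of_real_add distrib_right by simp
    ultimately have ne: "(\<Prod>i = 2..<n. e i + d i) + (\<Prod>i = 2..<n. e i - d i) \<noteq> 0"
      by (simp only: mult_eq_0_iff not_False_eq_True simp_thms)
    have "det (M + N) + det (M - N) = det L * det R * d 0 * d 1 * ((\<Prod>i = 2..<n. e i + d i) + (\<Prod>i = 2..<n. e i - d i))"
      unfolding plus minus det_LDR split by (simp add: e_def algebra_simps)
    moreover have "det M = 0" unfolding M_def det_LDR split by (simp add: e_def)
    ultimately show False using aff[OF M] LR d01 ne by auto
  qed
  have "N $$ (i, j) = (L $$ (i, 0) * d 0) * R $$ (0, j)" if ij: "i < n" "j < n" for i j
  proof -
    have "N $$ (i, j) = (\<Sum>l<n. L $$ (i, l) * (d l * R $$ (l, j)))"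
      unfolding N_eq by (rule diag_sandwich_entry[OF LR(1,2) ij])
    also have "\<dots> = (\<Sum>l\<in>{0}. L $$ (i, l) * (d l * R $$ (l, j)))"
      by (rule sum.mono_neutral_right) (use n d0 in auto)
    finally show ?thesis by simp
  qed
  then show ?thesis by meson
qed

text \<open>Every member shares its column factor or its row factor with a fixed nonzero member M0.
  If some M1 fails the first and some M2 the second, then M1 + M2 fails both.\<close>

lemma rank_one_space:
  fixes E :: "('a \<Rightarrow> 'b \<Rightarrow> complex) set"
  assumes add: "\<And>M N. M \<in> E \<Longrightarrow> N \<in> E \<Longrightarrow> (\<lambda>i j. M i j + N i j) \<in> E"
    and rk: "\<And>M. M \<in> E \<Longrightarrow> \<exists>x y. \<forall>i\<in>I. \<forall>j\<in>J. M i j = x i * y j"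
  shows "(\<exists>x. \<forall>M\<in>E. \<exists>y. \<forall>i\<in>I. \<forall>j\<in>J. M i j = x i * y j) \<or>
         (\<exists>y. \<forall>M\<in>E. \<exists>x. \<forall>i\<in>I. \<forall>j\<in>J. M i j = x i * y j)"
proof (rule ccontr)
  assume neg: "\<not> ?thesis"
  have minor: "M i j * M i' j' = M i j' * M i' j" if "M \<in> E" "i \<in> I" "i' \<in> I" "j \<in> J" "j' \<in> J" for M i i' j j'
    using rk[OF that(1)] that by (auto simp: algebra_simps)
  have "\<exists>M0\<in>E. \<exists>a\<in>I. \<exists>b\<in>J. M0 a b \<noteq> 0"
  proof (rule ccontr)
    assume "\<not> ?thesis"
    then have "\<exists>x. \<forall>M\<in>E. \<exists>y. \<forall>i\<in>I. \<forall>j\<in>J. M i j = x i * y j" by (intro exI[of _ "\<lambda>_. 0"]) auto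
    then show False using neg by blast
  qed
  then obtain M0 a b where M0: "M0 \<in> E" "a \<in> I" "b \<in> J" "M0 a b \<noteq> 0" by auto
  define x0 where "x0 i = M0 i b" for i
  define y0 where "y0 j = M0 a j / M0 a b" for j
  have M0_eq: "M0 i j = x0 i * y0 j" if "i \<in> I" "j \<in> J" for i j
    using minor[OF M0(1) that(1) M0(2) that(2) M0(3)] M0(4) by (simp add: x0_def y0_def field_simps)
  have x0a: "x0 a \<noteq> 0" and y0b: "y0 b = 1" using M0 by (auto simp: x0_def y0_def)
  have dich: "(\<forall>i\<in>I. \<forall>j\<in>J. M i j * x0 a = x0 i * M a j) \<or> (\<forall>i\<in>I. \<forall>j\<in>J. M i j = M i b * y0 j)"
    if M: "M \<in> E" for M
  proof (rule ccontr)
    assume c: "\<not> ?thesis"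
    obtain x y where xy: "\<And>i j. i \<in> I \<Longrightarrow> j \<in> J \<Longrightarrow> M i j = x i * y j" using rk[OF M] by blast
    obtain i1 j1 where 1: "i1 \<in> I" "j1 \<in> J" "M i1 j1 * x0 a \<noteq> x0 i1 * M a j1" using c by blast
    obtain i2 j2 where 2: "i2 \<in> I" "j2 \<in> J" "M i2 j2 \<noteq> M i2 b * y0 j2" using c by blast
    have x1: "x i1 * x0 a \<noteq> x0 i1 * x a" using 1 xy M0 by auto
    have y2: "y j2 \<noteq> y b * y0 j2" using 2 xy M0 by auto
    \<comment> \<open>A vanishing minor of M0 + M. The minors of M0 and of M drop out, and the mixed
      terms factor into the two differences known to be nonzero.\<close>
    have "(M0 i1 j2 + M i1 j2) * (M0 a b + M a b) = (M0 i1 b + M i1 b) * (M0 a j2 + M a j2)"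
      using minor[OF add[OF M0(1) M], of i1 a j2 b] 1 2 M0 by simp
    then have "(x0 i1 * y0 j2 + x i1 * y j2) * (x0 a + x a * y b) = (x0 i1 + x i1 * y b) * (x0 a * y0 j2 + x a * y j2)"
      using 1 2 M0 xy M0_eq y0b by simp
    then have "(x i1 * x0 a - x0 i1 * x a) * (y j2 - y b * y0 j2) = 0"
      by (simp add: algebra_simps)
    then show False using x1 y2 by simp
  qed
  obtain M1 where M1: "M1 \<in> E" "\<not> (\<forall>i\<in>I. \<forall>j\<in>J. M1 i j * x0 a = x0 i * M1 a j)"
  proof -
    have "\<exists>M1\<in>E. \<not> (\<forall>i\<in>I. \<forall>j\<in>J. M1 i j * x0 a = x0 i * M1 a j)"
    proof (rule ccontr)
      assume "\<not> ?thesis"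
      then have *: "M i j = x0 i * (M a j / x0 a)" if "M \<in> E" "i \<in> I" "j \<in> J" for M i j
        using that x0a by (auto simp: field_simps)
      have "\<forall>M\<in>E. \<exists>y. \<forall>i\<in>I. \<forall>j\<in>J. M i j = x0 i * y j"
      proof
        fix M assume "M \<in> E"
        then show "\<exists>y. \<forall>i\<in>I. \<forall>j\<in>J. M i j = x0 i * y j"
          using * by (intro exI[of _ "\<lambda>j. M a j / x0 a"]) blast
      qed
      then show False using neg by blast
    qed
    then show ?thesis using that by blast
  qed
  obtain M2 where M2: "M2 \<in> E" "\<not> (\<forall>i\<in>I. \<forall>j\<in>J. M2 i j = M2 i b * y0 j)"
  proof -
    have "\<exists>M2\<in>E. \<not> (\<forall>i\<in>I. \<forall>j\<in>J. M2 i j = M2 i b * y0 j)"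
    proof (rule ccontr)
      assume "\<not> ?thesis"
      then have *: "M i j = M i b * y0 j" if "M \<in> E" "i \<in> I" "j \<in> J" for M i j using that by blast
      have "\<forall>M\<in>E. \<exists>x. \<forall>i\<in>I. \<forall>j\<in>J. M i j = x i * y0 j"
      proof
        fix M assume "M \<in> E"
        then show "\<exists>x. \<forall>i\<in>I. \<forall>j\<in>J. M i j = x i * y0 j"
          using * by (intro exI[of _ "\<lambda>i. M i b"]) blast
      qed
      then show False using neg by blast
    qed
    then show ?thesis using that by blast
  qed
  have 1: "M1 i j = M1 i b * y0 j" if "i \<in> I" "j \<in> J" for i j using dich[OF M1(1)] M1(2) that by blast
  have 2: "M2 i j * x0 a = x0 i * M2 a j" if "i \<in> I" "j \<in> J" for i j using dich[OF M2(1)] M2(2) that by blast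
  from dich[OF add[OF M1(1) M2(1)]] show False
  proof
    assume *: "\<forall>i\<in>I. \<forall>j\<in>J. (M1 i j + M2 i j) * x0 a = x0 i * (M1 a j + M2 a j)"
    have "M1 i j * x0 a = x0 i * M1 a j" if ij: "i \<in> I" "j \<in> J" for i j
    proof -
      have "(M1 i j + M2 i j) * x0 a = x0 i * (M1 a j + M2 a j)" using * ij by blast
      then show ?thesis using 2[OF ij] by (simp add: algebra_simps)
    qed
    then show False using M1(2) by blast
  next
    assume *: "\<forall>i\<in>I. \<forall>j\<in>J. M1 i j + M2 i j = (M1 i b + M2 i b) * y0 j"
    have "M2 i j = M2 i b * y0 j" if ij: "i \<in> I" "j \<in> J" for i j
    proof -
      have "M1 i j + M2 i j = (M1 i b + M2 i b) * y0 j" using * ij by blast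
      then show ?thesis using 1[OF ij] by (simp add: algebra_simps)
    qed
    then show False using M2(2) by blast
  qed
qed

lemma det_zero_row:
  assumes A: "A \<in> carrier_mat n n" and k: "k < n" and z: "\<And>j. j < n \<Longrightarrow> A $$ (k, j) = 0"
  shows "det A = (0 :: complex)"
  unfolding det_def'[OF A]
proof (intro sum.neutral ballI)
  fix p assume "p \<in> {p. p permutes {0..<n}}"
  then have "p k < n" using permutes_in_image[of p "{0..<n}" k] k by auto
  then have "\<exists>i\<in>{0..<n}. A $$ (i, p i) = 0" using k z by (intro bexI[of _ k]) auto
  then show "signof p * (\<Prod>i = 0..<n. A $$ (i, p i)) = 0"
    by (simp only: prod_zero finite_atLeastLessThan mult_zero_right)
qed

text \<open>The n + 1 vectors are the columns of a matrix that is made square, and thereby singular,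
  by a row of zeros.\<close>

lemma linear_dependence:
  fixes v :: "nat \<Rightarrow> nat \<Rightarrow> complex"
  obtains c where "\<exists>p\<le>n. c p \<noteq> 0" "\<And>i. i < n \<Longrightarrow> (\<Sum>p\<le>n. c p * v p i) = 0"
proof -
  define A where "A = mat (Suc n) (Suc n) (\<lambda>(i, p). if i < n then v p i else 0)"
  have A: "A \<in> carrier_mat (Suc n) (Suc n)" by (simp add: A_def)
  have "det A = 0" by (rule det_zero_row[OF A, of n]) (auto simp: A_def)
  then obtain x where x: "x \<in> carrier_vec (Suc n)" "x \<noteq> 0\<^sub>v (Suc n)" "A *\<^sub>v x = 0\<^sub>v (Suc n)"
    using det_0_iff_vec_prod_zero_field[OF A] by blast
  have "\<exists>p\<le>n. x $ p \<noteq> 0" using x(1,2) by (metis carrier_vecD eq_vecI index_zero_vec less_Suc_eq_le)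
  moreover have "(\<Sum>p\<le>n. x $ p * v p i) = 0" if "i < n" for i
  proof -
    have "(A *\<^sub>v x) $ i = (\<Sum>p\<le>n. v p i * x $ p)"
      using x(1) that A by (simp add: scalar_prod_def A_def atLeast0AtMost[symmetric] atLeastLessThanSuc_atLeastAtMost)
    then show ?thesis using x(3) that by (simp add: mult.commute)
  qed
  ultimately show ?thesis using that by blast
qed

section \<open>Linear maps preserving singularity\<close>

type_synonym tensor = "nat \<Rightarrow> nat \<Rightarrow> nat \<Rightarrow> complex"

text \<open>Entries outside the range vanish, so that equality of tensors is equality of
  functions.\<close>

definition tensors :: "nat \<Rightarrow> nat \<Rightarrow> tensor set" where
  "tensors n m = {T. \<forall>i j l. \<not> (i < n \<and> j < n \<and> l < m) \<longrightarrow> T i j l = 0}"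

definition tplus :: "tensor \<Rightarrow> tensor \<Rightarrow> tensor" where
  "tplus S T = (\<lambda>i j l. S i j l + T i j l)"

definition tscale :: "complex \<Rightarrow> tensor \<Rightarrow> tensor" where
  "tscale c T = (\<lambda>i j l. c * T i j l)"

definition flip :: "tensor \<Rightarrow> tensor" where
  "flip T = (\<lambda>i j l. T j i l)"

definition tsum :: "'i set \<Rightarrow> ('i \<Rightarrow> tensor) \<Rightarrow> tensor" where
  "tsum I F = (\<lambda>i j l. \<Sum>a\<in>I. F a i j l)"

definition comb :: "nat \<Rightarrow> nat \<Rightarrow> (nat \<Rightarrow> complex) \<Rightarrow> tensor \<Rightarrow> complex mat" where
  "comb n m t T = mat n n (\<lambda>(i, j). \<Sum>l<m. t l * T i j l)"

definition nz :: "nat \<Rightarrow> (nat \<Rightarrow> complex) \<Rightarrow> bool" where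
  "nz n u \<longleftrightarrow> (\<exists>i<n. u i \<noteq> 0)"

definition row_degenerate :: "nat \<Rightarrow> nat \<Rightarrow> tensor \<Rightarrow> bool" where
  "row_degenerate n m T \<longleftrightarrow> (\<exists>u. nz n u \<and> (\<forall>j<n. \<forall>l<m. (\<Sum>i<n. u i * T i j l) = 0))"

text \<open>A tensor of rank one when column and slice index are grouped together: u in the row
  direction times an arbitrary n x m array.\<close>

definition outer :: "nat \<Rightarrow> nat \<Rightarrow> (nat \<Rightarrow> complex) \<Rightarrow> (nat \<Rightarrow> nat \<Rightarrow> complex) \<Rightarrow> tensor" where
  "outer n m u z = (\<lambda>i j l. if i < n \<and> j < n \<and> l < m then u i * z j l else 0)"

definition linear_on :: "nat \<Rightarrow> nat \<Rightarrow> (tensor \<Rightarrow> tensor) \<Rightarrow> bool" where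
  "linear_on n m h \<longleftrightarrow>
     (\<forall>T\<in>tensors n m. h T \<in> tensors n m \<and> (\<forall>c. h (tscale c T) = tscale c (h T)) \<and>
        (\<forall>S\<in>tensors n m. h (tplus S T) = tplus (h S) (h T)))"

text \<open>A consequence of the preservation of SING that speaks of complex numbers alone: the
  sources are singular for an elementary reason, a common left or right null vector of the slices,
  and the conclusion concerns complex combinations.\<close>

definition keeps_singular :: "nat \<Rightarrow> nat \<Rightarrow> (tensor \<Rightarrow> tensor) \<Rightarrow> bool" where
  "keeps_singular n m h \<longleftrightarrow>
     (\<forall>T\<in>tensors n m. row_degenerate n m T \<or> row_degenerate n m (flip T) \<longrightarrow>
        (\<forall>t. det (comb n m t (h T)) = 0))"

definition good :: "nat \<Rightarrow> nat \<Rightarrow> (tensor \<Rightarrow> tensor) \<Rightarrow> (tensor \<Rightarrow> tensor) \<Rightarrow> bool" where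
  "good n m h h' \<longleftrightarrow> linear_on n m h \<and> linear_on n m h' \<and>
     (\<forall>T\<in>tensors n m. h (h' T) = T \<and> h' (h T) = T) \<and> keeps_singular n m h \<and> keeps_singular n m h'"

lemma flip_flip [simp]: "flip (flip T) = T" by (simp add: flip_def)
lemma flip_apply: "flip T i j l = T j i l" by (simp add: flip_def)
lemma flip_tensors [simp]: "flip T \<in> tensors n m \<longleftrightarrow> T \<in> tensors n m"
  by (auto simp: tensors_def flip_def)
lemma flip_tplus: "flip (tplus S T) = tplus (flip S) (flip T)" by (simp add: flip_def tplus_def)
lemma flip_tscale: "flip (tscale c T) = tscale c (flip T)" by (simp add: flip_def tscale_def)
lemma outer_tensors [simp]: "outer n m u z \<in> tensors n m" by (simp add: outer_def tensors_def)
lemma tplus_tensors [simp]: "S \<in> tensors n m \<Longrightarrow> T \<in> tensors n m \<Longrightarrow> tplus S T \<in> tensors n m"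
  by (auto simp: tensors_def tplus_def)
lemma tscale_tensors [simp]: "T \<in> tensors n m \<Longrightarrow> tscale c T \<in> tensors n m"
  by (auto simp: tensors_def tscale_def)
lemma tsum_tensors [simp]: "(\<And>a. a \<in> I \<Longrightarrow> F a \<in> tensors n m) \<Longrightarrow> tsum I F \<in> tensors n m"
  by (auto simp: tensors_def tsum_def intro!: sum.neutral)
lemma comb_carrier [simp]: "comb n m t T \<in> carrier_mat n n" by (simp add: comb_def)

lemma tensor_eqI:
  "S \<in> tensors n m \<Longrightarrow> T \<in> tensors n m \<Longrightarrow>
   (\<And>i j l. i < n \<Longrightarrow> j < n \<Longrightarrow> l < m \<Longrightarrow> S i j l = T i j l) \<Longrightarrow> S = T"
  unfolding tensors_def fun_eq_iff by (metis (mono_tags, lifting) mem_Collect_eq)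

lemma comb_flip: "comb n m t (flip T) = (comb n m t T)\<^sup>T"
  by (rule eq_matI) (auto simp: comb_def flip_def)

lemma det_comb_flip: "det (comb n m t (flip T)) = det (comb n m t T)"
  unfolding comb_flip by (rule det_transpose[OF comb_carrier])

lemma comb_tplus: "comb n m t (tplus S T) = comb n m t S + comb n m t T"
  by (rule eq_matI) (auto simp: comb_def tplus_def algebra_simps sum.distrib)

lemma comb_tsum: "comb n m t (tsum I F) = msum n I (\<lambda>a. comb n m t (F a))"
  by (rule eq_matI) (auto simp: comb_def tsum_def msum_def sum_distrib_left sum.swap[of _ "{..<m}" I])

lemma outer_tplus: "tplus (outer n m u y) (outer n m u z) = outer n m u (\<lambda>j l. y j l + z j l)"
  by (auto simp: outer_def tplus_def fun_eq_iff algebra_simps)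

lemma outer_tscale: "tscale c (outer n m u y) = outer n m u (\<lambda>j l. c * y j l)"
  by (auto simp: outer_def tscale_def fun_eq_iff algebra_simps)

context
  fixes n m :: nat
begin

lemma linear_tsum:
  fixes F :: "'i \<Rightarrow> tensor"
  assumes h: "linear_on n m h" and F: "\<And>a. a \<in> I \<Longrightarrow> F a \<in> tensors n m" and "finite I"
  shows "h (tsum I F) = tsum I (\<lambda>a. h (F a))"
  using \<open>finite I\<close> F
proof (induction I rule: finite_induct)
  case empty
  have z: "tsum {} F = tscale 0 (\<lambda>_ _ _. 0)" "(\<lambda>_ _ _. 0) \<in> tensors n m" for F :: "'i \<Rightarrow> tensor"
    by (auto simp: tsum_def tscale_def tensors_def)
  then have "h (tsum {} F) = tscale 0 (h (\<lambda>_ _ _. 0))"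
    using h unfolding linear_on_def by metis
  then show ?case by (simp add: tscale_def tsum_def)
next
  case (insert a I)
  have i: "tsum (insert a I) G = tplus (G a) (tsum I G)" for G :: "'i \<Rightarrow> tensor"
    using insert by (simp add: tsum_def tplus_def)
  have "tsum I F \<in> tensors n m" "F a \<in> tensors n m" using insert by auto
  then have "h (tsum (insert a I) F) = tplus (h (F a)) (h (tsum I F))"
    using h unfolding linear_on_def i by metis
  then show ?case using insert i by auto
qed

lemma linearD:
  assumes "linear_on n m h"
  shows "T \<in> tensors n m \<Longrightarrow> h T \<in> tensors n m" "T \<in> tensors n m \<Longrightarrow> h (tscale c T) = tscale c (h T)"
    "S \<in> tensors n m \<Longrightarrow> T \<in> tensors n m \<Longrightarrow> h (tplus S T) = tplus (h S) (h T)"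
  using assms by (auto simp: linear_on_def)

lemma good_swap: "good n m h h' \<Longrightarrow> good n m h' h"
  by (simp add: good_def)

lemma good_flip_left: "good n m h h' \<Longrightarrow> good n m (flip \<circ> h) (h' \<circ> flip)"
  unfolding good_def linear_on_def keeps_singular_def
  by (auto simp: flip_tplus flip_tscale det_comb_flip)

lemma good_flip_right: "good n m h h' \<Longrightarrow> good n m (h \<circ> flip) (flip \<circ> h')"
  using good_flip_left good_swap by blast

text \<open>\<open>b\<close> is the standard basis with its k-th member replaced by u, and x is up
  to a factor the p-th member of the dual basis.\<close>

lemma nz_annihilator:
  assumes k: "k < n" "u k \<noteq> 0" and p: "p < n"
  defines "b \<equiv> (\<lambda>i. if i = k then u else (\<lambda>a. if a = i then 1 else 0))"
  obtains x where "nz n x" "\<And>i. i < n \<Longrightarrow> i \<noteq> p \<Longrightarrow> (\<Sum>a<n. x a * b i a) = 0"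
proof (cases "p = k")
  case True
  show ?thesis
  proof (rule that[of "\<lambda>a. if a = k then 1 else 0"])
    show "(\<Sum>a<n. (if a = k then 1 else 0) * b i a) = 0" if "i < n" "i \<noteq> p" for i
      by (rule sum.neutral) (use True that in \<open>auto simp: b_def\<close>)
  qed (use k in \<open>auto simp: nz_def\<close>)
next
  case False
  define x where "x a = (if a = p then 1 else 0) - (if a = k then u p / u k else 0)" for a
  have s: "(\<Sum>a<n. x a * f a) = f p - u p / u k * f k" for f
  proof -
    have "(\<Sum>a<n. x a * f a) = (\<Sum>a<n. (if a = p then f a else 0)) - (\<Sum>a<n. if a = k then u p / u k * f a else 0)"
      unfolding sum_subtractf[symmetric] by (rule sum.cong) (auto simp: x_def algebra_simps)
    then show ?thesis using k p by simp
  qed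
  show ?thesis
  proof (rule that[of x])
    show "nz n x" unfolding nz_def using p False by (auto simp: x_def)
    show "(\<Sum>a<n. x a * b i a) = 0" if "i < n" "i \<noteq> p" for i
      unfolding s using that k by (auto simp: b_def)
  qed
qed

text \<open>For t not zero, any M is the combination of the image of some X. Split X along a basis
  containing u. A sum over fewer than n of the parts has a common left null vector, so its image is
  singular, and by \<open>det_msum_additive\<close> the determinant is additive in the part along u.
  This gives the affine behaviour that \<open>rank_one_of_det\<close> asks for.\<close>

lemma rank_one_image:
  assumes g: "good n m h h'" and u: "nz n u" and n: "n \<ge> 1"
  shows "\<exists>x y. \<forall>i<n. \<forall>j<n. comb n m t (h (outer n m u z)) $$ (i, j) = x i * y j"
proof (rule rank_one_of_det[OF comb_carrier n])
  fix M :: "complex mat" assume M: "M \<in> carrier_mat n n"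
  from g have h: "linear_on n m h" and h': "linear_on n m h'"
    and hh': "\<And>T. T \<in> tensors n m \<Longrightarrow> h (h' T) = T" and ks: "keeps_singular n m h"
    by (auto simp: good_def)
  let ?Y = "comb n m t (h (outer n m u z))"
  show "det (M + ?Y) + det (M - ?Y) = 2 * det M"
  proof (cases "\<exists>l<m. t l \<noteq> 0")
    case False
    then have "?Y = 0\<^sub>m n n" by (intro eq_matI) (auto simp: comb_def intro!: sum.neutral)
    moreover have "M - 0\<^sub>m n n = M" by (rule eq_matI) (use M in auto)
    ultimately show ?thesis using M by (simp add: right_add_zero_mat[of _ n n])
  next
    case True
    then obtain l0 where l0: "l0 < m" "t l0 \<noteq> 0" by auto
    define X0 :: tensor where "X0 = (\<lambda>i j l. if i < n \<and> j < n \<and> l = l0 then M $$ (i, j) / t l0 else 0)"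
    have X0: "X0 \<in> tensors n m" using l0 by (auto simp: X0_def tensors_def)
    have cX0: "comb n m t X0 = M"
    proof (rule eq_matI)
      fix i j assume "i < dim_row M" "j < dim_col M"
      then have "i < n" "j < n" using M by auto
      moreover have "(\<Sum>l<m. t l * X0 i j l) = (\<Sum>l\<in>{l0}. t l * X0 i j l)"
        by (rule sum.mono_neutral_right) (use l0 in \<open>auto simp: X0_def\<close>)
      ultimately show "comb n m t X0 $$ (i, j) = M $$ (i, j)"
        using l0 by (simp add: comb_def X0_def)
    qed (use M in \<open>auto simp: comb_def\<close>)
    define X where "X = h' X0"
    have X: "X \<in> tensors n m" and hX: "h X = X0" using linearD(1)[OF h'] hh' X0 by (auto simp: X_def)
    obtain k where k: "k < n" "u k \<noteq> 0" using u by (auto simp: nz_def)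
    define b where "b = (\<lambda>i. if i = k then u else (\<lambda>a. if a = i then 1 else 0))"
    \<comment> \<open>The coordinates of X in the basis \<open>b\<close>: X is the sum of the
      tensors \<open>outer n m (b i) (\<zeta> i)\<close>.\<close>
    define \<zeta> where "\<zeta> = (\<lambda>i. if i = k then (\<lambda>j l. X k j l / u k) else (\<lambda>j l. X i j l - u i / u k * X k j l))"
    define Z where "Z y i = (if i = k then outer n m u y else outer n m (b i) (\<zeta> i))" for y i
    define N where "N i = comb n m t (h (outer n m (b i) (\<zeta> i)))" for i
    define C where "C y = comb n m t (h (outer n m u y))" for y
    have Zrow: "Z y i = outer n m (b i) ((\<zeta>(k := y)) i)" for y i by (auto simp: Z_def b_def)
    have msum: "msum n I (N(k := C y)) = comb n m t (h (tsum I (Z y)))" if "I \<subseteq> {0..<n}" for I y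
    proof -
      have "finite I" using that finite_subset by blast
      then have "h (tsum I (Z y)) = tsum I (\<lambda>a. h (Z y a))"
        by (intro linear_tsum[OF h]) (auto simp: Z_def)
      moreover have "N(k := C y) = (\<lambda>a. comb n m t (h (Z y a)))"
        by (auto simp: N_def C_def Z_def fun_eq_iff)
      ultimately show ?thesis by (simp add: comb_tsum)
    qed
    have zero: "det (msum n I (N(k := C y))) = 0" if I: "I \<subset> {0..<n}" for I y
    proof -
      from I obtain p where "p \<in> {0..<n}" and p: "p \<notin> I" by blast
      then have p: "p < n" "p \<notin> I" by auto
      from I have fin: "finite I" "I \<subseteq> {0..<n}" using finite_subset by blast+
      obtain x where x: "nz n x" "\<And>i. i < n \<Longrightarrow> i \<noteq> p \<Longrightarrow> (\<Sum>a<n. x a * b i a) = 0"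
        using nz_annihilator[where k=k and u=u and p=p, OF k p(1)] unfolding b_def by blast
      have "(\<Sum>a<n. x a * tsum I (Z y) a j l) = 0" if "j < n" "l < m" for j l
      proof -
        have "(\<Sum>a<n. x a * tsum I (Z y) a j l) = (\<Sum>a<n. \<Sum>i\<in>I. x a * b i a * (\<zeta>(k := y)) i j l)"
          unfolding tsum_def sum_distrib_left Zrow using that by (intro sum.cong) (auto simp: outer_def algebra_simps)
        also have "\<dots> = (\<Sum>i\<in>I. (\<Sum>a<n. x a * b i a) * (\<zeta>(k := y)) i j l)"
          unfolding sum_distrib_right by (rule sum.swap)
        also have "\<dots> = 0" by (rule sum.neutral) (use x(2) p fin in \<open>auto simp: subset_iff\<close>)
        finally show ?thesis .
      qed
      then have "row_degenerate n m (tsum I (Z y))" unfolding row_degenerate_def using x(1) by blast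
      moreover have "tsum I (Z y) \<in> tensors n m" by (auto simp: Z_def)
      ultimately have "det (comb n m t (h (tsum I (Z y)))) = 0" using ks unfolding keeps_singular_def by blast
      then show ?thesis using msum[OF fin(2)] by simp
    qed
    have CC: "C (\<lambda>j l. y j l + y' j l) = C y + C y'" for y y'
      unfolding C_def outer_tplus[symmetric] by (simp add: linearD[OF h] comb_tplus)
    have Ccar: "C y \<in> carrier_mat n n" for y by (simp add: C_def)
    define D where "D y = det (msum n {0..<n} (N(k := C y)))" for y
    have add: "D (\<lambda>j l. y j l + y' j l) = D y + D y'" for y y'
      unfolding D_def CC
      by (rule det_msum_additive[OF Ccar Ccar k(1)]) (use zero CC[of y y', symmetric] in auto)
    have Dk: "D y = det (comb n m t (h (tsum {0..<n} (Z y))))" for y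
      unfolding D_def using msum[of "{0..<n}" y] by simp
    have X_eq: "tplus X (outer n m u y) = tsum {0..<n} (Z (\<lambda>j l. \<zeta> k j l + y j l))" for y
    proof (rule tensor_eqI[of _ n m])
      fix i j l assume ij: "i < n" "j < n" "l < m"
      have "tsum {0..<n} (Z (\<lambda>j l. \<zeta> k j l + y j l)) i j l =
         Z (\<lambda>j l. \<zeta> k j l + y j l) k i j l + (\<Sum>a\<in>{0..<n} - {k}. Z (\<lambda>j l. \<zeta> k j l + y j l) a i j l)"
        unfolding tsum_def using k by (intro sum.remove) auto
      also have "(\<Sum>a\<in>{0..<n} - {k}. Z (\<lambda>j l. \<zeta> k j l + y j l) a i j l) =
         (\<Sum>a\<in>{0..<n} - {k}. if a = i then \<zeta> i j l else 0)"
        by (rule sum.cong) (use ij in \<open>auto simp: Z_def outer_def b_def\<close>)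
      also have "\<dots> = (if i = k then 0 else \<zeta> i j l)" using ij by simp
      finally show "tplus X (outer n m u y) i j l = tsum {0..<n} (Z (\<lambda>j l. \<zeta> k j l + y j l)) i j l"
        using ij k by (simp only:) (cases "i = k", simp_all add: Z_def outer_def tplus_def \<zeta>_def field_simps)
    qed (use X in \<open>auto simp: Z_def\<close>)
    have det_eq: "det (comb n m t (h (tplus X (outer n m u y)))) = D (\<zeta> k) + D y" for y
      unfolding X_eq Dk[symmetric] by (rule add)
    have hp: "comb n m t (h (tplus X (outer n m u y))) = M + C y" for y
      using X by (simp add: linearD[OF h] comb_tplus hX cX0 C_def)
    have z0: "D (\<lambda>j l. 0) = 0" using add[of "\<lambda>j l. 0" "\<lambda>j l. 0"] by simp
    have C0: "M + C (\<lambda>j l. 0) = M"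
    proof -
      have "outer n m u (\<lambda>j l. 0) = tscale 0 (outer n m u (\<lambda>j l. 0))" by (auto simp: outer_def tscale_def fun_eq_iff)
      then have "h (outer n m u (\<lambda>j l. 0)) = tscale 0 (h (outer n m u (\<lambda>j l. 0)))"
        using linearD(2)[OF h outer_tensors] by metis
      then have "h (outer n m u (\<lambda>j l. 0)) = (\<lambda>_ _ _. 0)" by (simp add: tscale_def)
      then have "C (\<lambda>j l. 0) = 0\<^sub>m n n" by (intro eq_matI) (auto simp: C_def comb_def)
      then show ?thesis using M by (simp add: right_add_zero_mat[of _ n n])
    qed
    have neg: "M - ?Y = M + C (\<lambda>j l. - z j l)"
    proof -
      have "C z + C (\<lambda>j l. - z j l) = C (\<lambda>j l. 0)" unfolding CC[symmetric] by simp
      then have "M + (C z + C (\<lambda>j l. - z j l)) = M" using C0 by simp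
      then show ?thesis using M Ccar[of z] Ccar[of "\<lambda>j l. - z j l"]
        unfolding C_def[of z, symmetric] mat_eq_iff by (auto simp: algebra_simps)
    qed
    have "det (M + ?Y) = D (\<zeta> k) + D z" using det_eq[of z] hp[of z] by (simp add: C_def)
    moreover have "det (M - ?Y) = D (\<zeta> k) + D (\<lambda>j l. - z j l)" using det_eq hp neg by simp
    moreover have "det M = D (\<zeta> k)" using det_eq[of "\<lambda>j l. 0"] hp[of "\<lambda>j l. 0"] C0 z0 by simp
    moreover have "D z + D (\<lambda>j l. - z j l) = 0" using add[of z "\<lambda>j l. - z j l"] z0 by simp
    ultimately show ?thesis by (simp add: algebra_simps)
  qed
qed

end

section \<open>Row and column spaces under a preserver\<close>

definition rowmap :: "nat \<Rightarrow> nat \<Rightarrow> (tensor \<Rightarrow> tensor) \<Rightarrow> (nat \<Rightarrow> complex) \<Rightarrow> (nat \<Rightarrow> complex) \<Rightarrow> bool" where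
  "rowmap n m h u v \<longleftrightarrow> (\<forall>z. \<exists>y. h (outer n m u z) = outer n m v y)"

definition unit :: "nat \<Rightarrow> nat \<Rightarrow> complex" where
  "unit i = (\<lambda>a. if a = i then 1 else 0)"

definition unit2 :: "nat \<Rightarrow> nat \<Rightarrow> nat \<Rightarrow> nat \<Rightarrow> complex" where
  "unit2 j l = (\<lambda>b k. if b = j \<and> k = l then 1 else 0)"

definition act :: "nat \<Rightarrow> nat \<Rightarrow> (nat \<Rightarrow> nat \<Rightarrow> complex) \<Rightarrow> (nat \<Rightarrow> nat \<Rightarrow> complex) \<Rightarrow>
    (nat \<Rightarrow> nat \<Rightarrow> complex) \<Rightarrow> tensor \<Rightarrow> tensor" where
  "act n m P Q A T = (\<lambda>a b k. if a < n \<and> b < n \<and> k < m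
     then \<Sum>i<n. \<Sum>j<n. \<Sum>l<m. P a i * Q b j * A k l * T i j l else 0)"

lemma outer_apply: "i < n \<Longrightarrow> j < n \<Longrightarrow> l < m \<Longrightarrow> outer n m u z i j l = u i * z j l"
  by (simp add: outer_def)

lemma outer_rescale: "(\<And>i. i < n \<Longrightarrow> u i = c * v i) \<Longrightarrow> outer n m u z = outer n m v (\<lambda>j l. c * z j l)"
  by (auto simp: outer_def fun_eq_iff)

lemma outer_eq_parallel:
  assumes "outer n m u z = outer n m v y" "outer n m u z \<noteq> (\<lambda>_ _ _. 0)"
  obtains c where "c \<noteq> 0" "\<And>i. i < n \<Longrightarrow> u i = c * v i"
proof -
  from assms(2) obtain i j l where ijl: "i < n" "j < n" "l < m" "u i \<noteq> 0" "z j l \<noteq> 0"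
    by (auto simp: outer_def fun_eq_iff split: if_splits)
  have eq: "u a * z j l = v a * y j l" if "a < n" for a
    using fun_cong[OF fun_cong[OF fun_cong[OF assms(1), of a], of j], of l] that ijl by (simp add: outer_def)
  show ?thesis
  proof (rule that[of "y j l / z j l"])
    show "y j l / z j l \<noteq> 0" using eq[OF ijl(1)] ijl by auto
    show "u i = y j l / z j l * v i" if "i < n" for i using eq[OF that] ijl by (simp add: field_simps)
  qed
qed

text \<open>Rank at most one of the matrix with rows i and columns (j, l), expressed by minors so
  that the condition is polynomial along a line of tensors.\<close>

lemma outer_iff_minors:
  assumes T: "T \<in> tensors n m"
  shows "(\<exists>v y. T = outer n m v y) \<longleftrightarrow>
    (\<forall>i<n. \<forall>i'<n. \<forall>j<n. \<forall>j'<n. \<forall>l<m. \<forall>l'<m. T i j l * T i' j' l' - T i j' l' * T i' j l = 0)"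
    (is "?L \<longleftrightarrow> ?R")
proof
  assume ?L
  then obtain v y where "T = outer n m v y" by blast
  then show ?R by (auto simp: outer_def)
next
  assume R: ?R
  show ?L
  proof (cases "\<exists>i<n. \<exists>j<n. \<exists>l<m. T i j l \<noteq> 0")
    case False
    then have "T = outer n m (\<lambda>_. 0) (\<lambda>_ _. 0)" by (intro tensor_eqI[OF T outer_tensors]) (auto simp: outer_def)
    then show ?thesis by blast
  next
    case True
    then obtain a b c where abc: "a < n" "b < n" "c < m" "T a b c \<noteq> 0" by blast
    have "T = outer n m (\<lambda>i. T i b c) (\<lambda>j l. T a j l / T a b c)"
    proof (rule tensor_eqI[OF T outer_tensors])
      fix i j l assume ijl: "i < n" "j < n" "l < m"
      then have "T i j l * T a b c - T i b c * T a j l = 0" using R abc by blast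
      then show "T i j l = outer n m (\<lambda>i. T i b c) (\<lambda>j l. T a j l / T a b c) i j l"
        using ijl abc by (simp add: outer_def field_simps)
    qed
    then show ?thesis by blast
  qed
qed

text \<open>A common left factor w of the transposed tensors would make the columns of all arrays z
  parallel to w, which two different unit arrays contradict.\<close>

lemma no_row_in_column:
  assumes u: "nz n u" and n: "n \<ge> 2" and m: "m \<ge> 1"
    and w: "\<And>z. \<exists>y. flip (outer n m u z) = outer n m w y"
  shows False
proof -
  obtain j where j: "j < n" "u j \<noteq> 0" using u by (auto simp: nz_def)
  obtain y where y: "flip (outer n m u (unit2 0 0)) = outer n m w y" using w by blast
  obtain y' where y': "flip (outer n m u (unit2 1 0)) = outer n m w y'" using w by blast
  have 1: "u j * unit2 0 0 i 0 = w i * y j 0" if "i < n" for i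
    using fun_cong[OF fun_cong[OF fun_cong[OF y, of i], of j], of 0] that j m by (simp add: outer_def flip_def)
  have 2: "u j * unit2 1 0 i 0 = w i * y' j 0" if "i < n" for i
    using fun_cong[OF fun_cong[OF fun_cong[OF y', of i], of j], of 0] that j m by (simp add: outer_def flip_def)
  have "w 1 = 0" using 1[of 0] 1[of 1] n j by (auto simp: unit2_def)
  then show False using 2[of 1] n j by (auto simp: unit2_def)
qed

context
  fixes n m :: nat
  assumes n: "n \<ge> 2" and m: "m \<ge> 2"
begin

lemma goodD:
  assumes "good n m h h'"
  shows "linear_on n m h" "linear_on n m h'" "T \<in> tensors n m \<Longrightarrow> h (h' T) = T" "T \<in> tensors n m \<Longrightarrow> h' (h T) = T"
    "T \<in> tensors n m \<Longrightarrow> h T \<in> tensors n m" "T \<in> tensors n m \<Longrightarrow> h' T \<in> tensors n m"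
  using assms by (auto simp: good_def linear_on_def)

lemma good_inj: "good n m h h' \<Longrightarrow> S \<in> tensors n m \<Longrightarrow> T \<in> tensors n m \<Longrightarrow> h S = h T \<Longrightarrow> S = T"
  using goodD(4) by metis

lemma zero_tensor: "(\<lambda>_ _ _. 0) \<in> tensors n m" by (simp add: tensors_def)

lemma linear_zero: "linear_on n m h \<Longrightarrow> h (\<lambda>_ _ _. 0) = (\<lambda>_ _ _. 0)"
  using linearD(2)[OF _ zero_tensor, of h 0] by (simp add: tscale_def)

lemma good_eq_zero: "good n m h h' \<Longrightarrow> T \<in> tensors n m \<Longrightarrow> h T = (\<lambda>_ _ _. 0) \<Longrightarrow> T = (\<lambda>_ _ _. 0)"
  using good_inj[OF _ _ zero_tensor] linear_zero goodD(1) by metis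

lemma outer_unit_nonzero: "nz n u \<Longrightarrow> j < n \<Longrightarrow> l < m \<Longrightarrow> outer n m u (unit2 j l) \<noteq> (\<lambda>_ _ _. 0)"
  by (auto simp: nz_def outer_def unit2_def fun_eq_iff)

text \<open>All combinations of the slices of the image have rank at most one, so by
  \<open>rank_one_space\<close> they share a column or a row factor.\<close>

lemma image_type:
  assumes g: "good n m h h'" and u: "nz n u"
  shows "(\<exists>v y. h (outer n m u z) = outer n m v y) \<or> (\<exists>v y. flip (h (outer n m u z)) = outer n m v y)"
proof -
  define T where "T = h (outer n m u z)"
  have T: "T \<in> tensors n m" unfolding T_def using goodD(5)[OF g] by simp
  define E where "E = {(\<lambda>i j. \<Sum>l<m. t l * T i j l) | t. True}"
  have disj: "(\<exists>x. \<forall>M\<in>E. \<exists>y. \<forall>i\<in>{..<n}. \<forall>j\<in>{..<n}. M i j = x i * y j) \<or>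
         (\<exists>y. \<forall>M\<in>E. \<exists>x. \<forall>i\<in>{..<n}. \<forall>j\<in>{..<n}. M i j = x i * y j)"
  proof (rule rank_one_space)
    fix M N assume "M \<in> E" "N \<in> E"
    then obtain t t' where "M = (\<lambda>i j. \<Sum>l<m. t l * T i j l)" "N = (\<lambda>i j. \<Sum>l<m. t' l * T i j l)"
      by (auto simp: E_def)
    then have "(\<lambda>i j. M i j + N i j) = (\<lambda>i j. \<Sum>l<m. (t l + t' l) * T i j l)"
      by (auto simp: fun_eq_iff algebra_simps sum.distrib)
    then show "(\<lambda>i j. M i j + N i j) \<in> E" by (auto simp: E_def)
  next
    fix M assume "M \<in> E"
    then obtain t where M: "M = (\<lambda>i j. \<Sum>l<m. t l * T i j l)" by (auto simp: E_def)
    obtain x y where "\<forall>i<n. \<forall>j<n. comb n m t T $$ (i, j) = x i * y j"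
      using rank_one_image[OF g u, of t z] n unfolding T_def by auto
    then have "\<forall>i\<in>{..<n}. \<forall>j\<in>{..<n}. M i j = x i * y j" by (auto simp: M comb_def)
    then show "\<exists>x y. \<forall>i\<in>{..<n}. \<forall>j\<in>{..<n}. M i j = x i * y j" by blast
  qed
  have slice: "(\<lambda>i j. T i j l) \<in> E" if "l < m" for l
  proof -
    have "(\<Sum>l'<m. unit l l' * T i j l') = (\<Sum>l'<m. if l' = l then T i j l' else 0)" for i j
      by (rule sum.cong) (auto simp: unit_def)
    then have "(\<lambda>i j. \<Sum>l'<m. unit l l' * T i j l') = (\<lambda>i j. T i j l)" using that by simp
    moreover have "(\<lambda>i j. \<Sum>l'<m. unit l l' * T i j l') \<in> E" by (auto simp: E_def)
    ultimately show ?thesis by simp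
  qed
  from disj show ?thesis
  proof (elim disjE exE)
    fix x assume x: "\<forall>M\<in>E. \<exists>y. \<forall>i\<in>{..<n}. \<forall>j\<in>{..<n}. M i j = x i * y j"
    have "\<exists>y. l < m \<longrightarrow> (\<forall>i\<in>{..<n}. \<forall>j\<in>{..<n}. T i j l = x i * y j)" for l
      using bspec[OF x slice[of l]] by (cases "l < m") auto
    then obtain y where y: "\<And>l. l < m \<longrightarrow> (\<forall>i\<in>{..<n}. \<forall>j\<in>{..<n}. T i j l = x i * y l j)" by metis
    have "T = outer n m x (\<lambda>j l. y l j)"
      by (rule tensor_eqI[OF T outer_tensors]) (use y in \<open>auto simp: outer_def\<close>)
    then show ?thesis unfolding T_def by blast
  next
    fix y assume y: "\<forall>M\<in>E. \<exists>x. \<forall>i\<in>{..<n}. \<forall>j\<in>{..<n}. M i j = x i * y j"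
    have "\<exists>x. l < m \<longrightarrow> (\<forall>i\<in>{..<n}. \<forall>j\<in>{..<n}. T i j l = x i * y j)" for l
      using bspec[OF y slice[of l]] by (cases "l < m") auto
    then obtain x where x: "\<And>l. l < m \<longrightarrow> (\<forall>i\<in>{..<n}. \<forall>j\<in>{..<n}. T i j l = x l i * y j)" by metis
    have "flip T = outer n m y (\<lambda>j l. x l j)"
      by (rule tensor_eqI[OF _ outer_tensors]) (use x T in \<open>auto simp: outer_apply flip_apply\<close>)
    then show ?thesis unfolding T_def by blast
  qed
qed

text \<open>On the line \<open>Y1 + s Y2\<close>, a minor that excludes row type at Y2 is quadratic
  in s without constant term, and one that excludes column type at Y1 is affine. For nonzero s each
  of them vanishes at most once, but at each of three values one of them has to.\<close>

lemma image_type_uniform: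
  assumes g: "good n m h h'" and u: "nz n u"
  shows "(\<forall>z. \<exists>v y. h (outer n m u z) = outer n m v y) \<or> (\<forall>z. \<exists>v y. flip (h (outer n m u z)) = outer n m v y)"
proof (rule ccontr)
  assume "\<not> ?thesis"
  then obtain z1 z2 where z2: "\<nexists>v y. h (outer n m u z2) = outer n m v y"
    and z1: "\<nexists>v y. flip (h (outer n m u z1)) = outer n m v y" by blast
  define Y1 where "Y1 = h (outer n m u z1)"
  define Y2 where "Y2 = h (outer n m u z2)"
  have Y: "Y1 \<in> tensors n m" "Y2 \<in> tensors n m" "flip Y1 \<in> tensors n m" "flip Y2 \<in> tensors n m"
    unfolding Y1_def Y2_def using goodD(5)[OF g] by simp_all
  define Y where "Y s = tplus Y1 (tscale s Y2)" for s
  have Ys: "Y s = h (outer n m u (\<lambda>j l. z1 j l + s * z2 j l))" for s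
    unfolding Y_def Y1_def Y2_def outer_tplus[symmetric] outer_tscale[symmetric]
    by (simp add: linearD[OF goodD(1)[OF g]])
  have YV: "Y s \<in> tensors n m" "flip (Y s) \<in> tensors n m" for s unfolding Y_def using Y by simp_all
  have t1: "\<exists>v y. Y1 = outer n m v y" and t2: "\<exists>v y. flip Y2 = outer n m v y"
    using image_type[OF g u] z1 z2 unfolding Y1_def Y2_def by blast+
  from z2[folded Y2_def, unfolded outer_iff_minors[OF Y(2)]] obtain a a' b b' c c'
    where abc: "a < n" "a' < n" "b < n" "b' < n" "c < m" "c' < m"
      and A: "Y2 a b c * Y2 a' b' c' - Y2 a b' c' * Y2 a' b c \<noteq> 0" (is "?A \<noteq> 0") by blast
  from z1[folded Y1_def, unfolded outer_iff_minors[OF Y(3)]] obtain d d' e e' f f'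
    where def: "d < n" "d' < n" "e < n" "e' < n" "f < m" "f' < m"
      and A': "flip Y1 d e f * flip Y1 d' e' f' - flip Y1 d e' f' * flip Y1 d' e f \<noteq> 0" (is "?A' \<noteq> 0") by blast
  have 1: "Y1 a b c * Y1 a' b' c' - Y1 a b' c' * Y1 a' b c = 0"
    using t1 abc unfolding outer_iff_minors[OF Y(1)] by blast
  have 2: "flip Y2 d e f * flip Y2 d' e' f' - flip Y2 d e' f' * flip Y2 d' e f = 0"
    using t2 def unfolding outer_iff_minors[OF Y(4)] by blast
  define B where "B = Y1 a b c * Y2 a' b' c' + Y2 a b c * Y1 a' b' c' - Y1 a b' c' * Y2 a' b c - Y2 a b' c' * Y1 a' b c"
  define B' where "B' = flip Y1 d e f * flip Y2 d' e' f' + flip Y2 d e f * flip Y1 d' e' f'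
     - flip Y1 d e' f' * flip Y2 d' e f - flip Y2 d e' f' * flip Y1 d' e f"
  have lin: "B + s * ?A = 0 \<or> ?A' + s * B' = 0" if s: "s \<noteq> 0" for s
  proof -
    have "(\<exists>v y. Y s = outer n m v y) \<or> (\<exists>v y. flip (Y s) = outer n m v y)"
      using image_type[OF g u] unfolding Ys by blast
    then show ?thesis
    proof
      assume "\<exists>v y. Y s = outer n m v y"
      then have "Y s a b c * Y s a' b' c' - Y s a b' c' * Y s a' b c = 0"
        using abc unfolding outer_iff_minors[OF YV(1)] by blast
      moreover have "Y s a b c * Y s a' b' c' - Y s a b' c' * Y s a' b c =
          (Y1 a b c * Y1 a' b' c' - Y1 a b' c' * Y1 a' b c) + s * (B + s * ?A)"
        unfolding Y_def tplus_def tscale_def B_def by (simp add: algebra_simps)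
      ultimately show ?thesis using 1 s by simp
    next
      assume "\<exists>v y. flip (Y s) = outer n m v y"
      then have "flip (Y s) d e f * flip (Y s) d' e' f' - flip (Y s) d e' f' * flip (Y s) d' e f = 0"
        using def unfolding outer_iff_minors[OF YV(2)] by blast
      moreover have "flip (Y s) d e f * flip (Y s) d' e' f' - flip (Y s) d e' f' * flip (Y s) d' e f =
          ?A' + s * B' + s * s * (flip Y2 d e f * flip Y2 d' e' f' - flip Y2 d e' f' * flip Y2 d' e f)"
        unfolding Y_def tplus_def tscale_def flip_def B'_def by (simp add: algebra_simps)
      ultimately show ?thesis using 2 by simp
    qed
  qed
  have no: "\<not> (B + s * ?A = 0 \<and> B + t * ?A = 0)" "\<not> (?A' + s * B' = 0 \<and> ?A' + t * B' = 0)"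
    if "s \<noteq> t" for s t
  proof -
    have diff: "(s - t) * x = (b + s * x) - (b + t * x)" for x b by (simp add: algebra_simps)
    have "(s - t) * ?A = 0" if "B + s * ?A = 0" "B + t * ?A = 0" unfolding diff[of _ B] that by simp
    then show "\<not> (B + s * ?A = 0 \<and> B + t * ?A = 0)" using A \<open>s \<noteq> t\<close> by auto
    have "(s - t) * B' = 0" if "?A' + s * B' = 0" "?A' + t * B' = 0" unfolding diff[of _ ?A'] that by simp
    then show "\<not> (?A' + s * B' = 0 \<and> ?A' + t * B' = 0)" using A' \<open>s \<noteq> t\<close> by auto
  qed
  have "(1::complex) \<noteq> 0" "(2::complex) \<noteq> 0" "(3::complex) \<noteq> 0" "(1::complex) \<noteq> 2" "(2::complex) \<noteq> 3" "(1::complex) \<noteq> 3"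
    by simp_all
  then show False using lin[of 1] lin[of 2] lin[of 3] no[of 1 2] no[of 2 3] no[of 1 3] by blast
qed

text \<open>\<open>rank_one_space\<close> for the n x (n m) flattenings gives a common left or a
  common right factor. A common right factor would confine the image to n dimensions, although h is
  injective on a space of dimension n m > n.\<close>

lemma rowmap_of_row_type:
  assumes g: "good n m h h'" and u: "nz n u"
    and type: "\<And>z. \<exists>v y. h (outer n m u z) = outer n m v y"
  shows "\<exists>v. rowmap n m h u v"
proof -
  have hV: "h (outer n m u z) \<in> tensors n m" for z using goodD(5)[OF g] by simp
  define E where "E = {(\<lambda>i (j, l). h (outer n m u z) i j l) | z. True}"
  have E: "(\<lambda>i (j, l). h (outer n m u z) i j l) \<in> E" for z by (auto simp: E_def)
  let ?J = "{..<n} \<times> {..<m}"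
  have "(\<exists>x. \<forall>M\<in>E. \<exists>y. \<forall>i\<in>{..<n}. \<forall>j\<in>?J. M i j = x i * y j) \<or>
         (\<exists>y. \<forall>M\<in>E. \<exists>x. \<forall>i\<in>{..<n}. \<forall>j\<in>?J. M i j = x i * y j)"
  proof (rule rank_one_space)
    fix M N assume "M \<in> E" "N \<in> E"
    then obtain z z' where M: "M = (\<lambda>i (j, l). h (outer n m u z) i j l)"
      "N = (\<lambda>i (j, l). h (outer n m u z') i j l)" by (auto simp: E_def)
    have "h (outer n m u (\<lambda>j l. z j l + z' j l)) = tplus (h (outer n m u z)) (h (outer n m u z'))"
      unfolding outer_tplus[symmetric] by (simp add: linearD[OF goodD(1)[OF g]])
    then have "(\<lambda>i j. M i j + N i j) = (\<lambda>i (j, l). h (outer n m u (\<lambda>j l. z j l + z' j l)) i j l)"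
      by (auto simp: M tplus_def fun_eq_iff)
    then show "(\<lambda>i j. M i j + N i j) \<in> E" using E by simp
  next
    fix M assume "M \<in> E"
    then obtain z where M: "M = (\<lambda>i (j, l). h (outer n m u z) i j l)" by (auto simp: E_def)
    obtain v y where "h (outer n m u z) = outer n m v y" using type by blast
    then have "\<forall>i\<in>{..<n}. \<forall>j\<in>?J. M i j = v i * (case j of (j, l) \<Rightarrow> y j l)" by (auto simp: M outer_def)
    then show "\<exists>x y. \<forall>i\<in>{..<n}. \<forall>j\<in>?J. M i j = x i * y j" by blast
  qed
  then show ?thesis
  proof
    assume "\<exists>x. \<forall>M\<in>E. \<exists>y. \<forall>i\<in>{..<n}. \<forall>j\<in>?J. M i j = x i * y j"
    then obtain x where x: "\<And>M. M \<in> E \<Longrightarrow> \<exists>y. \<forall>i\<in>{..<n}. \<forall>j\<in>?J. M i j = x i * y j" by blast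
    have "rowmap n m h u x" unfolding rowmap_def
    proof
      fix z
      obtain y where y: "\<forall>i\<in>{..<n}. \<forall>j\<in>?J. (\<lambda>i (j, l). h (outer n m u z) i j l) i j = x i * y j"
        using x[OF E[of z]] by blast
      have "h (outer n m u z) = outer n m x (\<lambda>j l. y (j, l))"
        by (rule tensor_eqI[OF hV outer_tensors]) (use y in \<open>auto simp: outer_def\<close>)
      then show "\<exists>y. h (outer n m u z) = outer n m x y" by blast
    qed
    then show ?thesis by blast
  next
    assume "\<exists>y. \<forall>M\<in>E. \<exists>x. \<forall>i\<in>{..<n}. \<forall>j\<in>?J. M i j = x i * y j"
    then obtain y where y: "\<And>M. M \<in> E \<Longrightarrow> \<exists>x. \<forall>i\<in>{..<n}. \<forall>j\<in>?J. M i j = x i * y j" by blast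
    \<comment> \<open>n + 1 independent arrays: n with their entry in column 0 and, since m is at
      least 2, one with its entry in column 1.\<close>
    define z where "z p = (if p < n then unit2 p 0 else unit2 0 1)" for p
    have "\<exists>x. \<forall>i<n. \<forall>j<n. \<forall>l<m. h (outer n m u (z p)) i j l = x i * y (j, l)" for p
      using y[OF E[of "z p"]] by fastforce
    then obtain x where x: "\<And>p i j l. i < n \<Longrightarrow> j < n \<Longrightarrow> l < m \<Longrightarrow> h (outer n m u (z p)) i j l = x p i * y (j, l)"
      by metis
    obtain c where c: "\<exists>p\<le>n. c p \<noteq> 0" "\<And>i. i < n \<Longrightarrow> (\<Sum>p\<le>n. c p * x p i) = 0"
      using linear_dependence[of n x] by blast
    define X where "X = tsum {..n} (\<lambda>p. tscale (c p) (outer n m u (z p)))"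
    have XV: "X \<in> tensors n m" unfolding X_def by auto
    have "h X = tsum {..n} (\<lambda>p. tscale (c p) (h (outer n m u (z p))))"
      unfolding X_def by (subst linear_tsum[OF goodD(1)[OF g]]) (auto simp: linearD[OF goodD(1)[OF g]])
    moreover have "\<dots> = (\<lambda>_ _ _. 0)"
    proof (rule tensor_eqI[OF _ zero_tensor])
      show "tsum {..n} (\<lambda>p. tscale (c p) (h (outer n m u (z p)))) \<in> tensors n m" using hV by auto
      fix i j l assume ijl: "i < n" "j < n" "l < m"
      have "tsum {..n} (\<lambda>p. tscale (c p) (h (outer n m u (z p)))) i j l = (\<Sum>p\<le>n. c p * x p i) * y (j, l)"
        unfolding tsum_def tscale_def sum_distrib_right using x[OF ijl] by (intro sum.cong) auto
      then show "tsum {..n} (\<lambda>p. tscale (c p) (h (outer n m u (z p)))) i j l = 0" using c(2)[OF ijl(1)] by simp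
    qed
    ultimately have X0: "X = (\<lambda>_ _ _. 0)" using good_eq_zero[OF g XV] by simp
    obtain i where i: "i < n" "u i \<noteq> 0" using u by (auto simp: nz_def)
    have coeff: "(\<Sum>p\<le>n. c p * z p j l) = 0" if "j < n" "l < m" for j l
    proof -
      have "X i j l = u i * (\<Sum>p\<le>n. c p * z p j l)"
        unfolding X_def tsum_def tscale_def sum_distrib_left using that i by (intro sum.cong) (auto simp: outer_def)
      then show ?thesis using X0 i by simp
    qed
    have "c p = 0" if "p \<le> n" for p
    proof (cases "p < n")
      case True
      have "(\<Sum>q\<le>n. c q * z q p 0) = (\<Sum>q\<le>n. if q = p then c q else 0)"
        by (rule sum.cong) (use True in \<open>auto simp: z_def unit2_def\<close>)
      then show ?thesis using coeff[OF True, of 0] m that by simp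
    next
      case False
      then have p: "p = n" using that by simp
      have "(\<Sum>q\<le>n. c q * z q 0 1) = (\<Sum>q\<le>n. if q = n then c q else 0)"
        by (rule sum.cong) (auto simp: z_def unit2_def)
      then show ?thesis using coeff[of 0 1] m n p by simp
    qed
    then show ?thesis using c(1) by blast
  qed
qed

lemma rowmap_or_colmap:
  assumes g: "good n m h h'" and u: "nz n u"
  shows "(\<exists>v. rowmap n m h u v) \<or> (\<exists>v. rowmap n m (flip \<circ> h) u v)"
  using image_type_uniform[OF g u]
proof
  assume "\<forall>z. \<exists>v y. h (outer n m u z) = outer n m v y"
  then show ?thesis using rowmap_of_row_type[OF g u] by blast
next
  assume "\<forall>z. \<exists>v y. flip (h (outer n m u z)) = outer n m v y"
  then show ?thesis using rowmap_of_row_type[OF good_flip_left[OF g] u] by auto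
qed

lemma rowmap_nz:
  assumes g: "good n m h h'" and u: "nz n u" and r: "rowmap n m h u v"
  shows "nz n v"
proof (rule ccontr)
  assume v: "\<not> nz n v"
  obtain y where "h (outer n m u (unit2 0 0)) = outer n m v y" using r unfolding rowmap_def by blast
  also have "outer n m v y = (\<lambda>_ _ _. 0)" using v by (auto simp: nz_def outer_def fun_eq_iff)
  finally have "outer n m u (unit2 0 0) = (\<lambda>_ _ _. 0)" using good_eq_zero[OF g] by simp
  then show False using outer_unit_nonzero[OF u] n m by simp
qed

text \<open>The inverse returns tensors in the image of h from left factor v to left factor u. By
  \<open>no_row_in_column\<close> it cannot send the row space of v to a column space, so it sends
  this space to a row space, whose left factor must be parallel to u.\<close>

lemma rowmap_onto:
  assumes g: "good n m h h'" and u: "nz n u" and r: "rowmap n m h u v"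
  shows "\<exists>y. outer n m v z = h (outer n m u y)"
proof -
  have v: "nz n v" by (rule rowmap_nz[OF g u r])
  have inv: "\<exists>y. h' (outer n m v y) = outer n m u z" for z
  proof -
    obtain y where "h (outer n m u z) = outer n m v y" using r unfolding rowmap_def by blast
    then have "h' (outer n m v y) = outer n m u z" using goodD(4)[OF g outer_tensors] by metis
    then show ?thesis by blast
  qed
  from rowmap_or_colmap[OF good_swap[OF g] v] show ?thesis
  proof (elim disjE exE)
    fix u' assume r': "rowmap n m h' v u'"
    obtain y where y: "h' (outer n m v y) = outer n m u (unit2 0 0)" using inv by blast
    obtain y' where y': "h' (outer n m v y) = outer n m u' y'" using r' unfolding rowmap_def by blast
    have eq: "outer n m u (unit2 0 0) = outer n m u' y'" using y y' by simp
    obtain c where c: "c \<noteq> 0" "\<And>i. i < n \<Longrightarrow> u i = c * u' i"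
      using outer_eq_parallel[OF eq] outer_unit_nonzero[OF u, of 0 0] n m by auto
    obtain x where x: "h' (outer n m v z) = outer n m u' x" using r' unfolding rowmap_def by blast
    have "outer n m u' x = outer n m u (\<lambda>j l. (1 / c) * x j l)"
      by (rule outer_rescale) (use c in auto)
    then have "h (outer n m u (\<lambda>j l. (1 / c) * x j l)) = outer n m v z"
      using x goodD(3)[OF g outer_tensors] by metis
    then show ?thesis by metis
  next
    fix w assume r': "rowmap n m (flip \<circ> h') v w"
    have "\<exists>y. flip (outer n m u z) = outer n m w y" for z
    proof -
      obtain y where "h' (outer n m v y) = outer n m u z" using inv by blast
      then show ?thesis using r' unfolding rowmap_def by (metis comp_apply)
    qed
    note * = this
    have False
    proof (rule no_row_in_column[OF u n])
      show "1 \<le> m" using m by simp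
      show "\<exists>y. flip (outer n m u z) = outer n m w y" for z by (rule *)
    qed
    then show ?thesis ..
  qed
qed

text \<open>Were u1 of column type and u2 of row type, an image column space and an image row space
  would meet in a nonzero tensor. Its preimage has both u1 and u2 as left factor, so these are
  parallel and have the same type.\<close>

lemma all_rowmap_or_all_colmap:
  assumes g: "good n m h h'"
  shows "(\<forall>u. nz n u \<longrightarrow> (\<exists>v. rowmap n m h u v)) \<or> (\<forall>u. nz n u \<longrightarrow> (\<exists>v. rowmap n m (flip \<circ> h) u v))"
proof (rule ccontr)
  assume "\<not> ?thesis"
  then obtain u1 u2 where u1: "nz n u1" "\<nexists>v. rowmap n m h u1 v"
    and u2: "nz n u2" "\<nexists>v. rowmap n m (flip \<circ> h) u2 v" by blast
  obtain w where w: "rowmap n m (flip \<circ> h) u1 w" using rowmap_or_colmap[OF g u1(1)] u1(2) by blast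
  obtain v where v: "rowmap n m h u2 v" using rowmap_or_colmap[OF g u2(1)] u2(2) by blast
  have nzv: "nz n v" and nzw: "nz n w" using rowmap_nz g good_flip_left[OF g] u1 u2 v w by blast+
  define T where "T = outer n m v (\<lambda>j l. if l = 0 then w j else 0)"
  have Tw: "flip T = outer n m w (\<lambda>j l. if l = 0 then v j else 0)"
    by (auto simp: T_def flip_def outer_def fun_eq_iff)
  obtain i j where "i < n" "v i \<noteq> 0" "j < n" "w j \<noteq> 0" using nzv nzw by (auto simp: nz_def)
  then have "T i j 0 \<noteq> 0" using m by (simp add: T_def outer_def)
  then have T0: "T \<noteq> (\<lambda>_ _ _. 0)" by auto
  obtain y2 where y2: "T = h (outer n m u2 y2)"
    using rowmap_onto[OF g u2(1) v] unfolding T_def by blast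
  obtain y1 where "flip T = (flip \<circ> h) (outer n m u1 y1)"
    using rowmap_onto[OF good_flip_left[OF g] u1(1) w] unfolding Tw by blast
  then have y1: "T = h (outer n m u1 y1)" by (metis comp_apply flip_flip)
  have eq: "outer n m u2 y2 = outer n m u1 y1"
    by (rule good_inj[OF g]) (use y1 y2 in auto)
  have ne: "outer n m u2 y2 \<noteq> (\<lambda>_ _ _. 0)"
    using T0 y2 linear_zero[OF goodD(1)[OF g]] by auto
  obtain c where c: "\<And>i. i < n \<Longrightarrow> u2 i = c * u1 i" using outer_eq_parallel[OF eq ne] by blast
  have "rowmap n m (flip \<circ> h) u2 w"
    unfolding rowmap_def
  proof
    fix z
    have "outer n m u2 z = outer n m u1 (\<lambda>j l. c * z j l)" by (rule outer_rescale[OF c])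
    then show "\<exists>y. (flip \<circ> h) (outer n m u2 z) = outer n m w y" using w unfolding rowmap_def by simp
  qed
  then show False using u2(2) by blast
qed

section \<open>Tensor product form of a preserver\<close>

lemma unit_nz: "i < n \<Longrightarrow> nz n (unit i)" by (auto simp: nz_def unit_def)

text \<open>Otherwise h sends rows and columns alike to row spaces. The inverse has one type on all
  row spaces, so whichever it is, all transposes of tensors with one left factor would share a left
  factor, against \<open>no_row_in_column\<close>.\<close>

lemma columns_of_rows:
  assumes g: "good n m h h'" and all: "\<And>u. nz n u \<Longrightarrow> \<exists>v. rowmap n m h u v"
    and w: "nz n w"
  shows "\<exists>v. rowmap n m (flip \<circ> (h \<circ> flip)) w v"
proof -
  have False if col: "\<forall>u. nz n u \<longrightarrow> (\<exists>v. rowmap n m (h \<circ> flip) u v)"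
  proof -
    have e: "nz n (unit 0)" using unit_nz n by simp
    obtain v1 where v1: "rowmap n m h (unit 0) v1" using all[OF e] by blast
    obtain v where v: "rowmap n m (h \<circ> flip) (unit 0) v" using col e by blast
    have nzv: "nz n v" "nz n v1" using rowmap_nz g good_flip_right[OF g] e v v1 by blast+
    from all_rowmap_or_all_colmap[OF good_swap[OF g]] show False
    proof
      assume "\<forall>u. nz n u \<longrightarrow> (\<exists>v. rowmap n m h' u v)"
      then obtain u' where u': "rowmap n m h' v u'" using nzv by blast
      have "\<exists>y. flip (outer n m (unit 0) z) = outer n m u' y" for z
      proof -
        obtain y where "h (flip (outer n m (unit 0) z)) = outer n m v y"
          using v unfolding rowmap_def by auto
        then have "h' (outer n m v y) = flip (outer n m (unit 0) z)"
          using goodD(4)[OF g, of "flip (outer n m (unit 0) z)"] by simp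
        then show ?thesis using u' unfolding rowmap_def by metis
      qed
      note * = this
      show False
      proof (rule no_row_in_column[OF e n])
        show "1 \<le> m" using m by simp
        show "\<exists>y. flip (outer n m (unit 0) z) = outer n m u' y" for z by (rule *)
      qed
    next
      assume "\<forall>u. nz n u \<longrightarrow> (\<exists>v. rowmap n m (flip \<circ> h') u v)"
      then obtain w' where w': "rowmap n m (flip \<circ> h') v1 w'" using nzv by blast
      have "\<exists>y. flip (outer n m (unit 0) z) = outer n m w' y" for z
      proof -
        obtain y where "h (outer n m (unit 0) z) = outer n m v1 y"
          using v1 unfolding rowmap_def by auto
        then have "h' (outer n m v1 y) = outer n m (unit 0) z"
          using goodD(4)[OF g, of "outer n m (unit 0) z"] by simp
        then show ?thesis using w' unfolding rowmap_def by (metis comp_apply)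
      qed
      note * = this
      show False
      proof (rule no_row_in_column[OF e n])
        show "1 \<le> m" using m by simp
        show "\<exists>y. flip (outer n m (unit 0) z) = outer n m w' y" for z by (rule *)
      qed
    qed
  qed
  then show ?thesis using all_rowmap_or_all_colmap[OF good_flip_right[OF g]] w by blast
qed

text \<open>The image of the row space of \<open>unit 0 + unit i\<close> has a left factor that does
  not depend on z. Since \<open>v 0\<close> and \<open>v i\<close> are independent, this makes
  \<open>b i z\<close> a fixed multiple of \<open>b 0 z\<close>, and the multiple is absorbed into
  \<open>v i\<close>.\<close>

lemma uniform_row_factor:
  assumes g: "good n m h h'" and all: "\<And>u. nz n u \<Longrightarrow> \<exists>v. rowmap n m h u v"
  shows "\<exists>v B. \<forall>i<n. \<forall>z. h (outer n m (unit i) z) = outer n m (v i) (B z)"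
proof -
  have "\<forall>i. \<exists>v. i < n \<longrightarrow> rowmap n m h (unit i) v" using all unit_nz by blast
  then obtain v where v: "\<And>i. i < n \<Longrightarrow> rowmap n m h (unit i) (v i)" by metis
  then have "\<forall>i z. \<exists>y. i < n \<longrightarrow> h (outer n m (unit i) z) = outer n m (v i) y"
    unfolding rowmap_def by blast
  then obtain b where b: "\<And>i z. i < n \<Longrightarrow> h (outer n m (unit i) z) = outer n m (v i) (b i z)" by metis
  have vnz: "nz n (v i)" if "i < n" for i using rowmap_nz[OF g unit_nz[OF that] v[OF that]] .
  have n0: "0 < n" and m0: "0 < m" using n m by auto
  \<comment> \<open>Parallel left factors would give the row spaces of \<open>unit 0\<close> and
    \<open>unit i\<close> a common nonzero image, against injectivity.\<close>
  have indep: "x = 0 \<and> y = 0" if i: "i < n" "i \<noteq> 0" and xy: "\<And>a. a < n \<Longrightarrow> x * v 0 a + y * v i a = 0" for i x y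
  proof -
    have "y = 0"
    proof (rule ccontr)
      assume y: "y \<noteq> 0"
      have "v i a = (- x / y) * v 0 a" if "a < n" for a
        using xy[OF that] y by (simp add: field_simps add_eq_0_iff)
      then have "outer n m (v i) (b i (unit2 0 0)) = outer n m (v 0) (\<lambda>j l. (- x / y) * b i (unit2 0 0) j l)"
        by (rule outer_rescale)
      then obtain z where "h (outer n m (unit i) (unit2 0 0)) = h (outer n m (unit 0) z)"
        using rowmap_onto[OF g unit_nz[OF n0] v[OF n0]] b[OF i(1)] by metis
      then have eq: "outer n m (unit i) (unit2 0 0) = outer n m (unit 0) z" using good_inj[OF g] by simp
      have "outer n m (unit i) (unit2 0 0) i 0 0 = outer n m (unit 0) z i 0 0" unfolding eq ..
      then show False using i n0 m0 by (simp add: outer_apply unit_def unit2_def)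
    qed
    moreover have "x = 0" using xy calculation vnz[OF n0] by (auto simp: nz_def)
    ultimately show ?thesis by simp
  qed
  have "\<exists>\<rho>. \<forall>z j l. j < n \<longrightarrow> l < m \<longrightarrow> b i z j l = \<rho> * b 0 z j l" if i: "i < n" for i
  proof (cases "i = 0")
    case True
    then show ?thesis by (intro exI[of _ 1]) auto
  next
    case False
    define e where "e = (\<lambda>a. unit 0 a + unit i a)"
    have "nz n e" unfolding nz_def e_def using n0 False by (intro exI[of _ 0]) (auto simp: unit_def)
    then obtain v' where "rowmap n m h e v'" using all by blast
    then have "\<forall>z. \<exists>y. h (outer n m e z) = outer n m v' y" unfolding rowmap_def by blast
    then obtain y where y: "\<And>z. h (outer n m e z) = outer n m v' (y z)" by metis
    have e_sum: "outer n m e z = tplus (outer n m (unit 0) z) (outer n m (unit i) z)" for z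
      by (auto simp: e_def outer_def tplus_def fun_eq_iff algebra_simps)
    have rel: "v 0 a * b 0 z j l + v i a * b i z j l = v' a * y z j l"
      if "a < n" "j < n" "l < m" for a z j l
    proof -
      have "outer n m v' (y z) = tplus (outer n m (v 0) (b 0 z)) (outer n m (v i) (b i z))"
        unfolding y[symmetric] e_sum by (simp add: linearD[OF goodD(1)[OF g]] b[OF n0] b[OF i])
      from fun_cong[OF fun_cong[OF fun_cong[OF this, of a], of j], of l] show ?thesis
        using that by (simp add: outer_def tplus_def)
    qed
    have "outer n m (v 0) (b 0 (unit2 0 0)) \<noteq> (\<lambda>_ _ _. 0)"
      using b[OF n0, of "unit2 0 0"] good_eq_zero[OF g outer_tensors] outer_unit_nonzero[OF unit_nz[OF n0], of 0 0] n0 m0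
      by metis
    then obtain jj ll where jl: "jj < n" "ll < m" "b 0 (unit2 0 0) jj ll \<noteq> 0"
      by (auto simp: outer_def fun_eq_iff split: if_splits)
    define x0 where "x0 = b 0 (unit2 0 0) jj ll"
    define y0 where "y0 = b i (unit2 0 0) jj ll"
    define s0 where "s0 = y (unit2 0 0) jj ll"
    have rel0: "v 0 a * x0 + v i a * y0 = v' a * s0" if "a < n" for a
      unfolding x0_def y0_def s0_def using rel[OF that jl(1,2)] .
    have x0: "x0 \<noteq> 0" using jl by (simp add: x0_def)
    have s0: "s0 \<noteq> 0"
    proof
      assume "s0 = 0"
      then have "x0 * v 0 a + y0 * v i a = 0" if "a < n" for a using rel0[OF that] by (simp add: algebra_simps)
      then show False using indep[OF i False] x0 by blast
    qed
    have "b i z j l = (y0 / x0) * b 0 z j l" if jl: "j < n" "l < m" for z j l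
    proof -
      define q where "q = y z j l / s0"
      have "(b 0 z j l - q * x0) * v 0 a + (b i z j l - q * y0) * v i a = 0" if a: "a < n" for a
      proof -
        have "v' a * y z j l = q * (v' a * s0)" using s0 by (simp add: q_def)
        then have "v 0 a * b 0 z j l + v i a * b i z j l = q * (v 0 a * x0 + v i a * y0)"
          using rel[OF a jl] rel0[OF a] by simp
        then show ?thesis by (simp add: algebra_simps)
      qed
      then have "b 0 z j l - q * x0 = 0 \<and> b i z j l - q * y0 = 0" by (rule indep[OF i False])
      then show ?thesis using x0 by simp
    qed
    then show ?thesis by blast
  qed
  then have "\<forall>i. \<exists>\<rho>. i < n \<longrightarrow> (\<forall>z j l. j < n \<longrightarrow> l < m \<longrightarrow> b i z j l = \<rho> * b 0 z j l)" by blast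
  then obtain \<rho> where \<rho>: "\<And>i z j l. i < n \<Longrightarrow> j < n \<Longrightarrow> l < m \<Longrightarrow> b i z j l = \<rho> i * b 0 z j l" by metis
  have "h (outer n m (unit i) z) = outer n m (\<lambda>a. \<rho> i * v i a) (b 0 z)" if i: "i < n" for i z
    unfolding b[OF i] using \<rho>[OF i] by (auto simp: outer_def fun_eq_iff)
  then show ?thesis by (intro exI[of _ "\<lambda>i a. \<rho> i * v i a"] exI[of _ "b 0"]) simp
qed

text \<open>The image of a basis tensor splits off its row factor and also its column factor.
  Comparing the two splittings at \<open>i = 0\<close> and a row \<open>a0\<close> with
  \<open>v 0 a0\<close> nonzero separates the column index from the slice index and yields
  A.\<close>

lemma tensor_product_form:
  assumes g: "good n m h h'" and all: "\<And>u. nz n u \<Longrightarrow> \<exists>v. rowmap n m h u v"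
  shows "\<exists>P Q A. \<forall>T\<in>tensors n m. h T = act n m P Q A T"
proof -
  obtain v B where v: "\<And>i z. i < n \<Longrightarrow> h (outer n m (unit i) z) = outer n m (v i) (B z)"
    using uniform_row_factor[OF g all] by blast
  have g': "good n m (flip \<circ> (h \<circ> flip)) ((flip \<circ> h') \<circ> flip)"
    by (rule good_flip_left[OF good_flip_right[OF g]])
  obtain w C where w: "\<And>j z. j < n \<Longrightarrow> (flip \<circ> (h \<circ> flip)) (outer n m (unit j) z) = outer n m (w j) (C z)"
    using uniform_row_factor[OF g' columns_of_rows[OF g all]] by blast
  define E where "E i j l = outer n m (unit i) (unit2 j l)" for i j l
  have flipE: "flip (outer n m (unit j) (unit2 i l)) = E i j l" for i j l
    by (auto simp: E_def flip_def outer_def unit_def unit2_def fun_eq_iff)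
  have n0: "0 < n" and m0: "0 < m" using n m by auto
  have "outer n m (v 0) (B (unit2 0 0)) \<noteq> (\<lambda>_ _ _. 0)"
    using v[OF n0, of "unit2 0 0"] good_eq_zero[OF g outer_tensors] outer_unit_nonzero[OF unit_nz[OF n0], of 0 0] n0 m0
    by metis
  then obtain a0 where a0: "a0 < n" "v 0 a0 \<noteq> 0" by (auto simp: outer_def fun_eq_iff split: if_splits)
  define A where "A k l = C (unit2 0 l) a0 k / v 0 a0" for k l
  have two: "v i a * B (unit2 j l) b k = w j b * C (unit2 i l) a k"
    if "i < n" "j < n" "l < m" "a < n" "b < n" "k < m" for i j l a b k
  proof -
    have "h (E i j l) a b k = v i a * B (unit2 j l) b k"
      unfolding E_def v[OF that(1)] using that by (simp add: outer_def)
    moreover have "flip (h (E i j l)) = outer n m (w j) (C (unit2 i l))"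
      using w[OF that(2), of "unit2 i l"] by (simp add: flipE)
    then have "h (E i j l) a b k = w j b * C (unit2 i l) a k"
      using that by (metis flip_apply outer_apply)
    ultimately show ?thesis by simp
  qed
  have hE: "h (E i j l) a b k = v i a * w j b * A k l"
    if "i < n" "j < n" "l < m" "a < n" "b < n" "k < m" for i j l a b k
  proof -
    have "B (unit2 j l) b k = w j b * A k l"
      using two[OF n0 that(2,3) a0(1) that(5,6)] a0 by (simp add: A_def field_simps)
    then show ?thesis unfolding E_def v[OF that(1)] using that by (simp add: outer_def)
  qed
  have "h T = act n m (\<lambda>a i. v i a) (\<lambda>b j. w j b) A T" if T: "T \<in> tensors n m" for T
  proof (rule tensor_eqI[OF goodD(5)[OF g T]])
    show "act n m (\<lambda>a i. v i a) (\<lambda>b j. w j b) A T \<in> tensors n m" by (simp add: act_def tensors_def)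
    fix a b k assume abk: "a < n" "b < n" "k < m"
    let ?I = "{..<n} \<times> {..<n} \<times> {..<m}"
    define F where "F = (\<lambda>(i, j, l). tscale (T i j l) (E i j l))"
    have FV: "F p \<in> tensors n m" for p by (cases p) (simp add: F_def E_def)
    have "T = tsum ?I F"
    proof (rule tensor_eqI[OF T])
      fix i j l assume ijl: "i < n" "j < n" "l < m"
      have "tsum ?I F i j l = (\<Sum>p\<in>?I. if p = (i, j, l) then T i j l else 0)"
        unfolding tsum_def
        by (rule sum.cong) (use ijl in \<open>auto simp: F_def E_def tscale_def outer_def unit_def unit2_def split: if_splits\<close>)
      then show "T i j l = tsum ?I F i j l" using ijl by simp
    qed (use FV in auto)
    then have "h T = tsum ?I (\<lambda>p. h (F p))"
      using linear_tsum[OF goodD(1)[OF g], of ?I F] FV by simp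
    moreover have "h (F (i, j, l)) = tscale (T i j l) (h (E i j l))" for i j l
      by (simp add: F_def E_def linearD[OF goodD(1)[OF g]])
    ultimately have "h T a b k = (\<Sum>(i, j, l)\<in>?I. T i j l * h (E i j l) a b k)"
      by (auto simp: tsum_def tscale_def intro!: sum.cong)
    also have "\<dots> = (\<Sum>(i, j, l)\<in>?I. v i a * w j b * A k l * T i j l)"
      by (rule sum.cong) (use hE abk in auto)
    also have "\<dots> = (\<Sum>i<n. \<Sum>j<n. \<Sum>l<m. v i a * w j b * A k l * T i j l)"
      by (simp add: sum.cartesian_product)
    finally show "h T a b k = act n m (\<lambda>a i. v i a) (\<lambda>b j. w j b) A T a b k"
      using abk by (simp add: act_def)
  qed
  then show ?thesis by blast
qed

text \<open>The analogue for tuples of the theorem of Frobenius and Dieudonne on preservers of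
  singular matrices. In the column case the form of \<open>flip \<circ> h\<close> is transposed,
  which exchanges P and Q.\<close>

theorem singularity_preserver:
  assumes g: "good n m h h'"
  shows "\<exists>P Q A. (\<forall>T\<in>tensors n m. h T = act n m P Q A T) \<or> (\<forall>T\<in>tensors n m. h T = act n m P Q A (flip T))"
  using all_rowmap_or_all_colmap[OF g]
proof
  assume "\<forall>u. nz n u \<longrightarrow> (\<exists>v. rowmap n m h u v)"
  then show ?thesis using tensor_product_form[OF g] by blast
next
  assume "\<forall>u. nz n u \<longrightarrow> (\<exists>v. rowmap n m (flip \<circ> h) u v)"
  then obtain P Q A where PQA: "\<And>T. T \<in> tensors n m \<Longrightarrow> flip (h T) = act n m P Q A T"
    using tensor_product_form[OF good_flip_left[OF g]] by fastforce
  have "h T = act n m Q P A (flip T)" if "T \<in> tensors n m" for T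
  proof -
    have "h T = flip (act n m P Q A T)" using PQA[OF that] by (metis flip_flip)
    also have "\<dots> = act n m Q P A (flip T)"
    proof (intro ext)
      fix a b k
      have "(\<Sum>i<n. \<Sum>j<n. \<Sum>l<m. P b i * Q a j * A k l * T i j l) =
          (\<Sum>i<n. \<Sum>j<n. \<Sum>l<m. Q a i * P b j * A k l * T j i l)"
        by (subst sum.swap) (intro sum.cong refl, simp)
      then show "flip (act n m P Q A T) a b k = act n m Q P A (flip T) a b k"
        by (auto simp: act_def flip_def)
    qed
    finally show ?thesis .
  qed
  then show ?thesis by blast
qed

end

section \<open>Invariants of reductive groups\<close>

lemma gen_sum: "finite I \<Longrightarrow> (\<And>i. i \<in> I \<Longrightarrow> f i \<in> gen_algebra C) \<Longrightarrow> (\<lambda>x. \<Sum>i\<in>I. f i x) \<in> gen_algebra C"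
  by (induction I rule: finite_induct) (auto intro: gen_algebra.intros)

lemma gen_prod: "finite I \<Longrightarrow> (\<And>i. i \<in> I \<Longrightarrow> f i \<in> gen_algebra C) \<Longrightarrow> (\<lambda>x. \<Prod>i\<in>I. f i x) \<in> gen_algebra C"
  by (induction I rule: finite_induct) (auto intro: gen_algebra.intros)

lemma gen_sum_list: "(\<And>a b. (a, b) \<in> set xs \<Longrightarrow> b \<in> gen_algebra C) \<Longrightarrow>
    (\<lambda>x. \<Sum>(a, b)\<leftarrow>xs. c a * b x) \<in> gen_algebra C"
  by (induction xs) (auto intro!: gen_algebra.add gen_algebra.mult intro: gen_algebra.const)

lemma gen_mono: "f \<in> gen_algebra C \<Longrightarrow> C \<subseteq> D \<Longrightarrow> f \<in> gen_algebra D"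
  by (induction f rule: gen_algebra.induct) (auto intro: gen_algebra.intros)

section \<open>Regular functions on matrix groups\<close>

lemma GL_simps: "monoid.mult (GL k) = (*)" "monoid.one (GL k) = 1\<^sub>m k"
  "carrier (GL k) = Units (ring_mat TYPE(complex) k ())"
  by (simp_all add: GL_def units_of_def ring_mat_def)

lemma GL_group: "group (GL k)"
proof -
  interpret ring "ring_mat TYPE(complex) k ()" by (rule ring_mat)
  show ?thesis unfolding GL_def by (rule units_group)
qed

lemma GL_I: "A \<in> carrier_mat k k \<Longrightarrow> B \<in> carrier_mat k k \<Longrightarrow> A * B = 1\<^sub>m k \<Longrightarrow> B * A = 1\<^sub>m k \<Longrightarrow> A \<in> carrier (GL k)"
  unfolding GL_simps Units_def by (auto simp: ring_mat_def)

lemma GL_carrier: "g \<in> carrier (GL k) \<Longrightarrow> g \<in> carrier_mat k k"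
  unfolding GL_simps Units_def by (auto simp: ring_mat_def)

lemma GL_inv:
  assumes "g \<in> carrier (GL k)"
  shows "inv\<^bsub>GL k\<^esub> g \<in> carrier (GL k)" "inv\<^bsub>GL k\<^esub> g * g = 1\<^sub>m k" "g * inv\<^bsub>GL k\<^esub> g = 1\<^sub>m k"
  using group.inv_closed[OF GL_group assms] group.l_inv[OF GL_group assms] group.r_inv[OF GL_group assms]
  by (simp_all add: GL_simps(1,2))

lemma GL_det: "g \<in> carrier (GL k) \<Longrightarrow> det (inv\<^bsub>GL k\<^esub> g) * det g = 1"
  using det_mult[OF GL_carrier[OF GL_inv(1)] GL_carrier] GL_inv(2) by (metis det_one)

lemma GL_inv_adj:
  assumes g: "g \<in> carrier (GL k)"
  shows "inv\<^bsub>GL k\<^esub> g = inverse (det g) \<cdot>\<^sub>m adj_mat g"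
proof -
  note c = GL_carrier[OF g] GL_carrier[OF GL_inv(1)[OF g]]
  note adj = adj_mat[OF c(1)]
  have d: "det g \<noteq> 0" using GL_det[OF g] by auto
  have "inv\<^bsub>GL k\<^esub> g = inv\<^bsub>GL k\<^esub> g * (inverse (det g) \<cdot>\<^sub>m (det g \<cdot>\<^sub>m 1\<^sub>m k))"
  proof -
    have "inverse (det g) \<cdot>\<^sub>m (det g \<cdot>\<^sub>m 1\<^sub>m k) = 1\<^sub>m k" by (rule eq_matI) (use d in auto)
    then show ?thesis using c by (simp add: right_mult_one_mat[of _ k k])
  qed
  also have "\<dots> = inverse (det g) \<cdot>\<^sub>m (inv\<^bsub>GL k\<^esub> g * (g * adj_mat g))"
    unfolding adj(2) using c by (simp add: mult_smult_distrib[of _ k k _ k])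
  also have "inv\<^bsub>GL k\<^esub> g * (g * adj_mat g) = (inv\<^bsub>GL k\<^esub> g * g) * adj_mat g"
    using c adj by (simp add: assoc_mult_mat[of _ k k _ k _ k])
  also have "\<dots> = adj_mat g" using GL_inv(2)[OF g] adj by (simp add: left_mult_one_mat[of _ k k])
  finally show ?thesis .
qed

lemma gen_det_minor:
  assumes ij: "i < k" "j < k"
  shows "\<exists>p\<in>gen_algebra (mat_coords k). \<forall>A\<in>carrier_mat k k. adj_mat A $$ (i, j) = p A"
proof -
  \<comment> \<open>\<open>s a\<close> enumerates the indices other than a, as the deletion of a row
    or column does.\<close>
  define s where "s a b = (if b < a then b else Suc b)" for a b :: nat
  let ?n = "k - 1"
  define p where "p A = (- 1) ^ (j + i) * (\<Sum>q | q permutes {0..<?n}. signof q * (\<Prod>a = 0..<?n. A $$ (s j a, s i (q a))))" for A :: "complex mat"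
  have "p \<in> gen_algebra (mat_coords k)" unfolding p_def
  proof (intro gen_algebra.mult gen_algebra.const gen_sum gen_prod)
    fix q a assume "q \<in> {q. q permutes {0..<?n}}" "a \<in> {0..<?n}"
    then have "a < ?n" "q a < ?n" using permutes_in_image[of q "{0..<?n}" a] by auto
    then have "s j a < k" "s i (q a) < k" by (auto simp: s_def)
    then show "(\<lambda>A. A $$ (s j a, s i (q a))) \<in> gen_algebra (mat_coords k)"
      by (intro gen_algebra.coord) (auto simp: mat_coords_def)
  qed (auto intro: finite_permutations)
  moreover have "adj_mat A $$ (i, j) = p A" if A: "A \<in> carrier_mat k k" for A
  proof -
    have "adj_mat A $$ (i, j) = (- 1) ^ (j + i) * det (mat_delete A j i)"
      using A ij by (simp add: adj_mat_def cofactor_def)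
    also have "det (mat_delete A j i) = (\<Sum>q | q permutes {0..<?n}. signof q * (\<Prod>a = 0..<?n. A $$ (s j a, s i (q a))))"
      unfolding det_def'[OF mat_delete_carrier[OF A]]
    proof (rule sum.cong[OF refl], rule arg_cong2[of _ _ _ _ "(*)", OF refl], rule prod.cong[OF refl])
      fix q a assume "q \<in> {q. q permutes {0..<?n}}" "a \<in> {0..<?n}"
      then have "a < ?n" "q a < ?n" using permutes_in_image[of q "{0..<?n}" a] by auto
      then show "mat_delete A j i $$ (a, q a) = A $$ (s j a, s i (q a))"
        using A by (simp add: mat_delete_def s_def)
    qed
    finally show ?thesis by (simp add: p_def)
  qed
  ultimately show ?thesis by blast
qed

lemma gen_det: "\<exists>p\<in>gen_algebra (mat_coords k). \<forall>A\<in>carrier_mat k k. det A = p A"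
proof -
  define p where "p A = (\<Sum>q | q permutes {0..<k}. signof q * (\<Prod>a = 0..<k. A $$ (a, q a)))" for A :: "complex mat"
  have "p \<in> gen_algebra (mat_coords k)" unfolding p_def
  proof (intro gen_algebra.mult gen_algebra.const gen_sum gen_prod)
    fix q a assume "q \<in> {q. q permutes {0..<k}}" "a \<in> {0..<k}"
    then have "a < k" "q a < k" using permutes_in_image[of q "{0..<k}" a] by auto
    then show "(\<lambda>A. A $$ (a, q a)) \<in> gen_algebra (mat_coords k)"
      by (intro gen_algebra.coord) (auto simp: mat_coords_def)
  qed (auto intro: finite_permutations)
  then show ?thesis by (intro bexI[of _ p]) (auto simp: p_def det_def')
qed

lemma regular_const: "regular_on k G (\<lambda>_. c)"
  unfolding regular_on_def by (rule bexI[OF _ gen_algebra.const]) auto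

lemma regular_add: "regular_on k G f \<Longrightarrow> regular_on k G f' \<Longrightarrow> regular_on k G (\<lambda>g. f g + f' g)"
proof -
  let ?A = "gen_algebra (insert (\<lambda>A. inverse (det A)) (mat_coords k))"
  assume "regular_on k G f" "regular_on k G f'"
  then obtain p q where "p \<in> ?A" "q \<in> ?A" "\<forall>g\<in>G. f g = p g" "\<forall>g\<in>G. f' g = q g"
    unfolding regular_on_def by blast
  then show ?thesis
    unfolding regular_on_def by (intro bexI[of _ "\<lambda>g. p g + q g"]) (auto intro: gen_algebra.add)
qed

lemma regular_mult: "regular_on k G f \<Longrightarrow> regular_on k G f' \<Longrightarrow> regular_on k G (\<lambda>g. f g * f' g)"
proof -
  let ?A = "gen_algebra (insert (\<lambda>A. inverse (det A)) (mat_coords k))"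
  assume "regular_on k G f" "regular_on k G f'"
  then obtain p q where "p \<in> ?A" "q \<in> ?A" "\<forall>g\<in>G. f g = p g" "\<forall>g\<in>G. f' g = q g"
    unfolding regular_on_def by blast
  then show ?thesis
    unfolding regular_on_def by (intro bexI[of _ "\<lambda>g. p g * q g"]) (auto intro: gen_algebra.mult)
qed

lemma regular_sum: "finite I \<Longrightarrow> (\<And>i. i \<in> I \<Longrightarrow> regular_on k G (f i)) \<Longrightarrow> regular_on k G (\<lambda>g. \<Sum>i\<in>I. f i g)"
  by (induction I rule: finite_induct) (auto intro: regular_const regular_add)

lemma regular_cong: "regular_on k G f \<Longrightarrow> (\<And>g. g \<in> G \<Longrightarrow> f g = f' g) \<Longrightarrow> regular_on k G f'"
  unfolding regular_on_def by auto

lemma regular_sum_list: "(\<And>a b. (a, b) \<in> set xs \<Longrightarrow> regular_on k G (a \<circ> \<phi>)) \<Longrightarrow>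
    regular_on k G (\<lambda>g. \<Sum>(a, b)\<leftarrow>xs. a (\<phi> g) * b v)"
  by (induction xs) (auto intro!: regular_const regular_add regular_mult simp: comp_def)

text \<open>The entries of the inverse are those of the adjugate divided by the determinant, and the
  reciprocal of the determinant of the inverse is the determinant itself, a polynomial.\<close>

lemma regular_inverse:
  assumes G: "subgroup G (GL k)" and f: "regular_on k G f"
  shows "regular_on k G (f \<circ> m_inv (GL k))"
proof -
  let ?A = "gen_algebra (insert (\<lambda>A. inverse (det A)) (mat_coords k))"
  have "\<exists>q\<in>?A. \<forall>g\<in>carrier (GL k). p (inv\<^bsub>GL k\<^esub> g) = q g" if "p \<in> ?A" for p
    using that
  proof (induction p rule: gen_algebra.induct)
    case (const c)
    then show ?case by (intro bexI[of _ "\<lambda>_. c"]) (auto intro: gen_algebra.const)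
  next
    case (add f g)
    then obtain q r where "q \<in> ?A" "r \<in> ?A" "\<forall>x\<in>carrier (GL k). f (inv\<^bsub>GL k\<^esub> x) = q x"
      "\<forall>x\<in>carrier (GL k). g (inv\<^bsub>GL k\<^esub> x) = r x" by blast
    then show ?case by (intro bexI[of _ "\<lambda>x. q x + r x"]) (auto intro: gen_algebra.add)
  next
    case (mult f g)
    then obtain q r where "q \<in> ?A" "r \<in> ?A" "\<forall>x\<in>carrier (GL k). f (inv\<^bsub>GL k\<^esub> x) = q x"
      "\<forall>x\<in>carrier (GL k). g (inv\<^bsub>GL k\<^esub> x) = r x" by blast
    then show ?case by (intro bexI[of _ "\<lambda>x. q x * r x"]) (auto intro: gen_algebra.mult)
  next
    case (coord f)
    consider "f = (\<lambda>A. inverse (det A))" | i j where "i < k" "j < k" "f = (\<lambda>A. A $$ (i, j))"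
      using coord by (auto simp: mat_coords_def)
    then show ?case
    proof cases
      case 1
      obtain p where p: "p \<in> gen_algebra (mat_coords k)" "\<forall>A\<in>carrier_mat k k. det A = p A"
        using gen_det by blast
      have "inverse (det (inv\<^bsub>GL k\<^esub> g)) = p g" if "g \<in> carrier (GL k)" for g
        using GL_det[OF that] p(2) GL_carrier[OF that] by (metis inverse_unique)
      then show ?thesis using gen_mono[OF p(1) subset_insertI] 1 by (intro bexI[of _ p]) auto
    next
      case (2 i j)
      obtain p where p: "p \<in> gen_algebra (mat_coords k)" "\<forall>A\<in>carrier_mat k k. adj_mat A $$ (i, j) = p A"
        using gen_det_minor[OF 2(1,2)] by blast
      have "(\<lambda>A. inverse (det A) * p A) \<in> ?A"
        by (intro gen_algebra.mult gen_algebra.coord gen_mono[OF p(1) subset_insertI]) auto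
      moreover have "f (inv\<^bsub>GL k\<^esub> g) = inverse (det g) * p g" if "g \<in> carrier (GL k)" for g
        using GL_inv_adj[OF that] p(2) GL_carrier[OF that] adj_mat(1)[OF GL_carrier[OF that]] 2 by auto
      ultimately show ?thesis by (intro bexI[of _ "\<lambda>A. inverse (det A) * p A"]) auto
    qed
  qed
  then show ?thesis
    using f subgroup.subset[OF G] subgroup.m_inv_closed[OF G] unfolding regular_on_def
    by (metis comp_apply subsetD)
qed

lemma inverse_of_det:
  fixes A :: "complex mat"
  assumes A: "A \<in> carrier_mat n n" and d: "det A \<noteq> 0"
  obtains B where "B \<in> carrier_mat n n" "A * B = 1\<^sub>m n" "B * A = 1\<^sub>m n"
  using det_non_zero_imp_unit[OF A d, of "()"] unfolding Units_def by (auto simp: ring_mat_def)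

text \<open>A direct sum of irreducibles with a nonzero invariant functional contains a fixed vector on which
  the functional is 1: the functional is injective on any summand on which it does not vanish.\<close>

lemma fixed_vector:
  assumes ds: "direct_sum_of_irreducibles G d \<rho>"
    and \<rho>: "\<And>g. g \<in> G \<Longrightarrow> \<rho> g \<in> carrier_mat d d"
    and inv: "\<And>g w. g \<in> G \<Longrightarrow> w \<in> carrier_vec d \<Longrightarrow> (\<Sum>j<d. (\<rho> g *\<^sub>v w) $ j) = (\<Sum>j<d. w $ j)"
    and d: "d > 0"
  obtains w where "w \<in> carrier_vec d" "\<And>g. g \<in> G \<Longrightarrow> \<rho> g *\<^sub>v w = w" "(\<Sum>j<d. w $ j) = (1 :: complex)"
proof -
  \<comment> \<open>In the application the coordinates belong to polynomials with value 1 at the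
    origin, so the sum of coordinates is evaluation there.\<close>
  define \<Lambda> where "\<Lambda> w = (\<Sum>j<d. w $ j)" for w :: "complex vec"
  have add: "\<Lambda> (v + w) = \<Lambda> v + \<Lambda> w" if "w \<in> carrier_vec d" for v w
    using that by (simp add: \<Lambda>_def sum.distrib)
  have smult: "\<Lambda> (c \<cdot>\<^sub>v w) = c * \<Lambda> w" if "w \<in> carrier_vec d" for c w
    using that by (simp add: \<Lambda>_def sum_distrib_left)
  define Q where "Q r W \<longleftrightarrow> (\<forall>i<r. irreducible_subrep G d \<rho> (W i)) \<and>
      (\<forall>v\<in>carrier_vec d. \<exists>!w. w \<in> (\<Pi>\<^sub>E i\<in>{..<r}. W i) \<and> v = finsum_vec TYPE(complex) d w {..<r})"
    for r :: nat and W
  have "\<exists>r W. Q r W" using ds unfolding direct_sum_of_irreducibles_def Q_def .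
  then obtain r W where Q: "Q r W" by blast
  have irr: "irreducible_subrep G d \<rho> (W i)" if "i < r" for i using Q that by (simp add: Q_def)
  have dec: "\<exists>w. w \<in> (\<Pi>\<^sub>E i\<in>{..<r}. W i) \<and> v = finsum_vec TYPE(complex) d w {..<r}" if "v \<in> carrier_vec d" for v
    using conjunct2[OF Q[unfolded Q_def], THEN bspec, OF that] by (rule ex1_implies_ex)
  have sub: "submodule class_ring (W i) (module_vec TYPE(complex) d)" if "i < r" for i
    using irr[OF that] unfolding irreducible_subrep_def invariant_subspace_def VectorSpace.subspace_def by blast
  have Wc: "W i \<subseteq> carrier_vec d" if "i < r" for i
    using submodule.subset[OF sub[OF that]] by (simp add: module_vec_simps)
  let ?e = "unit_vec d 0 :: complex vec"
  have "\<Lambda> ?e = (\<Sum>j<d. if j = 0 then 1 else 0)" unfolding \<Lambda>_def by (rule sum.cong) (auto simp: unit_vec_def)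
  then have e1: "\<Lambda> ?e = 1" using d by simp
  obtain w where w: "w \<in> (\<Pi>\<^sub>E i\<in>{..<r}. W i)" "?e = finsum_vec TYPE(complex) d w {..<r}"
    using dec[of ?e] by auto
  have wc: "w i \<in> W i" "w i \<in> carrier_vec d" if "i < r" for i using w(1) Wc that by (auto simp: PiE_def Pi_def)
  have "\<Lambda> ?e = (\<Sum>j<d. \<Sum>i<r. w i $ j)"
    unfolding \<Lambda>_def w(2) by (intro sum.cong refl index_finsum_vec) (auto simp: wc)
  also have "\<dots> = (\<Sum>i<r. \<Lambda> (w i))" unfolding \<Lambda>_def by (rule sum.swap)
  finally have "\<exists>i<r. \<Lambda> (w i) \<noteq> 0" using e1 by (metis lessThan_iff sum.neutral zero_neq_one)
  then obtain i where i: "i < r" "\<Lambda> (w i) \<noteq> 0" by blast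
  interpret S: submodule class_ring "W i" "module_vec TYPE(complex) d" by (rule sub[OF i(1)])
  have Wadd: "x + y \<in> W i" if "x \<in> W i" "y \<in> W i" for x y
    using S.m_closed[OF that] by (simp add: module_vec_simps)
  have Wsm: "c \<cdot>\<^sub>v x \<in> W i" if "x \<in> W i" for c x
    using S.smult_closed[OF _ that, of c] by (simp add: module_vec_simps class_ring_simps)
  have W0: "0\<^sub>v d \<in> W i" using S.zero_closed by (simp add: module_vec_simps)
  have W\<rho>: "\<rho> g *\<^sub>v x \<in> W i" if "g \<in> G" "x \<in> W i" for g x
    using irr[OF i(1)] that unfolding irreducible_subrep_def invariant_subspace_def by blast
  define K where "K = {x \<in> W i. \<Lambda> x = 0}"
  have "submodule class_ring K (module_vec TYPE(complex) d)"
    by (rule submodule.intro)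
      (use Wc[OF i(1)] Wadd Wsm W0 add smult vec_module in
        \<open>auto simp: K_def module_vec_simps class_ring_simps subset_iff\<close>, auto simp: \<Lambda>_def)
  then have "VectorSpace.subspace class_ring K (module_vec TYPE(complex) d)"
    by (intro subspace.intro vec_vs)
  moreover have "\<rho> g *\<^sub>v x \<in> K" if "g \<in> G" "x \<in> K" for g x
    using that W\<rho> inv[OF that(1), of x] Wc[OF i(1)] by (auto simp: K_def \<Lambda>_def)
  ultimately have "invariant_subspace G d \<rho> K" unfolding invariant_subspace_def by blast
  moreover have "K \<subseteq> W i" by (auto simp: K_def)
  moreover have "K \<noteq> W i" using wc(1)[OF i(1)] i(2) by (auto simp: K_def)
  ultimately have K: "K = {0\<^sub>v d}" using irr[OF i(1)] unfolding irreducible_subrep_def by blast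
  have wi: "w i \<in> carrier_vec d" "w i \<in> W i" using wc i by auto
  have fixd: "\<rho> g *\<^sub>v w i = w i" if g: "g \<in> G" for g
  proof -
    have c: "\<rho> g *\<^sub>v w i \<in> carrier_vec d" using W\<rho>[OF g wi(2)] Wc[OF i(1)] by blast
    have "\<rho> g *\<^sub>v w i + (- 1) \<cdot>\<^sub>v w i \<in> K"
      unfolding K_def using Wadd[OF W\<rho>[OF g wi(2)] Wsm[OF wi(2)]] add[of "(- 1) \<cdot>\<^sub>v w i"] smult[OF wi(1)] wi
        inv[OF g wi(1)] by (simp add: \<Lambda>_def sum_negf)
    then have eq: "\<rho> g *\<^sub>v w i + (- 1) \<cdot>\<^sub>v w i = 0\<^sub>v d" using K by blast
    show ?thesis
    proof (rule eq_vecI)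
      fix j assume "j < dim_vec (w i)"
      then have j: "j < d" using wi by simp
      have "(\<rho> g *\<^sub>v w i + (- 1) \<cdot>\<^sub>v w i) $ j = 0" using eq j by simp
      then show "(\<rho> g *\<^sub>v w i) $ j = w i $ j" using j wi c by simp
    qed (use wi \<rho>[OF g] in auto)
  qed
  show ?thesis
  proof (rule that[of "(1 / \<Lambda> (w i)) \<cdot>\<^sub>v w i"])
    show "(\<Sum>j<d. ((1 / \<Lambda> (w i)) \<cdot>\<^sub>v w i) $ j) = 1"
      using smult[OF wi(1), of "1 / \<Lambda> (w i)"] i(2) by (simp add: \<Lambda>_def)
    show "\<rho> g *\<^sub>v ((1 / \<Lambda> (w i)) \<cdot>\<^sub>v w i) = (1 / \<Lambda> (w i)) \<cdot>\<^sub>v w i" if "g \<in> G" for g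
      using mult_mat_vec[OF \<rho>[OF that] wi(1)] fixd[OF that] by simp
  qed (use wi in auto)
qed

text \<open>Local finiteness of the action on polynomials, stated for one polynomial as a finite
  decomposition into products of a regular function on G and a polynomial on V.\<close>

definition separated ::
  "nat \<Rightarrow> complex mat set \<Rightarrow> 'v set \<Rightarrow> ('v \<Rightarrow> complex) set \<Rightarrow> (complex mat \<Rightarrow> 'v \<Rightarrow> 'v) \<Rightarrow> ('v \<Rightarrow> complex) \<Rightarrow>
    ((complex mat \<Rightarrow> complex) \<times> ('v \<Rightarrow> complex)) list \<Rightarrow> bool" where
  "separated k G V C \<beta> q xs \<longleftrightarrow>
     (\<forall>(a, b)\<in>set xs. regular_on k G a \<and> b \<in> gen_algebra C) \<and>
     (\<forall>g\<in>G. \<forall>v\<in>V. q (\<beta> g v) = (\<Sum>(a, b)\<leftarrow>xs. a g * b v))"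

lemma sum_list_product:
  "(\<Sum>(a, b)\<leftarrow>xs. f a * (h b :: complex)) * (\<Sum>(a, b)\<leftarrow>ys. f' a * h' b) =
   (\<Sum>p\<leftarrow>List.product xs ys. (f (fst (fst p)) * f' (fst (snd p))) * (h (snd (fst p)) * h' (snd (snd p))))"
proof (induction xs)
  case (Cons p xs)
  obtain a b where p: "p = (a, b)" by (cases p)
  have "f a * h b * (\<Sum>(a, b)\<leftarrow>ys. f' a * h' b) =
      (\<Sum>q\<leftarrow>map (Pair p) ys. (f (fst (fst q)) * f' (fst (snd q))) * (h (snd (fst q)) * h' (snd (snd q))))"
    by (induction ys) (auto simp: p algebra_simps)
  then show ?case using Cons by (simp add: p algebra_simps)
qed simp

locale group_action =
  fixes k :: nat and G :: "complex mat set" and V :: "'v set" and C :: "('v \<Rightarrow> complex) set"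
    and \<beta> :: "complex mat \<Rightarrow> 'v \<Rightarrow> 'v" and z :: 'v
  assumes reductive: "reductive_group k G"
    and act_closed: "g \<in> G \<Longrightarrow> v \<in> V \<Longrightarrow> \<beta> g v \<in> V"
    and act_mult: "g \<in> G \<Longrightarrow> h \<in> G \<Longrightarrow> v \<in> V \<Longrightarrow> \<beta> (g * h) v = \<beta> g (\<beta> h v)"
    and act_one: "v \<in> V \<Longrightarrow> \<beta> (1\<^sub>m k) v = v"
    and coord_separated: "c \<in> C \<Longrightarrow> \<exists>xs. separated k G V C \<beta> c xs"
    and origin: "z \<in> V" and act_origin: "g \<in> G \<Longrightarrow> \<beta> g z = z"
begin

lemma G_subgroup: "subgroup G (GL k)"
  using reductive by (simp add: reductive_group_def linear_algebraic_group_def)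

abbreviation ginv :: "complex mat \<Rightarrow> complex mat" where "ginv \<equiv> m_inv (GL k)"

lemma G_GL: "g \<in> G \<Longrightarrow> g \<in> carrier (GL k)" using subgroup.subset[OF G_subgroup] by blast
lemma G_carrier: "g \<in> G \<Longrightarrow> g \<in> carrier_mat k k" using G_GL GL_carrier by blast
lemma G_one: "1\<^sub>m k \<in> G" using subgroup.one_closed[OF G_subgroup] by (simp add: GL_simps)
lemma G_mult: "g \<in> G \<Longrightarrow> h \<in> G \<Longrightarrow> g * h \<in> G" using subgroup.m_closed[OF G_subgroup] by (simp add: GL_simps)
lemma G_inv: "g \<in> G \<Longrightarrow> ginv g \<in> G" using subgroup.m_inv_closed[OF G_subgroup] by simp
lemma G_inv_mult: "g \<in> G \<Longrightarrow> h \<in> G \<Longrightarrow> ginv (g * h) = ginv h * ginv g"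
  using group.inv_mult_group[OF GL_group G_GL G_GL] by (simp add: GL_simps)
lemma G_inv_inv: "g \<in> G \<Longrightarrow> ginv (ginv g) = g"
  using group.inv_inv[OF GL_group G_GL] by simp
lemma gen_separated: "q \<in> gen_algebra C \<Longrightarrow> \<exists>xs. separated k G V C \<beta> q xs"
proof (induction q rule: gen_algebra.induct)
  case (const c)
  have "separated k G V C \<beta> (\<lambda>_. c) [(\<lambda>_. 1, \<lambda>_. c)]"
    by (auto simp: separated_def intro: regular_const gen_algebra.const)
  then show ?case by blast
next
  case (coord c)
  then show ?case using coord_separated by blast
next
  case (add f f')
  then obtain xs ys where xs: "separated k G V C \<beta> f xs" "separated k G V C \<beta> f' ys" by blast
  then have "separated k G V C \<beta> (\<lambda>x. f x + f' x) (xs @ ys)"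
    unfolding separated_def by auto
  then show ?case by blast
next
  case (mult f f')
  then obtain xs ys where xs: "separated k G V C \<beta> f xs" "separated k G V C \<beta> f' ys" by blast
  define zs where "zs = map (\<lambda>p. (\<lambda>g. fst (fst p) g * fst (snd p) g, \<lambda>v. snd (fst p) v * snd (snd p) v)) (List.product xs ys)"
  have "f (\<beta> g v) * f' (\<beta> g v) = (\<Sum>(a, b)\<leftarrow>zs. a g * b v)" if "g \<in> G" "v \<in> V" for g v
  proof -
    have "f (\<beta> g v) * f' (\<beta> g v) = (\<Sum>(a, b)\<leftarrow>xs. a g * b v) * (\<Sum>(a, b)\<leftarrow>ys. a g * b v)"
      using xs that unfolding separated_def by auto
    also have "\<dots> = (\<Sum>(a, b)\<leftarrow>zs. a g * b v)"
      unfolding sum_list_product[of "\<lambda>a. a g" "\<lambda>b. b v" xs "\<lambda>a. a g" "\<lambda>b. b v" ys] zs_def by (simp add: comp_def)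
    finally show ?thesis .
  qed
  moreover have "\<forall>(a, b)\<in>set zs. regular_on k G a \<and> b \<in> gen_algebra C"
    using xs unfolding separated_def zs_def
    by (auto intro!: regular_mult gen_algebra.mult)
  ultimately have "separated k G V C \<beta> (\<lambda>x. f x * f' x) zs" unfolding separated_def by blast
  then show ?case by blast
qed

text \<open>The translates of p span a finite-dimensional representation on which evaluation at the
  fixed point z is an invariant functional, nonzero because p z = 1. By \<open>fixed_vector\<close>
  some combination of translates is invariant with value 1 at z. It vanishes at X because p vanishes
  on the orbit of X.\<close>

lemma invariant_exists:
  assumes p: "p \<in> gen_algebra C" and X: "X \<in> V" and pX: "\<And>g. g \<in> G \<Longrightarrow> p (\<beta> g X) = 0" and pz: "p z = 1"
  shows "\<exists>f\<in>gen_algebra C. (\<forall>g\<in>G. \<forall>v\<in>V. f (\<beta> g v) = f v) \<and> f X = 0 \<and> f z = 1"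
proof -
  define M where "M v g = p (\<beta> (ginv g) v)" for v g
  obtain xs where xs: "separated k G V C \<beta> p xs" using gen_separated[OF p] by blast
  \<comment> \<open>A nonsingular matrix of values of translates of p certifies their independence.
    The largest possible size is the dimension of their span; it is bounded by the length of
    \<open>xs\<close>, through which the values factor.\<close>
  define E where "E d vs gs = mat d d (\<lambda>(i, j). M (vs i) (gs j))" for d :: nat and vs :: "nat \<Rightarrow> 'v" and gs
  define P where "P d \<longleftrightarrow> (\<exists>vs gs. (\<forall>i<d. vs i \<in> V \<and> gs i \<in> G) \<and> det (E d vs gs) \<noteq> 0)" for d
  let ?r = "length xs"
  have bound: "d \<le> ?r" if "P d" for d
  proof (rule ccontr)
    assume "\<not> d \<le> ?r"
    then have r: "?r < d" by simp
    from that obtain vs gs where vg: "\<And>i. i < d \<Longrightarrow> vs i \<in> V" "\<And>i. i < d \<Longrightarrow> gs i \<in> G" and dE: "det (E d vs gs) \<noteq> 0"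
      unfolding P_def by blast
    define B1 where "B1 = mat d d (\<lambda>(i, l). if l < ?r then snd (xs ! l) (vs i) else 0)"
    define B2 where "B2 = mat d d (\<lambda>(l, j). if l < ?r then fst (xs ! l) (ginv (gs j)) else 0)"
    have c: "B1 \<in> carrier_mat d d" "B2 \<in> carrier_mat d d" by (auto simp: B1_def B2_def)
    have "E d vs gs = B1 * B2"
    proof (rule eq_matI)
      fix i j assume "i < dim_row (B1 * B2)" "j < dim_col (B1 * B2)"
      then have ij: "i < d" "j < d" using c by auto
      have "M (vs i) (gs j) = (\<Sum>(a, b)\<leftarrow>xs. a (ginv (gs j)) * b (vs i))"
        unfolding M_def using xs vg ij G_inv unfolding separated_def by blast
      also have "\<dots> = (\<Sum>l<?r. fst (xs ! l) (ginv (gs j)) * snd (xs ! l) (vs i))"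
        by (simp add: sum_list_sum_nth lessThan_atLeast0 case_prod_beta)
      also have "\<dots> = (\<Sum>l<d. B1 $$ (i, l) * B2 $$ (l, j))"
        by (rule sum.mono_neutral_cong_left) (use r ij in \<open>auto simp: B1_def B2_def\<close>)
      finally show "E d vs gs $$ (i, j) = (B1 * B2) $$ (i, j)"
        unfolding mat_mult_entry[OF c ij] using ij by (simp add: E_def)
    qed (auto simp: E_def B1_def B2_def)
    moreover have "det B2 = 0" by (rule det_zero_row[OF c(2) r]) (auto simp: B2_def r)
    ultimately show False using dE det_mult[OF c] by simp
  qed
  have "P 0" unfolding P_def E_def by (auto simp: det_dim_zero)
  then obtain d where Pd: "P d" and max: "\<And>d'. P d' \<Longrightarrow> d' \<le> d"
    using GreatestI_nat[of P 0 ?r] Greatest_le_nat[of P _ ?r] bound by blast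
  from Pd obtain vs gs where vs: "\<And>i. i < d \<Longrightarrow> vs i \<in> V" and gs: "\<And>i. i < d \<Longrightarrow> gs i \<in> G"
    and dE: "det (E d vs gs) \<noteq> 0" unfolding P_def by blast
  have Ec: "E d vs gs \<in> carrier_mat d d" by (simp add: E_def)
  obtain F where F: "F \<in> carrier_mat d d" "E d vs gs * F = 1\<^sub>m d" "F * E d vs gs = 1\<^sub>m d"
    using inverse_of_det[OF Ec dE] by blast
  have FE: "(\<Sum>i<d. F $$ (j, i) * M (vs i) (gs l)) = (if j = l then 1 else 0)" if "j < d" "l < d" for j l
    using mat_mult_entry[OF F(1) Ec that] F(3) that by (simp add: E_def)
  \<comment> \<open>The coordinates of the translate by g in the basis of translates by the
    \<open>gs j\<close>, recovered from its values at the \<open>vs i\<close>.\<close>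
  define \<kappa> where "\<kappa> g j = (\<Sum>i<d. F $$ (j, i) * M (vs i) g)" for g j
  have solve: "x j = (\<Sum>i<d. F $$ (j, i) * y i)"
    if j: "j < d" and xy: "\<And>i. i < d \<Longrightarrow> (\<Sum>l<d. M (vs i) (gs l) * x l) = y i" for x y j
  proof -
    have "(\<Sum>i<d. F $$ (j, i) * y i) = (\<Sum>i<d. \<Sum>l<d. F $$ (j, i) * M (vs i) (gs l) * x l)"
      using xy by (simp add: sum_distrib_left algebra_simps flip: xy)
    also have "\<dots> = (\<Sum>l<d. \<Sum>i<d. F $$ (j, i) * M (vs i) (gs l) * x l)" by (rule sum.swap)
    also have "\<dots> = (\<Sum>l<d. (if j = l then 1 else 0) * x l)"
      unfolding sum_distrib_right[symmetric] using FE[OF j] by (intro sum.cong) auto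
    also have "\<dots> = x j" using j by (simp add: if_distrib[of "\<lambda>a. a * _"] cong: if_cong)
    finally show ?thesis by simp
  qed
  have expand: "M v g = (\<Sum>j<d. M v (gs j) * \<kappa> g j)" if v: "v \<in> V" and g: "g \<in> G" for v g
  proof -
    \<comment> \<open>Bordered by one more point and one more translate, the matrix is singular by
      the maximality of d. Its kernel vector has a nonzero last entry because the inner matrix is
      invertible, and so it expresses the new translate in the basis.\<close>
    define B where "B = E (Suc d) (vs(d := v)) (gs(d := g))"
    have B: "B \<in> carrier_mat (Suc d) (Suc d)" by (simp add: B_def E_def)
    have "\<not> P (Suc d)" using max[of "Suc d"] by auto
    moreover have "P (Suc d)" if "det B \<noteq> 0"
      unfolding P_def
      by (intro exI[of _ "vs(d := v)"] exI[of _ "gs(d := g)"])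
        (use that vs gs v g in \<open>auto simp: B_def less_Suc_eq\<close>)
    ultimately have "det B = 0" by blast
    then obtain x where x: "x \<in> carrier_vec (Suc d)" "x \<noteq> 0\<^sub>v (Suc d)" "B *\<^sub>v x = 0\<^sub>v (Suc d)"
      using det_0_iff_vec_prod_zero_field[OF B] by blast
    have rowB: "(\<Sum>l<d. B $$ (i, l) * x $ l) + B $$ (i, d) * x $ d = 0" if "i < Suc d" for i
    proof -
      have "(B *\<^sub>v x) $ i = (\<Sum>l<Suc d. B $$ (i, l) * x $ l)"
        using B x(1) that by (auto simp: scalar_prod_def lessThan_atLeast0 intro!: sum.cong)
      then show ?thesis using x(3) that by simp
    qed
    have top: "(\<Sum>l<d. M (vs i) (gs l) * x $ l) = - x $ d * M (vs i) g" if "i < d" for i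
      using rowB[of i] that by (simp add: B_def E_def add_eq_0_iff2 algebra_simps)
    have xj: "x $ j = - x $ d * \<kappa> g j" if "j < d" for j
      using solve[OF that top] by (simp add: \<kappa>_def sum_distrib_left algebra_simps sum_negf)
    have xd: "x $ d \<noteq> 0"
    proof
      assume "x $ d = 0"
      then have "x $ j = 0" if "j < Suc d" for j using xj that by (cases "j = d") auto
      then show False using x(1,2) by (metis carrier_vecD eq_vecI index_zero_vec)
    qed
    have "(\<Sum>l<d. M v (gs l) * x $ l) + M v g * x $ d = 0"
      using rowB[of d] by (simp add: B_def E_def)
    moreover have "(\<Sum>l<d. M v (gs l) * x $ l) = - x $ d * (\<Sum>j<d. M v (gs j) * \<kappa> g j)"
      unfolding sum_distrib_left using xj by (intro sum.cong) auto
    ultimately have "x $ d * (M v g - (\<Sum>j<d. M v (gs j) * \<kappa> g j)) = 0" by (simp add: algebra_simps)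
    then show ?thesis using xd by simp
  qed
  have unique: "c j = c' j" if "j < d" "\<And>v. v \<in> V \<Longrightarrow> (\<Sum>i<d. M v (gs i) * c i) = (\<Sum>i<d. M v (gs i) * c' i)" for c c' j
    using solve[of j c "\<lambda>i. \<Sum>l<d. M (vs i) (gs l) * c l"] solve[of j c' "\<lambda>i. \<Sum>l<d. M (vs i) (gs l) * c l"]
      that vs by auto
  have Mmult: "M v (h * g) = M (\<beta> (ginv h) v) g" if "v \<in> V" "h \<in> G" "g \<in> G" for v h g
    unfolding M_def using that by (simp add: G_inv_mult act_mult G_inv)
  have bV: "\<beta> (ginv h) v \<in> V" if "h \<in> G" "v \<in> V" for h v using act_closed G_inv that by blast
  \<comment> \<open>The matrix of translation by h in this basis: column j expands the translate by
    \<open>h * gs j\<close>.\<close>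
  define \<tau> where "\<tau> h = mat d d (\<lambda>(i, j). \<kappa> (h * gs j) i)" for h
  have \<tau>c: "\<tau> h \<in> carrier_mat d d" for h by (simp add: \<tau>_def)
  have \<tau>: "M v (h * gs j) = (\<Sum>i<d. M v (gs i) * \<tau> h $$ (i, j))" if "v \<in> V" "h \<in> G" "j < d" for v h j
    using expand[OF that(1) G_mult[OF that(2) gs[OF that(3)]]] that by (simp add: \<tau>_def)
  have \<tau>_mult: "\<tau> (h * h') = \<tau> h * \<tau> h'" if h: "h \<in> G" "h' \<in> G" for h h'
  proof (rule eq_matI)
    fix i j assume "i < dim_row (\<tau> h * \<tau> h')" "j < dim_col (\<tau> h * \<tau> h')"
    then have ij: "i < d" "j < d" by (auto simp: \<tau>_def)
    show "\<tau> (h * h') $$ (i, j) = (\<tau> h * \<tau> h') $$ (i, j)"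
    proof (rule unique[OF ij(1)])
      fix v assume v: "v \<in> V"
      have "(\<Sum>i<d. M v (gs i) * \<tau> (h * h') $$ (i, j)) = M v ((h * h') * gs j)"
        using \<tau>[OF v G_mult[OF h] ij(2)] by simp
      also have "(h * h') * gs j = h * (h' * gs j)"
        using assoc_mult_mat[OF G_carrier[OF h(1)] G_carrier[OF h(2)] G_carrier[OF gs[OF ij(2)]]] .
      also have "M v (h * (h' * gs j)) = M (\<beta> (ginv h) v) (h' * gs j)"
        by (rule Mmult[OF v h(1) G_mult[OF h(2) gs[OF ij(2)]]])
      also have "\<dots> = (\<Sum>l<d. M (\<beta> (ginv h) v) (gs l) * \<tau> h' $$ (l, j))"
        by (rule \<tau>[OF bV[OF h(1) v] h(2) ij(2)])
      also have "\<dots> = (\<Sum>l<d. M v (h * gs l) * \<tau> h' $$ (l, j))"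
        using Mmult[OF v h(1) gs] by (intro sum.cong) auto
      also have "\<dots> = (\<Sum>l<d. \<Sum>i<d. M v (gs i) * \<tau> h $$ (i, l) * \<tau> h' $$ (l, j))"
        using \<tau>[OF v h(1)] by (intro sum.cong) (auto simp: sum_distrib_right)
      also have "\<dots> = (\<Sum>i<d. \<Sum>l<d. M v (gs i) * \<tau> h $$ (i, l) * \<tau> h' $$ (l, j))" by (rule sum.swap)
      also have "\<dots> = (\<Sum>i<d. M v (gs i) * (\<tau> h * \<tau> h') $$ (i, j))"
        by (rule sum.cong) (auto simp: mat_mult_entry[OF \<tau>c \<tau>c _ ij(2)] sum_distrib_left algebra_simps simp del: index_mult_mat(1))
      finally show "(\<Sum>i<d. M v (gs i) * \<tau> (h * h') $$ (i, j)) = (\<Sum>i<d. M v (gs i) * (\<tau> h * \<tau> h') $$ (i, j))" .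
    qed
  qed (auto simp: \<tau>_def)
  have \<tau>_one: "\<tau> (1\<^sub>m k) = 1\<^sub>m d"
  proof (rule eq_matI)
    fix i j assume "i < dim_row (1\<^sub>m d :: complex mat)" "j < dim_col (1\<^sub>m d :: complex mat)"
    then have ij: "i < d" "j < d" by auto
    show "\<tau> (1\<^sub>m k) $$ (i, j) = 1\<^sub>m d $$ (i, j)"
    proof (rule unique[OF ij(1)])
      fix v assume v: "v \<in> V"
      have "(\<Sum>i<d. M v (gs i) * \<tau> (1\<^sub>m k) $$ (i, j)) = M v (1\<^sub>m k * gs j)" using \<tau>[OF v G_one ij(2)] by simp
      also have "\<dots> = M v (gs j)" using left_mult_one_mat[OF G_carrier[OF gs[OF ij(2)]]] by simp
      also have "\<dots> = (\<Sum>i<d. if i = j then M v (gs i) else 0)" using ij by simp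
      also have "\<dots> = (\<Sum>i<d. M v (gs i) * 1\<^sub>m d $$ (i, j))" by (rule sum.cong) (use ij in auto)
      finally show "(\<Sum>i<d. M v (gs i) * \<tau> (1\<^sub>m k) $$ (i, j)) = (\<Sum>i<d. M v (gs i) * 1\<^sub>m d $$ (i, j))" .
    qed
  qed (auto simp: \<tau>_def)
  have \<tau>_GL: "\<tau> h \<in> carrier (GL d)" if h: "h \<in> G" for h
  proof (rule GL_I[OF \<tau>c \<tau>c])
    show "\<tau> h * \<tau> (ginv h) = 1\<^sub>m d" "\<tau> (ginv h) * \<tau> h = 1\<^sub>m d"
      using \<tau>_mult[OF h G_inv[OF h]] \<tau>_mult[OF G_inv[OF h] h] GL_inv[OF G_GL[OF h]] \<tau>_one by simp_all
  qed
  \<comment> \<open>For fixed g the translate agrees on V with a polynomial q; separating q at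
    \<open>\<beta> (ginv h) v\<close> gives regular functions of \<open>ginv h\<close>, which are
    regular in h.\<close>
  have reg: "regular_on k G (\<lambda>h. M v (h * g))" if v: "v \<in> V" and g: "g \<in> G" for v g
  proof -
    define q where "q v = (\<Sum>(a, b)\<leftarrow>xs. a (ginv g) * b v)" for v
    have q: "q \<in> gen_algebra C" unfolding q_def
      by (rule gen_sum_list) (use xs in \<open>auto simp: separated_def\<close>)
    have Mq: "M v g = q v" if "v \<in> V" for v
      unfolding M_def q_def using xs that G_inv[OF g] unfolding separated_def by blast
    obtain ys where ys: "separated k G V C \<beta> q ys" using gen_separated[OF q] by blast
    have "regular_on k G (\<lambda>h. \<Sum>(a, b)\<leftarrow>ys. a (ginv h) * b v)"
      by (rule regular_sum_list) (use ys regular_inverse[OF G_subgroup] in \<open>auto simp: separated_def\<close>)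
    moreover have "(\<Sum>(a, b)\<leftarrow>ys. a (ginv h) * b v) = M v (h * g)" if h: "h \<in> G" for h
    proof -
      have "M v (h * g) = q (\<beta> (ginv h) v)" using Mmult[OF v h g] Mq[OF bV[OF h v]] by simp
      also have "\<dots> = (\<Sum>(a, b)\<leftarrow>ys. a (ginv h) * b v)" using ys G_inv[OF h] v unfolding separated_def by blast
      finally show ?thesis by simp
    qed
    ultimately show ?thesis by (rule regular_cong)
  qed
  have "rational_rep k G d \<tau>"
    unfolding rational_rep_def
  proof (intro conjI allI impI)
    show "\<tau> \<in> hom (GL k\<lparr>carrier := G\<rparr>) (GL d)"
      by (auto simp: hom_def \<tau>_mult GL_simps \<tau>_GL[unfolded GL_simps])
    fix i j assume ij: "i < d" "j < d"
    have "regular_on k G (\<lambda>h. \<Sum>l<d. F $$ (i, l) * M (vs l) (h * gs j))"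
      by (intro regular_sum regular_mult regular_const reg) (use vs gs ij in auto)
    then show "regular_on k G (\<lambda>g. \<tau> g $$ (i, j))" using ij by (simp add: \<tau>_def \<kappa>_def)
  qed
  then have ds: "direct_sum_of_irreducibles G d \<tau>" using reductive by (simp add: reductive_group_def)
  have Mz: "M z g = 1" if "g \<in> G" for g unfolding M_def using act_origin[OF G_inv[OF that]] pz by simp
  have d0: "d > 0"
  proof (rule ccontr)
    assume "\<not> d > 0"
    then show False using expand[OF origin G_one] Mz[OF G_one] by simp
  qed
  have inv: "(\<Sum>j<d. (\<tau> h *\<^sub>v w) $ j) = (\<Sum>j<d. w $ j)" if h: "h \<in> G" and w: "w \<in> carrier_vec d" for h w
  proof -
    have col: "(\<Sum>i<d. \<tau> h $$ (i, j)) = 1" if "j < d" for j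
    proof -
      have "M z (h * gs j) = (\<Sum>i<d. M z (gs i) * \<tau> h $$ (i, j))" by (rule \<tau>[OF origin h that])
      also have "\<dots> = (\<Sum>i<d. \<tau> h $$ (i, j))" by (rule sum.cong) (auto simp: Mz gs)
      finally show ?thesis using Mz[OF G_mult[OF h gs[OF that]]] by simp
    qed
    have "(\<Sum>i<d. (\<tau> h *\<^sub>v w) $ i) = (\<Sum>i<d. \<Sum>j<d. \<tau> h $$ (i, j) * w $ j)"
      using \<tau>c[of h] w by (intro sum.cong) (auto simp: scalar_prod_def lessThan_atLeast0 intro!: sum.cong)
    also have "\<dots> = (\<Sum>j<d. \<Sum>i<d. \<tau> h $$ (i, j) * w $ j)" by (rule sum.swap)
    also have "\<dots> = (\<Sum>j<d. w $ j)" using col by (simp flip: sum_distrib_right)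
    finally show ?thesis .
  qed
  obtain w where w: "w \<in> carrier_vec d" "\<And>h. h \<in> G \<Longrightarrow> \<tau> h *\<^sub>v w = w" "(\<Sum>j<d. w $ j) = 1"
    by (rule fixed_vector[OF ds \<tau>c inv d0]) auto
  \<comment> \<open>The separated form of p stands in for \<open>M\<close>: it lies in
    \<open>gen_algebra C\<close> as a function on the whole type, and the two agree on V.\<close>
  define f where "f v = (\<Sum>j<d. w $ j * (\<Sum>(a, b)\<leftarrow>xs. a (ginv (gs j)) * b v))" for v
  have fM: "f v = (\<Sum>j<d. w $ j * M v (gs j))" if v: "v \<in> V" for v
    unfolding f_def M_def using xs v G_inv[OF gs] unfolding separated_def by (intro sum.cong) auto
  have "f \<in> gen_algebra C" unfolding f_def
    by (intro gen_sum gen_algebra.mult gen_algebra.const gen_sum_list) (use xs in \<open>auto simp: separated_def\<close>)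
  moreover have "f (\<beta> g v) = f v" if g: "g \<in> G" and v: "v \<in> V" for g v
  proof -
    have h: "ginv g \<in> G" "ginv (ginv g) = g" using G_inv G_inv_inv g by auto
    have "f (\<beta> g v) = (\<Sum>j<d. w $ j * M v (ginv g * gs j))"
      unfolding fM[OF act_closed[OF g v]] using Mmult[OF v h(1) gs] h(2) by (intro sum.cong) auto
    also have "\<dots> = (\<Sum>j<d. \<Sum>i<d. w $ j * (M v (gs i) * \<tau> (ginv g) $$ (i, j)))"
      using \<tau>[OF v h(1)] by (intro sum.cong) (auto simp: sum_distrib_left)
    also have "\<dots> = (\<Sum>i<d. \<Sum>j<d. w $ j * (M v (gs i) * \<tau> (ginv g) $$ (i, j)))" by (rule sum.swap)
    also have "\<dots> = (\<Sum>i<d. M v (gs i) * (\<tau> (ginv g) *\<^sub>v w) $ i)"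
      using \<tau>c[of "ginv g"] w(1)
      by (intro sum.cong) (auto simp: scalar_prod_def lessThan_atLeast0 sum_distrib_left algebra_simps intro!: sum.cong)
    also have "\<dots> = f v" unfolding w(2)[OF h(1)] fM[OF v] by (simp add: mult.commute)
    finally show ?thesis .
  qed
  moreover have "f X = 0" unfolding fM[OF X] M_def using pX G_inv gs by simp
  moreover have "f z = 1" unfolding fM[OF origin] using Mz gs w(3) by simp
  ultimately show ?thesis by blast
qed

end

section \<open>Singular tuples\<close>

definition mon_eval :: "(nat \<Rightarrow> complex) \<Rightarrow> (nat \<Rightarrow>\<^sub>0 nat) \<Rightarrow> complex" where
  "mon_eval t k = (\<Prod>l\<in>Poly_Mapping.keys k. t l ^ Poly_Mapping.lookup k l)"

definition pm_eval :: "(nat \<Rightarrow> complex) \<Rightarrow> ((nat \<Rightarrow>\<^sub>0 nat) \<Rightarrow>\<^sub>0 complex) \<Rightarrow> complex" where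
  "pm_eval t p = (\<Sum>k\<in>Poly_Mapping.keys p. Poly_Mapping.lookup p k * mon_eval t k)"

lemma mon_eval_superset:
  "finite K \<Longrightarrow> Poly_Mapping.keys k \<subseteq> K \<Longrightarrow> mon_eval t k = (\<Prod>l\<in>K. t l ^ Poly_Mapping.lookup k l)"
  unfolding mon_eval_def by (rule prod.mono_neutral_left) (auto simp: in_keys_iff)

lemma pm_eval_superset:
  "finite K \<Longrightarrow> Poly_Mapping.keys p \<subseteq> K \<Longrightarrow> pm_eval t p = (\<Sum>k\<in>K. Poly_Mapping.lookup p k * mon_eval t k)"
  unfolding pm_eval_def by (rule sum.mono_neutral_left) (auto simp: in_keys_iff)

lemma mon_eval_add: "mon_eval t (a + b) = mon_eval t a * mon_eval t b"
proof -
  let ?K = "Poly_Mapping.keys a \<union> Poly_Mapping.keys b"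
  have "Poly_Mapping.keys (a + b) \<subseteq> ?K" by (rule keys_add)
  then show ?thesis
    by (simp add: mon_eval_superset[of ?K] lookup_add power_add prod.distrib)
qed

lemma pm_eval_add: "pm_eval t (p + q) = pm_eval t p + pm_eval t q"
proof -
  let ?K = "Poly_Mapping.keys p \<union> Poly_Mapping.keys q"
  have "Poly_Mapping.keys (p + q) \<subseteq> ?K" by (rule keys_add)
  then show ?thesis
    by (simp add: pm_eval_superset[of ?K] lookup_add algebra_simps sum.distrib)
qed

lemma pm_eval_single: "pm_eval t (Poly_Mapping.single k c) = c * mon_eval t k"
  by (simp add: pm_eval_def)

lemma poly_mapping_sum_induct [case_names zero add]:
  assumes "P 0" and "\<And>a b p. P p \<Longrightarrow> P (Poly_Mapping.single a b + p)"
  shows "P (p :: 'a \<Rightarrow>\<^sub>0 'b :: comm_monoid_add)"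
proof (induction p rule: update_induct)
  case (update f a b)
  have "Poly_Mapping.update a b f = Poly_Mapping.single a b + f"
    by (rule poly_mapping_eqI) (use update(1) in \<open>auto simp: lookup_update lookup_add lookup_single when_def in_keys_iff\<close>)
  then show ?case using assms(2) update(3) by simp
qed (rule assms(1))

lemma pm_eval_mult: "pm_eval t (p * q) = pm_eval t p * pm_eval t q"
proof (induction p rule: poly_mapping_sum_induct)
  case zero
  then show ?case by (simp add: pm_eval_def)
next
  case (add a b p)
  have "pm_eval t (Poly_Mapping.single a b * q) = b * mon_eval t a * pm_eval t q"
  proof (induction q rule: poly_mapping_sum_induct)
    case zero
    then show ?case by (simp add: pm_eval_def)
  next
    case (add c d q)
    then show ?case
      by (simp add: distrib_left pm_eval_add mult_single pm_eval_single mon_eval_add)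
  qed
  then show ?case using add by (simp add: distrib_right pm_eval_add pm_eval_single)
qed

lemma pm_eval_hom: "comm_ring_hom (pm_eval t)"
proof
  show "pm_eval t 0 = 0" by (simp add: pm_eval_def)
  show "pm_eval t 1 = 1"
    using pm_eval_single[of t 0 1] by (simp add: mon_eval_def)
qed (simp_all add: pm_eval_add pm_eval_mult)

lemma Fract_hom: "comm_ring_hom (\<lambda>p :: 'a :: idom. Fract p 1)"
  by standard (simp_all add: Zero_fract_def One_fract_def)

lemma Fract_eq_0: "Fract p 1 = 0 \<longleftrightarrow> p = (0 :: 'a :: idom)"
  by (simp add: Zero_fract_def eq_fract)

section \<open>Tuples as tensors and the generic determinant\<close>

definition tuple_of :: "nat \<Rightarrow> nat \<Rightarrow> tensor \<Rightarrow> complex mat list" where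
  "tuple_of n m T = map (\<lambda>l. mat n n (\<lambda>(i, j). T i j l)) [0..<m]"

definition tensor_of :: "nat \<Rightarrow> nat \<Rightarrow> complex mat list \<Rightarrow> tensor" where
  "tensor_of n m X = (\<lambda>i j l. if i < n \<and> j < n \<and> l < m then (X ! l) $$ (i, j) else 0)"

lemma tuple_of_entry: "l < m \<Longrightarrow> i < n \<Longrightarrow> j < n \<Longrightarrow> (tuple_of n m T ! l) $$ (i, j) = T i j l"
  by (simp add: tuple_of_def)

lemma tuple_of_Mat: "tuple_of n m T \<in> Mat_tuples n m"
  by (auto simp: tuple_of_def Mat_tuples_def)

lemma tensor_of_tensors: "tensor_of n m X \<in> tensors n m"
  by (auto simp: tensor_of_def tensors_def)

lemma tensor_of_tuple_of: "T \<in> tensors n m \<Longrightarrow> tensor_of n m (tuple_of n m T) = T"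
  by (rule tensor_eqI[OF tensor_of_tensors]) (auto simp: tensor_of_def tuple_of_entry)

lemma tuple_of_tensor_of:
  assumes X: "X \<in> Mat_tuples n m"
  shows "tuple_of n m (tensor_of n m X) = X"
proof (rule nth_equalityI)
  show "length (tuple_of n m (tensor_of n m X)) = length X" using X by (simp add: tuple_of_def Mat_tuples_def)
  fix l assume "l < length (tuple_of n m (tensor_of n m X))"
  then have l: "l < m" by (simp add: tuple_of_def)
  have "X ! l \<in> carrier_mat n n" using X l by (auto simp: Mat_tuples_def)
  then show "tuple_of n m (tensor_of n m X) ! l = X ! l"
    by (intro eq_matI) (use l in \<open>auto simp: tuple_of_def tensor_of_def\<close>)
qed

lemma invertible_mat_iff_det:
  fixes A :: "'a :: field mat"
  assumes A: "A \<in> carrier_mat n n"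
  shows "invertible_mat A \<longleftrightarrow> det A \<noteq> 0"
proof
  assume "invertible_mat A"
  then obtain B where B: "A * B = 1\<^sub>m n" "B * A = 1\<^sub>m (dim_row B)"
    using A unfolding invertible_mat_def inverts_mat_def by auto
  have "B \<in> carrier_mat n n"
    using A B by (metis carrier_matD carrier_matI index_mult_mat(2,3) index_one_mat(2,3))
  then show "det A \<noteq> 0" using det_mult[OF A, of B] B by auto
next
  assume "det A \<noteq> 0"
  from det_non_zero_imp_unit[OF A this, of "()"] obtain B where "B \<in> carrier_mat n n" "A * B = 1\<^sub>m n" "B * A = 1\<^sub>m n"
    unfolding Units_def by (auto simp: ring_mat_def)
  then show "invertible_mat A" using A unfolding invertible_mat_def inverts_mat_def by auto
qed

lemma generic_carrier: "generic_combination n m X \<in> carrier_mat n n"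
  by (simp add: generic_combination_def)

lemma SING_iff: "X \<in> SING n m \<longleftrightarrow> X \<in> Mat_tuples n m \<and> det (generic_combination n m X) = 0"
  unfolding SING_def using invertible_mat_iff_det[OF generic_carrier] by auto

text \<open>The generic determinant comes from the polynomial ring, which embeds into its fraction
  field; so it vanishes already there and can be specialized at t.\<close>

lemma SING_imp_det_comb:
  assumes X: "X \<in> SING n m"
  shows "det (comb n m t (tensor_of n m X)) = 0"
proof -
  let ?var = "\<lambda>l. Poly_Mapping.single (Poly_Mapping.single l 1) 1 :: (nat \<Rightarrow>\<^sub>0 nat) \<Rightarrow>\<^sub>0 complex"
  let ?con = "\<lambda>c. Poly_Mapping.single 0 c :: (nat \<Rightarrow>\<^sub>0 nat) \<Rightarrow>\<^sub>0 complex"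
  define A where "A = mat n n (\<lambda>(i, j). \<Sum>l<m. ?var l * ?con ((X ! l) $$ (i, j)))"
  interpret F: comm_ring_hom "\<lambda>p :: (nat \<Rightarrow>\<^sub>0 nat) \<Rightarrow>\<^sub>0 complex. Fract p 1" by (rule Fract_hom)
  interpret E: comm_ring_hom "pm_eval t" by (rule pm_eval_hom)
  have "map_mat (\<lambda>p. Fract p 1) A = generic_combination n m X"
    by (rule eq_matI) (auto simp: A_def generic_combination_def rf_var_def rf_const_def F.hom_sum)
  then have "Fract (det A) 1 = 0" using X F.hom_det[of A] by (simp add: SING_iff)
  then have "det A = 0" by (simp only: Fract_eq_0)
  moreover have "map_mat (pm_eval t) A = comb n m t (tensor_of n m X)"
    by (rule eq_matI) (auto simp: A_def comb_def tensor_of_def E.hom_sum E.hom_mult pm_eval_single mon_eval_def)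
  ultimately show ?thesis using E.hom_det[of A] by simp
qed

lemma rf_const_hom: "rf_const (a + b) = rf_const a + rf_const b" "rf_const (a * b) = rf_const a * rf_const b"
  "rf_const 0 = 0" "rf_const a = 0 \<longleftrightarrow> a = 0"
  by (simp_all add: rf_const_def single_add mult_single Zero_fract_def eq_fract)
    (metis lookup_single_eq lookup_zero single_zero)

lemma rf_const_sum: "rf_const (\<Sum>i\<in>I. f i) = (\<Sum>i\<in>I. rf_const (f i))"
  by (induction I rule: infinite_finite_induct) (auto simp: rf_const_hom)

lemma generic_kernel:
  assumes "\<And>i. i < n \<Longrightarrow> (\<Sum>j<n. generic_combination n m X $$ (i, j) * v j) = 0" "j < n" "v j \<noteq> 0"
    and X: "X \<in> Mat_tuples n m"
  shows "X \<in> SING n m"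
proof -
  have "generic_combination n m X *\<^sub>v vec n v = 0\<^sub>v n"
    by (rule eq_vecI)
      (use assms(1) generic_carrier[of n m X] in \<open>auto simp: scalar_prod_def lessThan_atLeast0\<close>)
  moreover have "vec n v \<noteq> 0\<^sub>v n" using assms(2,3) by (metis index_vec index_zero_vec(1))
  ultimately have "det (generic_combination n m X) = 0"
    using det_0_iff_vec_prod_zero_field[OF generic_carrier] by (metis vec_carrier)
  then show ?thesis using X by (simp add: SING_iff)
qed

lemma generic_transpose:
  "generic_combination n m (tuple_of n m (flip T)) = (generic_combination n m (tuple_of n m T))\<^sup>T"
  by (rule eq_matI) (auto simp: generic_combination_def tuple_of_entry flip_apply)

lemma SING_flip: "tuple_of n m (flip T) \<in> SING n m \<longleftrightarrow> tuple_of n m T \<in> SING n m"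
  using det_transpose[OF generic_carrier[of n m "tuple_of n m T"]] unfolding SING_iff generic_transpose
  by (simp add: tuple_of_Mat)

text \<open>A common complex right null vector of the slices remains a null vector of the generic
  combination.\<close>

lemma flip_row_degenerate_SING:
  assumes "row_degenerate n m (flip T)"
  shows "tuple_of n m T \<in> SING n m"
proof -
  obtain u where u: "nz n u" "\<And>j l. j < n \<Longrightarrow> l < m \<Longrightarrow> (\<Sum>i<n. u i * T j i l) = 0"
    using assms unfolding row_degenerate_def flip_apply by blast
  obtain j where j: "j < n" "u j \<noteq> 0" using u(1) by (auto simp: nz_def)
  show ?thesis
  proof (rule generic_kernel[where v="\<lambda>j. rf_const (u j)", OF _ j(1) _ tuple_of_Mat])
    fix i assume i: "i < n"
    have "(\<Sum>j<n. generic_combination n m (tuple_of n m T) $$ (i, j) * rf_const (u j)) =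
        (\<Sum>j<n. \<Sum>l<m. rf_var l * rf_const (u j * T i j l))"
      by (rule sum.cong)
        (use i in \<open>auto simp: generic_combination_def tuple_of_entry rf_const_hom sum_distrib_right sum_distrib_left algebra_simps\<close>)
    also have "\<dots> = (\<Sum>l<m. \<Sum>j<n. rf_var l * rf_const (u j * T i j l))" by (rule sum.swap)
    also have "\<dots> = (\<Sum>l<m. rf_var l * rf_const (\<Sum>j<n. u j * T i j l))"
      by (simp add: rf_const_sum sum_distrib_left)
    also have "\<dots> = 0" using u(2)[OF i] by (simp add: rf_const_hom)
    finally show "(\<Sum>j<n. generic_combination n m (tuple_of n m T) $$ (i, j) * rf_const (u j)) = 0" .
  qed (use j in \<open>simp add: rf_const_hom\<close>)
qed

lemma row_degenerate_SING: "row_degenerate n m T \<Longrightarrow> tuple_of n m T \<in> SING n m"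
  using flip_row_degenerate_SING[of n m "flip T"] by (simp add: SING_flip)

text \<open>A singular tuple which is not singular because of a large block of zeros.\<close>

definition skew :: "complex \<Rightarrow> nat \<Rightarrow> nat \<Rightarrow> tensor" where
  "skew e n m i j l = (if i < n \<and> j < n \<and> l < m then
     (if l = 0 then (if i = 0 \<and> j = 1 then e else if i = 1 \<and> j = 0 then - e else if i = j \<and> 3 \<le> i then 1 else 0)
      else if l = 1 then (if i = 0 \<and> j = 2 then e else if i = 2 \<and> j = 0 then - e else 0)
      else if l = 2 then (if i = 1 \<and> j = 2 then e else if i = 2 \<and> j = 1 then - e else 0) else 0) else 0)"

lemma skew_tensors: "skew e n m \<in> tensors n m"
  by (simp add: tensors_def skew_def)

text \<open>The parameter e makes the family closed under transposition, since the skew part changes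
  sign and the padding is symmetric. Preservers with and without transposition are thus treated
  together.\<close>

lemma flip_skew: "flip (skew e n m) = skew (- e) n m"
proof (intro ext)
  fix i j l :: nat
  consider "l = 0" | "l = 1" | "l = 2" | "l \<noteq> 0" "l \<noteq> 1" "l \<noteq> 2" by blast
  then show "flip (skew e n m) i j l = skew (- e) n m i j l"
    by cases (simp_all add: flip_def skew_def)
qed

lemma sum_first_three:
  fixes f :: "nat \<Rightarrow> 'a :: comm_monoid_add"
  assumes "m \<ge> 3" "\<And>l. 3 \<le> l \<Longrightarrow> l < m \<Longrightarrow> f l = 0"
  shows "(\<Sum>l<m. f l) = f 0 + (f 1 + f 2)"
proof -
  have "(\<Sum>l<m. f l) = (\<Sum>l\<in>{0, 1, 2}. f l)"
    by (rule sum.mono_neutral_right) (use assms in \<open>auto simp: not_less_eq_eq numeral_3_eq_3 numeral_2_eq_2 le_Suc_eq\<close>)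
  then show ?thesis by simp
qed

lemma skew_SING:
  assumes n: "n \<ge> 3" and m: "m \<ge> 3"
  shows "tuple_of n m (skew 1 n m) \<in> SING n m"
proof -
  \<comment> \<open>The kernel vector of the generic 3 x 3 skew-symmetric matrix: its three entries
    with alternating signs, i.e. the sub-Pfaffians.\<close>
  define v where "v j = (if j = 0 then rf_var 2 else if j = 1 then - rf_var 1 else if j = 2 then rf_var 0 else 0)" for j :: nat
  have G: "generic_combination n m (tuple_of n m (skew 1 n m)) $$ (i, j) =
     rf_var 0 * rf_const (skew 1 n m i j 0) + (rf_var 1 * rf_const (skew 1 n m i j 1) + rf_var 2 * rf_const (skew 1 n m i j 2))"
    if "i < n" "j < n" for i j
  proof -
    have "generic_combination n m (tuple_of n m (skew 1 n m)) $$ (i, j) = (\<Sum>l<m. rf_var l * rf_const (skew 1 n m i j l))"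
      using that by (simp add: generic_combination_def tuple_of_entry)
    also have "\<dots> = rf_var 0 * rf_const (skew 1 n m i j 0) + (rf_var 1 * rf_const (skew 1 n m i j 1) + rf_var 2 * rf_const (skew 1 n m i j 2))"
      by (rule sum_first_three[OF m]) (auto simp: skew_def rf_const_hom)
    finally show ?thesis .
  qed
  have c1: "rf_const 1 = 1" "rf_const (- 1) = - 1"
  proof -
    show one: "rf_const 1 = 1" by (simp add: rf_const_def One_fract_def)
    have "rf_const (- 1) + rf_const 1 = 0" unfolding rf_const_hom(1)[symmetric] by (simp add: rf_const_hom)
    then show "rf_const (- 1) = - 1" unfolding one by (simp add: eq_neg_iff_add_eq_0)
  qed
  show ?thesis
  proof (rule generic_kernel[where v=v and j=0, OF _ _ _ tuple_of_Mat])
    fix i assume i: "i < n"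
    let ?G = "generic_combination n m (tuple_of n m (skew 1 n m))"
    have "(\<Sum>j<n. ?G $$ (i, j) * v j) = ?G $$ (i, 0) * v 0 + (?G $$ (i, 1) * v 1 + ?G $$ (i, 2) * v 2)"
      by (rule sum_first_three[OF n]) (auto simp: v_def)
    also have "\<dots> = 0"
    proof -
      consider "i = 0" | "i = 1" | "i = 2" | "i \<ge> 3" by linarith
      then show ?thesis
        by cases (use i n m in \<open>simp_all add: G v_def skew_def rf_const_hom c1 algebra_simps\<close>)
    qed
    finally show "(\<Sum>j<n. ?G $$ (i, j) * v j) = 0" .
  next
    have "rf_var 2 \<noteq> 0"
      unfolding rf_var_def by (simp add: Zero_fract_def eq_fract) (metis lookup_single_eq lookup_zero one_neq_zero)
    then show "v 0 \<noteq> 0" by (simp add: v_def)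
  qed (use n in auto)
qed

text \<open>The first n - a columns are supported on the n - 1 - a rows below the block and hence
  dependent. To see this by a determinant, the remaining a columns are replaced by unit vectors in
  the first a rows: row a becomes zero, and the kernel vector is forced to vanish on the replaced
  columns.\<close>

lemma zero_block_kernel:
  fixes N :: "complex mat"
  assumes N: "N \<in> carrier_mat n n" and a: "a < n"
    and block: "\<And>i j. i \<le> a \<Longrightarrow> j < n - a \<Longrightarrow> N $$ (i, j) = 0"
  obtains \<gamma> where "\<exists>j<n. \<gamma> j \<noteq> 0" "\<And>j. n - a \<le> j \<Longrightarrow> j < n \<Longrightarrow> \<gamma> j = 0"
    "\<And>i. i < n \<Longrightarrow> (\<Sum>j<n. N $$ (i, j) * \<gamma> j) = 0"
proof -
  define N' where "N' = mat n n (\<lambda>(i, j). if j < n - a then N $$ (i, j) else if i < a \<and> j = n - a + i then 1 else 0)"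
  have N': "N' \<in> carrier_mat n n" by (simp add: N'_def)
  have "det N' = 0" by (rule det_zero_row[OF N' a]) (use a block in \<open>auto simp: N'_def\<close>)
  then obtain x where x: "x \<in> carrier_vec n" "x \<noteq> 0\<^sub>v n" "N' *\<^sub>v x = 0\<^sub>v n"
    using det_0_iff_vec_prod_zero_field[OF N'] by blast
  have row: "(\<Sum>j<n. N' $$ (i, j) * x $ j) = 0" if "i < n" for i
  proof -
    have "(N' *\<^sub>v x) $ i = (\<Sum>j<n. N' $$ (i, j) * x $ j)"
      using N' x(1) that by (auto simp: scalar_prod_def lessThan_atLeast0 intro!: sum.cong)
    then show ?thesis using x(3) that by simp
  qed
  have supp: "x $ j = 0" if "n - a \<le> j" "j < n" for j
  proof -
    define i where "i = j - (n - a)"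
    have i: "i < a" "j = n - a + i" using that a by (auto simp: i_def)
    have "(\<Sum>l<n. N' $$ (i, l) * x $ l) = (\<Sum>l<n. if l = j then x $ l else 0)"
      by (rule sum.cong) (use i a that block[of i] in \<open>auto simp: N'_def\<close>)
    then show ?thesis using row[of i] i a that by simp
  qed
  show ?thesis
  proof (rule that[of "\<lambda>j. x $ j"])
    show "\<exists>j<n. x $ j \<noteq> 0" using x(1,2) by (metis carrier_vecD eq_vecI index_zero_vec)
    show "(\<Sum>j<n. N $$ (i, j) * x $ j) = 0" if "i < n" for i
    proof -
      have "(\<Sum>j<n. N $$ (i, j) * x $ j) = (\<Sum>j<n. N' $$ (i, j) * x $ j)"
        by (rule sum.cong) (use that supp in \<open>auto simp: N'_def not_less\<close>)
      then show ?thesis using row[OF that] by simp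
    qed
  qed (use supp in auto)
qed

text \<open>\<open>zero_block_kernel\<close> is applied to R s K^T. There R cancels on the left, and
  K^T carries \<gamma> to a nonzero kernel vector of s.\<close>

lemma sandwich_kernel:
  fixes R K :: "complex mat" and s :: "nat \<Rightarrow> nat \<Rightarrow> complex"
  assumes R: "R \<in> carrier_mat n n" "det R \<noteq> 0" and K: "K \<in> carrier_mat n n" "det K \<noteq> 0" and a: "a < n"
    and block: "\<And>i j. i \<le> a \<Longrightarrow> j < n - a \<Longrightarrow> (\<Sum>x<n. \<Sum>y<n. R $$ (i, x) * K $$ (j, y) * s x y) = 0"
  obtains \<gamma> where "\<exists>y<n. (\<Sum>j<n. K $$ (j, y) * \<gamma> j) \<noteq> 0" "\<And>j. n - a \<le> j \<Longrightarrow> j < n \<Longrightarrow> \<gamma> j = 0"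
    "\<And>x. x < n \<Longrightarrow> (\<Sum>y<n. s x y * (\<Sum>j<n. K $$ (j, y) * \<gamma> j)) = 0"
proof -
  define N where "N = mat n n (\<lambda>(i, j). \<Sum>x<n. \<Sum>y<n. R $$ (i, x) * K $$ (j, y) * s x y)"
  have N: "N \<in> carrier_mat n n" by (simp add: N_def)
  obtain \<gamma> where \<gamma>: "\<exists>j<n. \<gamma> j \<noteq> 0" "\<And>j. n - a \<le> j \<Longrightarrow> j < n \<Longrightarrow> \<gamma> j = 0"
    "\<And>i. i < n \<Longrightarrow> (\<Sum>j<n. N $$ (i, j) * \<gamma> j) = 0"
    by (rule zero_block_kernel[OF N a]) (use block a in \<open>auto simp: N_def\<close>)
  define c where "c y = (\<Sum>j<n. K $$ (j, y) * \<gamma> j)" for y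
  have inj: "\<forall>y<n. x y = 0" if A: "A \<in> carrier_mat n n" "det A \<noteq> 0" and z: "\<And>i. i < n \<Longrightarrow> (\<Sum>y<n. A $$ (i, y) * x y) = 0"
    for A :: "complex mat" and x
  proof -
    have "A *\<^sub>v vec n x = 0\<^sub>v n"
      by (rule eq_vecI) (use z A in \<open>auto simp: scalar_prod_def lessThan_atLeast0\<close>)
    then have "vec n x = 0\<^sub>v n" using det_0_iff_vec_prod_zero_field[OF A(1)] A(2) by (metis vec_carrier)
    then show ?thesis by (metis index_vec index_zero_vec(1))
  qed
  have KT: "K\<^sup>T \<in> carrier_mat n n" "det K\<^sup>T \<noteq> 0" using K det_transpose[OF K(1)] by auto
  have "\<exists>y<n. c y \<noteq> 0"
  proof (rule ccontr)
    assume "\<not> ?thesis"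
    then have "(\<Sum>j<n. K\<^sup>T $$ (y, j) * \<gamma> j) = 0" if "y < n" for y using that K by (simp add: c_def)
    note * = this
    have "\<forall>j<n. \<gamma> j = 0" by (rule inj[OF KT *])
    then show False using \<gamma>(1) by blast
  qed
  moreover have "(\<Sum>y<n. s x y * c y) = 0" if "x < n" for x
  proof -
    have "(\<Sum>x<n. R $$ (i, x) * (\<Sum>y<n. s x y * c y)) = 0" if i: "i < n" for i
    proof -
      have "(\<Sum>x<n. R $$ (i, x) * (\<Sum>y<n. s x y * c y)) =
          (\<Sum>x<n. \<Sum>y<n. \<Sum>j<n. R $$ (i, x) * K $$ (j, y) * s x y * \<gamma> j)"
        by (simp add: c_def sum_distrib_left algebra_simps)
      also have "\<dots> = (\<Sum>x<n. \<Sum>j<n. \<Sum>y<n. R $$ (i, x) * K $$ (j, y) * s x y * \<gamma> j)"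
        by (intro sum.cong refl sum.swap)
      also have "\<dots> = (\<Sum>j<n. \<Sum>x<n. \<Sum>y<n. R $$ (i, x) * K $$ (j, y) * s x y * \<gamma> j)"
        by (rule sum.swap)
      also have "\<dots> = (\<Sum>j<n. N $$ (i, j) * \<gamma> j)"
        using i by (simp add: N_def sum_distrib_right)
      finally show ?thesis using \<gamma>(3)[OF i] by simp
    qed
    note * = this
    have "\<forall>x<n. (\<Sum>y<n. s x y * c y) = 0" by (rule inj[OF R *])
    then show ?thesis using that by simp
  qed
  ultimately show ?thesis
    by (intro that[of \<gamma>]) (simp_all add: c_def \<gamma>(2))
qed

text \<open>A vector \<gamma> found from one slice is supported on the columns of the block, which
  is zero in all slices. So a row of R in the block also annihilates the images of the transported
  vector under the other slices.\<close>

lemma sandwich_column: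
  assumes "\<And>j. n - a \<le> j \<Longrightarrow> j < n \<Longrightarrow> \<gamma> j = 0"
    and block: "\<And>j. j < n - a \<Longrightarrow> (\<Sum>x<n. \<Sum>y<n. r x * K $$ (j, y) * s x y) = (0 :: complex)"
  shows "(\<Sum>x<n. \<Sum>y<n. r x * s x y * (\<Sum>j<n. K $$ (j, y) * \<gamma> j)) = 0"
proof -
  have "(\<Sum>x<n. \<Sum>y<n. r x * s x y * (\<Sum>j<n. K $$ (j, y) * \<gamma> j)) =
      (\<Sum>x<n. \<Sum>y<n. \<Sum>j<n. r x * K $$ (j, y) * s x y * \<gamma> j)"
    by (simp add: sum_distrib_left algebra_simps)
  also have "\<dots> = (\<Sum>x<n. \<Sum>j<n. \<Sum>y<n. r x * K $$ (j, y) * s x y * \<gamma> j)"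
    by (intro sum.cong refl sum.swap)
  also have "\<dots> = (\<Sum>j<n. \<Sum>x<n. \<Sum>y<n. r x * K $$ (j, y) * s x y * \<gamma> j)" by (rule sum.swap)
  also have "\<dots> = (\<Sum>j<n. (\<Sum>x<n. \<Sum>y<n. r x * K $$ (j, y) * s x y) * \<gamma> j)"
    by (simp add: sum_distrib_right)
  also have "\<dots> = 0" 
  proof (intro sum.neutral ballI)
    fix j assume "j \<in> {..<n}"
    then show "(\<Sum>x<n. \<Sum>y<n. r x * K $$ (j, y) * s x y) * \<gamma> j = 0"
      using assms(1)[of j] block[of j] by (cases "j < n - a") auto
  qed
  finally show ?thesis .
qed

lemma sum_single_term:
  fixes f :: "nat \<Rightarrow> complex"
  shows "y < n \<Longrightarrow> (\<And>x. x < n \<Longrightarrow> x \<noteq> y \<Longrightarrow> f x = 0) \<Longrightarrow> (\<Sum>x<n. f x) = f y"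
  by (subst sum.remove[of _ y]) (auto intro: sum.neutral)

text \<open>The kernel of slice 0 is spanned by the unit vector with index 2, so this is the
  transported kernel vector up to a factor. Slices 1 and 2 map it to multiples of the unit vectors
  with index 0 and 1, which the rows of R in the block must annihilate.\<close>

lemma skew_block_left:
  assumes n: "n \<ge> 3" and m: "m \<ge> 3" and e: "e \<noteq> 0"
    and R: "R \<in> carrier_mat n n" "det R \<noteq> 0" and K: "K \<in> carrier_mat n n" "det K \<noteq> 0" and a: "a < n"
    and block: "\<And>i j l. i \<le> a \<Longrightarrow> j < n - a \<Longrightarrow> l < m \<Longrightarrow>
      (\<Sum>x<n. \<Sum>y<n. R $$ (i, x) * K $$ (j, y) * skew e n m x y l) = 0"
    and i: "i \<le> a"
  shows "R $$ (i, 0) = 0" "R $$ (i, 1) = 0"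
proof -
  obtain \<gamma> where nz: "\<exists>y<n. (\<Sum>j<n. K $$ (j, y) * \<gamma> j) \<noteq> 0"
    and supp: "\<And>j. n - a \<le> j \<Longrightarrow> j < n \<Longrightarrow> \<gamma> j = 0"
    and ker: "\<And>x. x < n \<Longrightarrow> (\<Sum>y<n. skew e n m x y 0 * (\<Sum>j<n. K $$ (j, y) * \<gamma> j)) = 0"
    by (rule sandwich_kernel[OF R K a, of "\<lambda>x y. skew e n m x y 0"]) (use block m in auto)
  define c where "c y = (\<Sum>j<n. K $$ (j, y) * \<gamma> j)" for y
  have "(\<Sum>y<n. skew e n m 0 y 0 * c y) = skew e n m 0 1 0 * c 1"
    by (rule sum_single_term) (use n in \<open>auto simp: skew_def\<close>)
  then have c1: "c 1 = 0" using ker[of 0] n m e by (simp add: c_def skew_def)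
  have "(\<Sum>y<n. skew e n m 1 y 0 * c y) = skew e n m 1 0 0 * c 0"
    by (rule sum_single_term) (use n in \<open>auto simp: skew_def\<close>)
  then have c0: "c 0 = 0" using ker[of 1] n m e by (simp add: c_def skew_def)
  have c3: "c x = 0" if x: "3 \<le> x" "x < n" for x
  proof -
    have "(\<Sum>y<n. skew e n m x y 0 * c y) = skew e n m x x 0 * c x"
      by (rule sum_single_term) (use x in \<open>auto simp: skew_def\<close>)
    then show ?thesis using ker[of x] x m by (simp add: c_def skew_def)
  qed
  have c_other: "c y = 0" if "y < n" "y \<noteq> 2" for y
  proof -
    have "y = 0 \<or> y = 1 \<or> 3 \<le> y" using that by linarith
    then show ?thesis using c0 c1 c3 that by auto
  qed
  then have c2: "c 2 \<noteq> 0" using nz unfolding c_def[symmetric] by metis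
  have col: "(\<Sum>x<n. R $$ (i, x) * skew e n m x 2 l) * c 2 = 0" if l: "l < m" for l
  proof -
    have "(\<Sum>x<n. \<Sum>y<n. R $$ (i, x) * skew e n m x y l * c y) = 0"
      unfolding c_def by (rule sandwich_column[OF supp block[OF i _ l]])
    moreover have "(\<Sum>y<n. R $$ (i, x) * skew e n m x y l * c y) = R $$ (i, x) * skew e n m x 2 l * c 2" for x
      by (rule sum_single_term) (use n c_other in auto)
    ultimately show ?thesis by (simp add: sum_distrib_right)
  qed
  have "(\<Sum>x<n. R $$ (i, x) * skew e n m x 2 1) = R $$ (i, 0) * skew e n m 0 2 1"
    by (rule sum_single_term) (use n in \<open>auto simp: skew_def\<close>)
  then show "R $$ (i, 0) = 0" using col[of 1] c2 n m e by (simp add: skew_def)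
  have "(\<Sum>x<n. R $$ (i, x) * skew e n m x 2 2) = R $$ (i, 1) * skew e n m 1 2 2"
    by (rule sum_single_term) (use n in \<open>auto simp: skew_def\<close>)
  then show "R $$ (i, 1) = 0" using col[of 2] c2 n m e by (simp add: skew_def)
qed

text \<open>By \<open>skew_block_left\<close> and its transpose, the rows of R and K in the block
  vanish at the indices 0 and 1. Changing slice 0 in positions with an index below 2 therefore keeps
  the zero block, but such a change can make it invertible, while a matrix with this block is
  singular.\<close>

lemma skew_no_block:
  assumes n: "n \<ge> 3" and m: "m \<ge> 3" and e: "e \<noteq> 0"
    and R: "R \<in> carrier_mat n n" "det R \<noteq> 0" and K: "K \<in> carrier_mat n n" "det K \<noteq> 0" and a: "a < n"
    and block: "\<And>i j l. i \<le> a \<Longrightarrow> j < n - a \<Longrightarrow> l < m \<Longrightarrow>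
      (\<Sum>x<n. \<Sum>y<n. R $$ (i, x) * K $$ (j, y) * skew e n m x y l) = 0"
  shows False
proof -
  have R01: "R $$ (i, x) = 0" if "i \<le> a" "x < 2" for i x
    using skew_block_left[OF n m e R K a block that(1)] that(2) by (auto simp: less_Suc_eq numeral_2_eq_2)
  \<comment> \<open>The transposed block has \<open>n - a\<close> rows and \<open>a + 1\<close>
    columns, which is the same shape with \<open>n - 1 - a\<close> in place of a.\<close>
  have "(\<Sum>x<n. \<Sum>y<n. K $$ (j, x) * R $$ (i, y) * skew (- e) n m x y l) = 0"
    if "j \<le> n - 1 - a" "i < n - (n - 1 - a)" "l < m" for i j l
  proof -
    have "(\<Sum>x<n. \<Sum>y<n. K $$ (j, x) * R $$ (i, y) * skew (- e) n m x y l) =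
        (\<Sum>y<n. \<Sum>x<n. R $$ (i, y) * K $$ (j, x) * skew e n m y x l)"
      by (subst sum.swap) (simp add: flip_skew[symmetric] flip_apply algebra_simps)
    then show ?thesis using block[of i j l] that a by simp
  qed
  then have K01: "K $$ (j, y) = 0" if "j < n - a" "y < 2" for j y
    using skew_block_left[OF n m _ K R, of "- e" "n - 1 - a" j] e a that by (auto simp: less_Suc_eq numeral_2_eq_2)
  \<comment> \<open>The permutation matrix that exchanges 0 and 2. It agrees with slice 0 wherever
    both indices are at least 2, including the zero at position (2, 2).\<close>
  define p where "p x y = (if x = 0 \<and> y = 2 \<or> x = 2 \<and> y = 0 \<or> x = 1 \<and> y = 1 \<or> x = y \<and> 3 \<le> x then 1 else 0 :: complex)"
    for x y :: nat
  have "(\<Sum>x<n. \<Sum>y<n. R $$ (i, x) * K $$ (j, y) * p x y) = 0" if ij: "i \<le> a" "j < n - a" for i j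
  proof -
    have "R $$ (i, x) * K $$ (j, y) * p x y = R $$ (i, x) * K $$ (j, y) * skew e n m x y 0"
      if "x < n" "y < n" for x y
    proof (cases "x < 2 \<or> y < 2")
      case True
      then show ?thesis using R01[OF ij(1)] K01[OF ij(2)] by auto
    next
      case False
      then show ?thesis using that m by (auto simp: p_def skew_def)
    qed
    then have "(\<Sum>x<n. \<Sum>y<n. R $$ (i, x) * K $$ (j, y) * p x y) =
        (\<Sum>x<n. \<Sum>y<n. R $$ (i, x) * K $$ (j, y) * skew e n m x y 0)" by (intro sum.cong) auto
    then show ?thesis using block[OF ij, of 0] m by simp
  qed
  note blk = this
  obtain \<gamma> where nz: "\<exists>y<n. (\<Sum>j<n. K $$ (j, y) * \<gamma> j) \<noteq> 0"
    and supp: "\<And>j. n - a \<le> j \<Longrightarrow> j < n \<Longrightarrow> \<gamma> j = 0"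
    and ker: "\<And>x. x < n \<Longrightarrow> (\<Sum>y<n. p x y * (\<Sum>j<n. K $$ (j, y) * \<gamma> j)) = 0"
    by (rule sandwich_kernel[OF R K a, of p]) (use blk in auto)
  define q where "q y = (if y = 0 then 2 else if y = 2 then 0 else y)" for y :: nat
  have "(\<Sum>j<n. K $$ (j, y) * \<gamma> j) = 0" if y: "y < n" for y
  proof -
    have q: "q y < n" using y n by (auto simp: q_def)
    have "(\<Sum>y'<n. p (q y) y' * (\<Sum>j<n. K $$ (j, y') * \<gamma> j)) = p (q y) y * (\<Sum>j<n. K $$ (j, y) * \<gamma> j)"
      by (rule sum_single_term[OF y]) (auto simp: p_def q_def split: if_splits)
    moreover have "p (q y) y = 1" by (auto simp: p_def q_def)
    ultimately show ?thesis using ker[OF q] by simp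
  qed
  then show False using nz by blast
qed

section \<open>Degenerating tensors\<close>

abbreviation box :: "nat \<Rightarrow> nat \<Rightarrow> (nat \<times> nat \<times> nat) set" where
  "box n m \<equiv> {..<n} \<times> {..<n} \<times> {..<m}"

section \<open>Triples of matrices acting on tensors\<close>

definition actm :: "nat \<Rightarrow> nat \<Rightarrow> complex mat \<Rightarrow> complex mat \<Rightarrow> complex mat \<Rightarrow> tensor \<Rightarrow> tensor" where
  "actm n m M N K T = act n m (\<lambda>a i. M $$ (a, i)) (\<lambda>b j. N $$ (b, j)) (\<lambda>k l. K $$ (k, l)) T"

lemma act_tensors: "act n m P Q A T \<in> tensors n m"
  by (simp add: act_def tensors_def)

lemma actm_tensors: "actm n m M N K T \<in> tensors n m"
  unfolding actm_def by (rule act_tensors)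

lemma act_eq_actm:
  "act n m P Q A T = actm n m (mat n n (\<lambda>(i, j). P i j)) (mat n n (\<lambda>(i, j). Q i j)) (mat m m (\<lambda>(i, j). A i j)) T"
  unfolding actm_def act_def by (intro ext) (auto intro!: sum.cong)

lemma actm_entry:
  "a < n \<Longrightarrow> b < n \<Longrightarrow> c < m \<Longrightarrow>
   actm n m M N K T a b c = (\<Sum>(i, j, l)\<in>box n m. M $$ (a, i) * N $$ (b, j) * K $$ (c, l) * T i j l)"
  by (simp add: actm_def act_def sum.cartesian_product)

lemma sum_triple_product:
  fixes f g h :: "nat \<Rightarrow> complex"
  shows "(\<Sum>(i, j, l)\<in>box n m. f i * g j * h l) = (\<Sum>i<n. f i) * (\<Sum>j<n. g j) * (\<Sum>l<m. h l)"
proof -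
  have "(\<Sum>(i, j, l)\<in>box n m. f i * g j * h l) = (\<Sum>i<n. \<Sum>j<n. \<Sum>l<m. f i * g j * h l)"
    by (simp add: sum.cartesian_product)
  also have "\<dots> = (\<Sum>i<n. (\<Sum>j<n. f i * g j) * (\<Sum>l<m. h l))"
    by (simp only: sum_distrib_left[symmetric] sum_distrib_right[symmetric])
  also have "\<dots> = (\<Sum>i<n. f i) * (\<Sum>j<n. g j) * (\<Sum>l<m. h l)"
    by (simp only: sum_distrib_left[symmetric] sum_distrib_right[symmetric])
  finally show ?thesis .
qed

lemma actm_comp:
  assumes M: "M \<in> carrier_mat n n" "M' \<in> carrier_mat n n" and N: "N \<in> carrier_mat n n" "N' \<in> carrier_mat n n"
    and K: "K \<in> carrier_mat m m" "K' \<in> carrier_mat m m"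
  shows "actm n m M N K (actm n m M' N' K' T) = actm n m (M * M') (N * N') (K * K') T"
proof (rule tensor_eqI[OF actm_tensors actm_tensors])
  fix a b c assume abc: "a < n" "b < n" "c < m"
  have "actm n m M N K (actm n m M' N' K' T) a b c =
     (\<Sum>(i, j, l)\<in>box n m. \<Sum>(x, y, z)\<in>box n m. M $$ (a, i) * N $$ (b, j) * K $$ (c, l) *
        (M' $$ (i, x) * N' $$ (j, y) * K' $$ (l, z) * T x y z))"
    unfolding actm_entry[OF abc]
    by (rule sum.cong) (auto simp: actm_entry sum_distrib_left case_prod_beta)
  also have "\<dots> = (\<Sum>(x, y, z)\<in>box n m. \<Sum>(i, j, l)\<in>box n m. M $$ (a, i) * N $$ (b, j) * K $$ (c, l) *
        (M' $$ (i, x) * N' $$ (j, y) * K' $$ (l, z) * T x y z))"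
    unfolding case_prod_beta by (rule sum.swap)
  also have "\<dots> = (\<Sum>(x, y, z)\<in>box n m. (M * M') $$ (a, x) * (N * N') $$ (b, y) * (K * K') $$ (c, z) * T x y z)"
  proof (rule sum.cong[OF refl])
    fix w assume "w \<in> box n m"
    then obtain x y z where w: "w = (x, y, z)" and xyz: "x \<in> {..<n}" "y \<in> {..<n}" "z \<in> {..<m}" by blast
    have "(\<Sum>(i, j, l)\<in>box n m. M $$ (a, i) * N $$ (b, j) * K $$ (c, l) *
        (M' $$ (i, x) * N' $$ (j, y) * K' $$ (l, z) * T x y z)) =
      (\<Sum>(i, j, l)\<in>box n m. (M $$ (a, i) * M' $$ (i, x)) * (N $$ (b, j) * N' $$ (j, y)) * (K $$ (c, l) * K' $$ (l, z))) * T x y z"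
      unfolding sum_distrib_right case_prod_beta by (rule sum.cong) (auto simp: ac_simps)
    also have "\<dots> = (M * M') $$ (a, x) * (N * N') $$ (b, y) * (K * K') $$ (c, z) * T x y z"
      unfolding sum_triple_product using xyz abc M N K
      by (simp add: mat_mult_entry[of _ n n _ n] mat_mult_entry[of _ m m _ m] del: index_mult_mat(1))
    finally show "(case w of (x, y, z) \<Rightarrow> \<Sum>(i, j, l)\<in>box n m. M $$ (a, i) * N $$ (b, j) * K $$ (c, l) *
        (M' $$ (i, x) * N' $$ (j, y) * K' $$ (l, z) * T x y z)) =
        (case w of (x, y, z) \<Rightarrow> (M * M') $$ (a, x) * (N * N') $$ (b, y) * (K * K') $$ (c, z) * T x y z)"
      unfolding w prod.case .
  qed
  also have "\<dots> = actm n m (M * M') (N * N') (K * K') T a b c"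
    unfolding actm_entry[OF abc] ..
  finally show "actm n m M N K (actm n m M' N' K' T) a b c = actm n m (M * M') (N * N') (K * K') T a b c" .
qed

lemma actm_diag:
  assumes abc: "a < n" "b < n" "c < m"
  shows "actm n m (mat_diag n f) (mat_diag n g) (mat_diag m h) T a b c = f a * g b * h c * T a b c"
proof -
  have "actm n m (mat_diag n f) (mat_diag n g) (mat_diag m h) T a b c =
      (\<Sum>p\<in>box n m. if p = (a, b, c) then f a * g b * h c * T a b c else 0)"
    unfolding actm_entry[OF abc] by (rule sum.cong) (use abc in \<open>auto simp: mat_diag_def split: if_splits\<close>)
  then show ?thesis using abc by simp
qed

lemma actm_one: "T \<in> tensors n m \<Longrightarrow> actm n m (1\<^sub>m n) (1\<^sub>m n) (1\<^sub>m m) T = T"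
  by (rule tensor_eqI[OF actm_tensors])
    (use actm_diag[of _ n _ _ m "\<lambda>_. 1" "\<lambda>_. 1" "\<lambda>_. 1"] in auto)

lemma comb_actm:
  assumes M: "M \<in> carrier_mat n n" and N: "N \<in> carrier_mat n n"
  shows "comb n m t (actm n m M N K T) = M * (comb n m (\<lambda>l. \<Sum>k<m. t k * K $$ (k, l)) T * N\<^sup>T)"
proof (rule eq_matI)
  let ?s = "\<lambda>l. \<Sum>k<m. t k * K $$ (k, l)"
  let ?C = "comb n m ?s T"
  fix a b assume "a < dim_row (M * (?C * N\<^sup>T))" "b < dim_col (M * (?C * N\<^sup>T))"
  then have ab: "a < n" "b < n" using M N by auto
  have NT: "N\<^sup>T \<in> carrier_mat n n" using N by simp
  have CN: "?C * N\<^sup>T \<in> carrier_mat n n" by (rule mult_carrier_mat[OF comb_carrier NT])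
  have "comb n m t (actm n m M N K T) $$ (a, b) =
      (\<Sum>k<m. \<Sum>(i, j, l)\<in>box n m. t k * (M $$ (a, i) * N $$ (b, j) * K $$ (k, l) * T i j l))"
    using ab by (auto simp: comb_def actm_entry sum_distrib_left case_prod_beta intro!: sum.cong)
  also have "\<dots> = (\<Sum>(i, j, l)\<in>box n m. \<Sum>k<m. t k * (M $$ (a, i) * N $$ (b, j) * K $$ (k, l) * T i j l))"
    unfolding case_prod_beta by (rule sum.swap)
  also have "\<dots> = (\<Sum>(i, j, l)\<in>box n m. M $$ (a, i) * (?s l * T i j l * N $$ (b, j)))"
    by (rule sum.cong) (auto simp: sum_distrib_left sum_distrib_right ac_simps)
  also have "\<dots> = (\<Sum>i<n. \<Sum>j<n. \<Sum>l<m. M $$ (a, i) * (?s l * T i j l * N $$ (b, j)))"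
    by (simp add: sum.cartesian_product)
  also have "\<dots> = (\<Sum>i<n. M $$ (a, i) * (\<Sum>j<n. ?C $$ (i, j) * N\<^sup>T $$ (j, b)))"
    using ab N by (intro sum.cong refl) (auto simp: comb_def sum_distrib_left sum_distrib_right intro!: sum.cong)
  also have "\<dots> = (M * (?C * N\<^sup>T)) $$ (a, b)"
    unfolding mat_mult_entry[OF M CN ab]
    by (rule sum.cong) (auto simp: mat_mult_entry[OF comb_carrier NT _ ab(2)] simp del: index_mult_mat(1))
  finally show "comb n m t (actm n m M N K T) $$ (a, b) = (M * (?C * N\<^sup>T)) $$ (a, b)" .
qed (use M N in \<open>auto simp: comb_def\<close>)

section \<open>Limits of families of tensors\<close>

context place
begin

definition tlim :: "nat \<Rightarrow> nat \<Rightarrow> ('w \<Rightarrow> tensor) \<Rightarrow> tensor \<Rightarrow> bool" where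
  "tlim n m T S \<longleftrightarrow> (\<forall>i<n. \<forall>j<n. \<forall>l<m. lim (\<lambda>w. T w i j l) (S i j l))"

definition mlim :: "nat \<Rightarrow> ('w \<Rightarrow> complex mat) \<Rightarrow> complex mat \<Rightarrow> bool" where
  "mlim n M A \<longleftrightarrow> (\<forall>i<n. \<forall>j<n. lim (\<lambda>w. M w $$ (i, j)) (A $$ (i, j)))"

definition factored :: "nat \<Rightarrow> ('w \<Rightarrow> complex mat) \<Rightarrow> ('w \<Rightarrow> complex mat) \<Rightarrow> ('w \<Rightarrow> complex mat) \<Rightarrow>
    ('w \<Rightarrow> complex mat) \<Rightarrow> ('w \<Rightarrow> complex mat) \<Rightarrow> (nat \<Rightarrow> 'w \<Rightarrow> complex) \<Rightarrow> bool" where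
  "factored n M L L' R R' d \<longleftrightarrow> gl n L L' \<and> gl n R R' \<and>
     ev (\<lambda>w. M w = L w * (mat_diag n (\<lambda>i. d i w) * R w)) \<and>
     (\<forall>i j. i \<le> j \<longrightarrow> j < n \<longrightarrow> dom (d i) (d j))"

lemma factored_exists:
  assumes "\<And>w. M w \<in> carrier_mat n n"
  shows "\<exists>L L' R R' d. factored n M L L' R R' d"
proof (rule diagonalize[of M n, OF assms])
  fix L L' R R' d
  assume "gl n L L'" "gl n R R'" "ev (\<lambda>w. M w = L w * (mat_diag n (\<lambda>i. d i w) * R w))"
    "\<And>i j. i \<le> j \<Longrightarrow> j < n \<Longrightarrow> dom (d i) (d j)"
  then have "factored n M L L' R R' d" unfolding factored_def by simp
  then show ?thesis by blast
qed

lemma gl_mlim: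
  assumes "gl n L L'"
  shows "\<exists>A A'. A \<in> carrier_mat n n \<and> A' \<in> carrier_mat n n \<and> A * A' = 1\<^sub>m n \<and> A' * A = 1\<^sub>m n \<and>
    det A \<noteq> 0 \<and> det A' \<noteq> 0 \<and> mlim n L A \<and> mlim n L' A'"
proof (rule gl_limit[OF assms])
  fix A A' assume A: "A \<in> carrier_mat n n" "A' \<in> carrier_mat n n" "A * A' = 1\<^sub>m n"
    and l: "\<And>i j. i < n \<Longrightarrow> j < n \<Longrightarrow> lim (\<lambda>w. L w $$ (i, j)) (A $$ (i, j))"
    "\<And>i j. i < n \<Longrightarrow> j < n \<Longrightarrow> lim (\<lambda>w. L' w $$ (i, j)) (A' $$ (i, j))"
  have "A' * A = 1\<^sub>m n" by (rule mat_mult_left_right_inverse[OF A])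
  moreover have "det A * det A' = 1" using det_mult[OF A(1,2)] A(3) by simp
  then have "det A \<noteq> 0" "det A' \<noteq> 0" by auto
  moreover have "mlim n L A" "mlim n L' A'" using l by (auto simp: mlim_def)
  ultimately show ?thesis using A by blast
qed

lemma tlim_actm:
  assumes "mlim n M M0" "mlim n N N0" "mlim m K K0" "tlim n m T S"
  shows "tlim n m (\<lambda>w. actm n m (M w) (N w) (K w) (T w)) (actm n m M0 N0 K0 S)"
  unfolding tlim_def
proof (intro allI impI)
  fix a b c assume "a < n" "b < n" "c < m"
  then show "lim (\<lambda>w. actm n m (M w) (N w) (K w) (T w) a b c) (actm n m M0 N0 K0 S a b c)"
    using assms by (auto simp: actm_def act_def tlim_def mlim_def intro!: lim_sum lim_mult)
qed

lemma tlim_zero_actm: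
  assumes M: "\<And>i j. i < n \<Longrightarrow> j < n \<Longrightarrow> fin (\<lambda>w. M w $$ (i, j))" and N: "\<And>i j. i < n \<Longrightarrow> j < n \<Longrightarrow> fin (\<lambda>w. N w $$ (i, j))"
    and K: "\<And>i j. i < m \<Longrightarrow> j < m \<Longrightarrow> fin (\<lambda>w. K w $$ (i, j))" and T: "tlim n m T (\<lambda>_ _ _. 0)"
  shows "tlim n m (\<lambda>w. actm n m (M w) (N w) (K w) (T w)) (\<lambda>_ _ _. 0)"
  unfolding tlim_def
proof (intro allI impI)
  fix a b c assume abc: "a < n" "b < n" "c < m"
  have "lim (\<lambda>w. \<Sum>i<n. \<Sum>j<n. \<Sum>l<m. M w $$ (a, i) * N w $$ (b, j) * K w $$ (c, l) * T w i j l)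
      (\<Sum>i<n. \<Sum>j<n. \<Sum>l<m. 0)"
    by (intro lim_sum lim_fin_mult_0 fin_mult M N K) (use T abc in \<open>auto simp: tlim_def\<close>)
  then show "lim (\<lambda>w. actm n m (M w) (N w) (K w) (T w) a b c) 0"
    using abc by (simp add: actm_def act_def)
qed

lemma tlim_cong_ev:
  assumes e: "ev (\<lambda>w. T w = T' w)" and T: "tlim n m T S"
  shows "tlim n m T' S"
  unfolding tlim_def
proof (intro allI impI)
  fix i j l assume "i < n" "j < n" "l < m"
  then have "lim (\<lambda>w. T w i j l) (S i j l)" using T by (simp add: tlim_def)
  moreover have "ev (\<lambda>w. T w i j l = T' w i j l)" by (rule ev_mono[OF e]) simp
  ultimately show "lim (\<lambda>w. T' w i j l) (S i j l)" by (rule lim_cong_ev[rotated])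
qed

text \<open>If a family of operators \<open>P \<otimes> Q \<otimes> A\<close> drives \<open>S\<close> to zero, then either all slices of \<open>S\<close> have a
  common block of zeros of size \<open>(a + 1) \<times> (n - a)\<close> in suitable bases, or the family also drives to zero a
  family of rank-one multiples of a matrix that is invertible in the limit. In diagonalizing coordinates
  with entries \<open>p\<close>, \<open>q\<close>, \<open>r\<close> the latter is the antidiagonal in the last slice.\<close>

lemma tensor_dichotomy:
  assumes n: "n > 0" and m: "m > 0" and S: "S \<in> tensors n m"
    and S0: "tlim n m (\<lambda>w. act n m (P w) (Q w) (A w) S) (\<lambda>_ _ _. 0)"
  shows "(\<exists>R K a. R \<in> carrier_mat n n \<and> det R \<noteq> 0 \<and> K \<in> carrier_mat n n \<and> det K \<noteq> 0 \<and> a < n \<and>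
        (\<forall>i j l. i \<le> a \<longrightarrow> j < n - a \<longrightarrow> l < m \<longrightarrow> (\<Sum>x<n. \<Sum>y<n. R $$ (i, x) * K $$ (j, y) * S x y l) = 0)) \<or>
    (\<exists>X X0 t. (\<forall>w. X w \<in> tensors n m) \<and> X0 \<in> tensors n m \<and> tlim n m X X0 \<and> det (comb n m t X0) \<noteq> 0 \<and>
        tlim n m (\<lambda>w. act n m (P w) (Q w) (A w) (X w)) (\<lambda>_ _ _. 0))"
proof -
  define MP where "MP w = mat n n (\<lambda>(i, j). P w i j)" for w
  define MQ where "MQ w = mat n n (\<lambda>(i, j). Q w i j)" for w
  define MA where "MA w = mat m m (\<lambda>(i, j). A w i j)" for w
  have act_M: "act n m (P w) (Q w) (A w) T = actm n m (MP w) (MQ w) (MA w) T" for w T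
    unfolding MP_def MQ_def MA_def by (rule act_eq_actm)
  obtain L1 L1' R1 R1' p where F1: "factored n MP L1 L1' R1 R1' p"
    using factored_exists[of MP n] by (auto simp: MP_def)
  obtain L2 L2' R2 R2' q where F2: "factored n MQ L2 L2' R2 R2' q"
    using factored_exists[of MQ n] by (auto simp: MQ_def)
  obtain L3 L3' R3 R3' r where F3: "factored m MA L3 L3' R3 R3' r"
    using factored_exists[of MA m] by (auto simp: MA_def)
  have gl: "gl n L1 L1'" "gl n R1 R1'" "gl n L2 L2'" "gl n R2 R2'" "gl m L3 L3'" "gl m R3 R3'"
    using F1 F2 F3 by (auto simp: factored_def)
  have dom: "\<And>i j. i \<le> j \<Longrightarrow> j < n \<Longrightarrow> dom (p i) (p j)" "\<And>i j. i \<le> j \<Longrightarrow> j < n \<Longrightarrow> dom (q i) (q j)"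
    "\<And>i j. i \<le> j \<Longrightarrow> j < m \<Longrightarrow> dom (r i) (r j)"
    using F1 F2 F3 by (auto simp: factored_def)
  note car = gl[THEN gl_carrier(1)] gl[THEN gl_carrier(2)]
  define D where "D w = actm n m (mat_diag n (\<lambda>i. p i w)) (mat_diag n (\<lambda>i. q i w)) (mat_diag m (\<lambda>i. r i w))" for w
  have D_entry: "D w T i j l = p i w * q j w * r l w * T i j l" if "i < n" "j < n" "l < m" for w T i j l
    unfolding D_def by (rule actm_diag[OF that])
  \<comment> \<open>Quantified over T because it is applied both to the fixed tensor S and to the
    moving family X.\<close>
  define eqs where "eqs w \<longleftrightarrow> (\<forall>T. act n m (P w) (Q w) (A w) T =
      actm n m (L1 w) (L2 w) (L3 w) (D w (actm n m (R1 w) (R2 w) (R3 w) T)))" for w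
  have eqs: "ev eqs"
  proof (rule ev_mono)
    show "ev (\<lambda>w. MP w = L1 w * (mat_diag n (\<lambda>i. p i w) * R1 w) \<and>
        MQ w = L2 w * (mat_diag n (\<lambda>i. q i w) * R2 w) \<and> MA w = L3 w * (mat_diag m (\<lambda>i. r i w) * R3 w))"
      using F1 F2 F3 unfolding factored_def by (intro ev_conj) auto
    fix w assume w: "MP w = L1 w * (mat_diag n (\<lambda>i. p i w) * R1 w) \<and>
        MQ w = L2 w * (mat_diag n (\<lambda>i. q i w) * R2 w) \<and> MA w = L3 w * (mat_diag m (\<lambda>i. r i w) * R3 w)"
    have c: "mat_diag n (\<lambda>i. p i w) * R1 w \<in> carrier_mat n n" "mat_diag n (\<lambda>i. q i w) * R2 w \<in> carrier_mat n n"
      "mat_diag m (\<lambda>i. r i w) * R3 w \<in> carrier_mat m m"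
      by (rule mult_carrier_mat[OF mat_diag_dim car(2)] mult_carrier_mat[OF mat_diag_dim car(4)]
          mult_carrier_mat[OF mat_diag_dim car(6)])+
    show "eqs w" unfolding eqs_def act_M D_def
      using w actm_comp[OF car(1) c(1) car(3) c(2) car(5) c(3)]
        actm_comp[OF mat_diag_dim car(2) mat_diag_dim car(4) mat_diag_dim car(6)] by simp
  qed
  have cancelR: "actm n m (R1 w) (R2 w) (R3 w) (actm n m (R1' w) (R2' w) (R3' w) T) = T" if "T \<in> tensors n m" for w T
    using that actm_comp[OF car(2) car(8) car(4) car(10) car(6) car(12)]
    by (simp add: gl_inv[OF gl(2)] gl_inv[OF gl(4)] gl_inv[OF gl(6)] actm_one)
  have cancelL: "actm n m (L1' w) (L2' w) (L3' w) (actm n m (L1 w) (L2 w) (L3 w) T) = T" if "T \<in> tensors n m" for w T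
    using that actm_comp[OF car(7) car(1) car(9) car(3) car(11) car(5)]
    by (simp add: gl_inv'[OF gl(1)] gl_inv'[OF gl(3)] gl_inv'[OF gl(5)] actm_one)
  have DV: "D w T \<in> tensors n m" for w T unfolding D_def by (rule actm_tensors)
  \<comment> \<open>The diagonal maps scale its nonzero entries by the \<open>h a\<close>. The
    antidiagonal is chosen because a failure of \<open>lim (h a) 0\<close> at one a controls all
    smaller indices of p, q and r, that is, a whole block of positions.\<close>
  define W :: tensor where "W = (\<lambda>i j l. if i < n \<and> j < n \<and> i + j = n - 1 \<and> l = m - 1 then 1 else 0)"
  have W: "W \<in> tensors n m" using m by (auto simp: W_def tensors_def)
  define h where "h a w = p a w * q (n - 1 - a) w * r (m - 1) w" for a w
  obtain B1 B1' where B1: "B1 \<in> carrier_mat n n" "B1' \<in> carrier_mat n n" "det B1 \<noteq> 0" "det B1' \<noteq> 0"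
    "mlim n R1 B1" "mlim n R1' B1'" using gl_mlim[OF gl(2)] by blast
  obtain B2 B2' where B2: "B2 \<in> carrier_mat n n" "B2' \<in> carrier_mat n n" "det B2 \<noteq> 0" "det B2' \<noteq> 0"
    "mlim n R2 B2" "mlim n R2' B2'" using gl_mlim[OF gl(4)] by blast
  obtain B3 B3' where B3: "B3 \<in> carrier_mat m m" "B3' \<in> carrier_mat m m" "B3 * B3' = 1\<^sub>m m" "B3' * B3 = 1\<^sub>m m"
    "mlim m R3 B3" "mlim m R3' B3'" using gl_mlim[OF gl(6)] by blast
  have const: "tlim n m (\<lambda>_. T) T" for T by (simp add: tlim_def lim_const)
  show ?thesis
  proof (cases "\<forall>a<n. lim (h a) 0")
    case True
    \<comment> \<open>Pulling W back by the inverses lets the right factors cancel, so that only the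
      diagonal maps and the finite left factors act on W.\<close>
    define X where "X w = actm n m (R1' w) (R2' w) (R3' w) W" for w
    define X0 where "X0 = actm n m B1' B2' B3' W"
    have XX0: "tlim n m X X0" unfolding X_def X0_def by (rule tlim_actm[OF B1(6) B2(6) B3(6) const])
    have "tlim n m (\<lambda>w. D w W) (\<lambda>_ _ _. 0)"
      unfolding tlim_def
    proof (intro allI impI)
      fix i j l assume ijl: "i < n" "j < n" "l < m"
      show "lim (\<lambda>w. D w W i j l) 0"
      proof (cases "i + j = n - 1 \<and> l = m - 1")
        case True
        then have jl: "j = n - 1 - i" "l = m - 1" by auto
        have "W i j l = 1" using True ijl by (simp add: W_def)
        then have "(\<lambda>w. D w W i j l) = h i"
          unfolding D_entry[OF ijl] h_def using jl by simp
        then show ?thesis using \<open>\<forall>a<n. lim (h a) 0\<close> ijl by simp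
      next
        case False
        then have "W i j l = 0" by (auto simp: W_def)
        then show ?thesis by (simp add: D_entry[OF ijl] lim_const)
      qed
    qed
    then have "tlim n m (\<lambda>w. actm n m (L1 w) (L2 w) (L3 w) (D w W)) (\<lambda>_ _ _. 0)"
      by (intro tlim_zero_actm) (auto intro: gl_fin(1)[OF gl(1)] gl_fin(1)[OF gl(3)] gl_fin(1)[OF gl(5)])
    moreover have "ev (\<lambda>w. actm n m (L1 w) (L2 w) (L3 w) (D w W) = act n m (P w) (Q w) (A w) (X w))"
      by (rule ev_mono[OF eqs]) (simp add: eqs_def X_def cancelR[OF W])
    ultimately have goal: "tlim n m (\<lambda>w. act n m (P w) (Q w) (A w) (X w)) (\<lambda>_ _ _. 0)"
      by (rule tlim_cong_ev[rotated])
    \<comment> \<open>The last row of \<open>B3\<close> selects, after the change of slices by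
      \<open>B3'\<close>, exactly the slice that carries W.\<close>
    define t where "t k = B3 $$ (m - 1, k)" for k
    define J where "J = mat n n (\<lambda>(i, j). if i + j = n - 1 then 1 else 0 :: complex)"
    have J: "J \<in> carrier_mat n n" by (simp add: J_def)
    have "(\<Sum>k<m. t k * B3' $$ (k, l)) = (if l = m - 1 then 1 else 0)" if "l < m" for l
    proof -
      have "(\<Sum>k<m. t k * B3' $$ (k, l)) = (B3 * B3') $$ (m - 1, l)"
        unfolding t_def using mat_mult_entry[OF B3(1,2), of "m - 1" l] m that by simp
      then show ?thesis unfolding B3(3) using m that by auto
    qed
    then have "comb n m (\<lambda>l. \<Sum>k<m. t k * B3' $$ (k, l)) W = comb n m (\<lambda>l. if l = m - 1 then 1 else 0) W"
      unfolding comb_def by (intro cong_mat) (auto intro!: sum.cong)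
    also have "\<dots> = J"
    proof (rule eq_matI)
      fix i j assume "i < dim_row J" "j < dim_col J"
      then have ij: "i < n" "j < n" by (auto simp: J_def)
      have "(\<Sum>l<m. (if l = m - 1 then 1 else 0) * W i j l) = (\<Sum>l<m. if l = m - 1 then W i j l else 0)"
        by (rule sum.cong) auto
      also have "\<dots> = W i j (m - 1)" using m by simp
      finally show "comb n m (\<lambda>l. if l = m - 1 then 1 else 0) W $$ (i, j) = J $$ (i, j)"
        using ij by (simp add: comb_def J_def W_def)
    qed (auto simp: J_def comb_def)
    finally have "comb n m t X0 = B1' * (J * B2'\<^sup>T)"
      unfolding X0_def comb_actm[OF B1(2) B2(2)] by simp
    moreover have "J * J = 1\<^sub>m n"
    proof (rule eq_matI)
      fix i j assume "i < dim_row (1\<^sub>m n :: complex mat)" "j < dim_col (1\<^sub>m n :: complex mat)"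
      then have ij: "i < n" "j < n" by auto
      have "(J * J) $$ (i, j) = (\<Sum>l<n. if l = n - 1 - i then (if i = j then 1 else 0) else 0)"
        unfolding mat_mult_entry[OF J J ij] by (rule sum.cong) (use ij in \<open>auto simp: J_def\<close>)
      then show "(J * J) $$ (i, j) = 1\<^sub>m n $$ (i, j)" using ij by simp
    qed (auto simp: J_def)
    then have "det J \<noteq> 0" using det_mult[OF J J] by auto
    moreover have "det B2'\<^sup>T \<noteq> 0" using det_transpose[OF B2(2)] B2(4) by simp
    ultimately have det: "det (comb n m t X0) \<noteq> 0"
      using B1 B2 J by (simp add: det_mult[of _ n] mult_carrier_mat[of _ n n _ n])
    have "\<forall>w. X w \<in> tensors n m" "X0 \<in> tensors n m" unfolding X_def X0_def using actm_tensors by simp_all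
    then show ?thesis using XX0 det goal by (intro disjI2 exI[of _ X] exI[of _ X0] exI[of _ t] conjI)
  next
    case False
    then obtain a where a: "a < n" "\<not> lim (h a) 0" by blast
    \<comment> \<open>The dichotomy for the reciprocal: its other alternative is
      \<open>lim (h a) 0\<close>, which is excluded here.\<close>
    have fin_h: "fin (\<lambda>w. 1 / h a w)"
      using dichotomy[of "\<lambda>w. 1 / h a w"] a(2) by (auto simp: fin_def)
    have ev_h: "ev (\<lambda>w. h a w \<noteq> 0)"
    proof (rule ccontr)
      assume "\<not> ?thesis"
      then have "ev (\<lambda>w. 0 = h a w)" using ev_or_not[of "\<lambda>w. h a w = 0"] by (auto elim: ev_mono)
      then show False using lim_cong_ev[OF _ lim_const[of 0]] a(2) by blast
    qed
    define Y where "Y w = actm n m (R1 w) (R2 w) (R3 w) S" for w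
    have YS: "tlim n m Y (actm n m B1 B2 B3 S)" unfolding Y_def by (rule tlim_actm[OF B1(5) B2(5) B3(5) const])
    have "tlim n m (\<lambda>w. actm n m (L1' w) (L2' w) (L3' w) (act n m (P w) (Q w) (A w) S)) (\<lambda>_ _ _. 0)"
      by (intro tlim_zero_actm S0) (auto intro: gl_fin(2)[OF gl(1)] gl_fin(2)[OF gl(3)] gl_fin(2)[OF gl(5)])
    moreover have "ev (\<lambda>w. actm n m (L1' w) (L2' w) (L3' w) (act n m (P w) (Q w) (A w) S) = D w (Y w))"
      by (rule ev_mono[OF eqs]) (simp add: eqs_def Y_def cancelL[OF DV])
    ultimately have DY: "tlim n m (\<lambda>w. D w (Y w)) (\<lambda>_ _ _. 0)" by (rule tlim_cong_ev[rotated])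
    \<comment> \<open>The weights are sorted, so \<open>h a\<close> is a finite multiple of the
      weight at (i, j, l), and \<open>1 / h a\<close> is finite. Hence this entry of
      \<open>Y w\<close> is a finite multiple of the same entry of \<open>D w (Y w)\<close> and
      tends to 0 with it.\<close>
    have zero: "actm n m B1 B2 B3 S i j l = 0" if ij: "i \<le> a" "j < n - a" and l: "l < m" for i j l
    proof -
      have ijn: "i < n" "j < n" "j \<le> n - 1 - a" using ij a by auto
      obtain z1 where z1: "fin z1" "ev (\<lambda>w. p a w = z1 w * p i w)"
        using dom(1)[OF ij(1) a(1)] unfolding dom_def by blast
      obtain z2 where z2: "fin z2" "ev (\<lambda>w. q (n - 1 - a) w = z2 w * q j w)"
        using dom(2)[OF ijn(3)] n unfolding dom_def by auto
      have lm: "l \<le> m - 1" "m - 1 < m" using l m by auto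
      obtain z3 where z3: "fin z3" "ev (\<lambda>w. r (m - 1) w = z3 w * r l w)"
        using dom(3)[OF lm] unfolding dom_def by blast
      have "lim (\<lambda>w. D w (Y w) i j l) 0" using DY ijn l by (simp add: tlim_def)
      then have "lim (\<lambda>w. (1 / h a w * (z1 w * (z2 w * z3 w))) * D w (Y w) i j l) 0"
        by (intro lim_fin_mult_0 fin_mult fin_h z1 z2 z3)
      moreover have "ev (\<lambda>w. (1 / h a w * (z1 w * (z2 w * z3 w))) * D w (Y w) i j l = Y w i j l)"
      proof (rule ev_mono[OF ev_conj[OF ev_h ev_conj[OF z1(2) ev_conj[OF z2(2) z3(2)]]]])
        fix w assume w: "h a w \<noteq> 0 \<and> p a w = z1 w * p i w \<and> q (n - 1 - a) w = z2 w * q j w \<and> r (m - 1) w = z3 w * r l w"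
        then have hw: "h a w = z1 w * p i w * (z2 w * q j w) * (z3 w * r l w)" by (simp add: h_def)
        have "(1 / h a w * (z1 w * (z2 w * z3 w))) * D w (Y w) i j l =
            1 / h a w * (z1 w * p i w * (z2 w * q j w) * (z3 w * r l w)) * Y w i j l"
          unfolding D_entry[OF ijn(1,2) l] by (simp add: ac_simps)
        then show "(1 / h a w * (z1 w * (z2 w * z3 w))) * D w (Y w) i j l = Y w i j l"
          unfolding hw[symmetric] using w by simp
      qed
      ultimately have "lim (\<lambda>w. Y w i j l) 0" by (rule lim_cong_ev[rotated])
      moreover have "lim (\<lambda>w. Y w i j l) (actm n m B1 B2 B3 S i j l)" using YS ijn l by (simp add: tlim_def)
      ultimately show ?thesis by (rule lim_unique[rotated])
    qed
    \<comment> \<open>The block is zero for every slice index, so the mixing of slices by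
      \<open>B3\<close> can be undone with \<open>B3'\<close>, which leaves the slices of S
      themselves.\<close>
    have "(\<Sum>x<n. \<Sum>y<n. B1 $$ (i, x) * B2 $$ (j, y) * S x y l) = 0"
      if ij: "i \<le> a" "j < n - a" and l: "l < m" for i j l
    proof -
      have ijn: "i < n" "j < n" using ij a by auto
      have "(\<Sum>k<m. B3' $$ (l, k) * actm n m B1 B2 B3 S i j k) =
          (\<Sum>k<m. \<Sum>(x, y, z)\<in>box n m. B3' $$ (l, k) * (B1 $$ (i, x) * B2 $$ (j, y) * B3 $$ (k, z) * S x y z))"
        using ijn by (auto simp: actm_entry sum_distrib_left case_prod_beta intro!: sum.cong)
      also have "\<dots> = (\<Sum>(x, y, z)\<in>box n m. \<Sum>k<m. B3' $$ (l, k) * (B1 $$ (i, x) * B2 $$ (j, y) * B3 $$ (k, z) * S x y z))"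
        unfolding case_prod_beta by (rule sum.swap)
      also have "\<dots> = (\<Sum>(x, y, z)\<in>box n m. B1 $$ (i, x) * B2 $$ (j, y) * S x y z * (B3' * B3) $$ (l, z))"
      proof (rule sum.cong[OF refl])
        fix w assume "w \<in> box n m"
        then obtain x y z where w: "w = (x, y, z)" and "z \<in> {..<m}" by blast
        then have "(B3' * B3) $$ (l, z) = (\<Sum>k<m. B3' $$ (l, k) * B3 $$ (k, z))"
          using mat_mult_entry[OF B3(2,1) l] by simp
        then have "(\<Sum>k<m. B3' $$ (l, k) * (B1 $$ (i, x) * B2 $$ (j, y) * B3 $$ (k, z) * S x y z)) =
           B1 $$ (i, x) * B2 $$ (j, y) * S x y z * (B3' * B3) $$ (l, z)"
          by (simp add: sum_distrib_left ac_simps del: index_mult_mat(1))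
        then show "(case w of (x, y, z) \<Rightarrow> \<Sum>k<m. B3' $$ (l, k) * (B1 $$ (i, x) * B2 $$ (j, y) * B3 $$ (k, z) * S x y z)) =
           (case w of (x, y, z) \<Rightarrow> B1 $$ (i, x) * B2 $$ (j, y) * S x y z * (B3' * B3) $$ (l, z))"
          unfolding w prod.case .
      qed
      also have "\<dots> = (\<Sum>x<n. \<Sum>y<n. \<Sum>z<m. B1 $$ (i, x) * B2 $$ (j, y) * S x y z * (if z = l then 1 else 0))"
        unfolding B3(4) using l by (auto simp: sum.cartesian_product intro!: sum.cong)
      also have "\<dots> = (\<Sum>x<n. \<Sum>y<n. B1 $$ (i, x) * B2 $$ (j, y) * S x y l)"
        using l by (simp add: if_distrib[of "\<lambda>c. _ * c"] cong: if_cong)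
      finally show ?thesis using zero[OF ij] by simp
    qed
    then show ?thesis
      using B1(1,3) B2(1,3) a(1) by (intro disjI1 exI[of _ B1] exI[of _ B2] exI[of _ a] conjI allI impI)
  qed
qed

end

section \<open>The null cone\<close>

lemma (in place) lim_gen_algebra:
  assumes "f \<in> gen_algebra (tuple_coords n m)" and X: "tlim n m X X0"
  shows "lim (\<lambda>w. f (tuple_of n m (X w))) (f (tuple_of n m X0))"
  using assms(1)
proof (induction f rule: gen_algebra.induct)
  case (coord f)
  then obtain l i j where "l < m" "i < n" "j < n" "f = (\<lambda>X. (X ! l) $$ (i, j))"
    by (auto simp: tuple_coords_def)
  then show ?case using X by (simp add: tuple_of_entry tlim_def)
qed (auto intro: lim_const lim_add lim_mult)

lemma flatten_tuple_of:
  assumes q: "q < m * n\<^sup>2"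
  shows "flatten n m (tuple_of n m T) $ q = T (q mod n\<^sup>2 div n) (q mod n) (q div n\<^sup>2)"
proof -
  have n: "0 < n" using q by (cases n) auto
  have "q div n\<^sup>2 < m" using q by (simp add: less_mult_imp_div_less)
  moreover have "q mod n\<^sup>2 < n * n" using n by (simp add: power2_eq_square)
  then have "q mod n\<^sup>2 div n < n" by (rule less_mult_imp_div_less)
  ultimately show ?thesis using q n by (simp add: flatten_def tuple_of_entry)
qed

lemma flatten_carrier: "flatten n m X \<in> carrier_vec (m * n\<^sup>2)"
  by (simp add: flatten_def)

lemma flatten_inj:
  "X \<in> Mat_tuples n m \<Longrightarrow> Y \<in> Mat_tuples n m \<Longrightarrow> flatten n m X = flatten n m Y \<Longrightarrow> X = Y"
  using bij_betw_flatten[of n m] by (auto simp: bij_betw_def dest: inj_onD)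

lemma zero_tuple_eq: "zero_tuple n m = tuple_of n m (\<lambda>_ _ _. 0)"
proof -
  have "0\<^sub>m n n = mat n n (\<lambda>(i, j). 0 :: complex)" by (rule eq_matI) auto
  then show ?thesis by (simp add: zero_tuple_def tuple_of_def map_replicate_const)
qed

lemma zero_tuple_Mat: "zero_tuple n m \<in> Mat_tuples n m"
  by (simp add: zero_tuple_eq tuple_of_Mat)

section \<open>The linear action on tuples and on tensors\<close>

locale tuple_action =
  fixes n m k :: nat and G :: "complex mat set"
    and \<alpha> :: "complex mat \<Rightarrow> complex mat list \<Rightarrow> complex mat list" and \<rho> :: "complex mat \<Rightarrow> complex mat"
  assumes red: "reductive_group k G" and rep: "rational_rep k G (m * n\<^sup>2) \<rho>"
    and action: "g \<in> G \<Longrightarrow> X \<in> Mat_tuples n m \<Longrightarrow>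
      \<alpha> g X \<in> Mat_tuples n m \<and> flatten n m (\<alpha> g X) = \<rho> g *\<^sub>v flatten n m X"
begin

abbreviation "N \<equiv> m * n\<^sup>2"

lemma subgroup: "subgroup G (GL k)"
  using red by (simp add: reductive_group_def linear_algebraic_group_def)

lemma one_G: "1\<^sub>m k \<in> G" using subgroup.one_closed[OF subgroup] by (simp add: GL_simps)
lemma mult_G: "g \<in> G \<Longrightarrow> h \<in> G \<Longrightarrow> g * h \<in> G" using subgroup.m_closed[OF subgroup] by (simp add: GL_simps)

lemma rho_GL: "g \<in> G \<Longrightarrow> \<rho> g \<in> carrier (GL N)"
  using rep unfolding rational_rep_def hom_def by auto

lemma rho_carrier: "g \<in> G \<Longrightarrow> \<rho> g \<in> carrier_mat N N"
  using rho_GL GL_carrier by blast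

lemma rho_mult: "g \<in> G \<Longrightarrow> h \<in> G \<Longrightarrow> \<rho> (g * h) = \<rho> g * \<rho> h"
  using rep unfolding rational_rep_def hom_def by (auto simp: GL_simps)

text \<open>An invertible idempotent is the identity.\<close>

lemma rho_one: "\<rho> (1\<^sub>m k) = 1\<^sub>m N"
proof -
  let ?r = "\<rho> (1\<^sub>m k)" and ?s = "inv\<^bsub>GL N\<^esub> (\<rho> (1\<^sub>m k))"
  note gl = rho_GL[OF one_G]
  have c: "?r \<in> carrier_mat N N" "?s \<in> carrier_mat N N"
    using GL_carrier[OF gl] GL_carrier[OF GL_inv(1)[OF gl]] by auto
  have "?r * ?r = ?r" using rho_mult[OF one_G one_G] by simp
  then have "?s * (?r * ?r) = ?s * ?r" by simp
  then show ?thesis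
    using GL_inv(2)[OF gl] c by (simp add: assoc_mult_mat[OF c(2,1,1), symmetric] left_mult_one_mat[of _ N N])
qed

lemma action_closed: "g \<in> G \<Longrightarrow> X \<in> Mat_tuples n m \<Longrightarrow> \<alpha> g X \<in> Mat_tuples n m"
  and action_flatten: "g \<in> G \<Longrightarrow> X \<in> Mat_tuples n m \<Longrightarrow> flatten n m (\<alpha> g X) = \<rho> g *\<^sub>v flatten n m X"
  using action by auto

lemma action_mult: "g \<in> G \<Longrightarrow> h \<in> G \<Longrightarrow> X \<in> Mat_tuples n m \<Longrightarrow> \<alpha> (g * h) X = \<alpha> g (\<alpha> h X)"
  by (rule flatten_inj[where n=n and m=m])
    (simp_all add: action_closed action_flatten mult_G rho_mult
      assoc_mult_mat_vec[OF rho_carrier rho_carrier flatten_carrier])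

lemma action_one: "X \<in> Mat_tuples n m \<Longrightarrow> \<alpha> (1\<^sub>m k) X = X"
  by (rule flatten_inj[where n=n and m=m])
    (simp_all add: action_closed action_flatten one_G rho_one one_mult_mat_vec[OF flatten_carrier])

lemma action_zero: "g \<in> G \<Longrightarrow> \<alpha> g (zero_tuple n m) = zero_tuple n m"
proof (rule flatten_inj)
  assume g: "g \<in> G"
  show z: "zero_tuple n m \<in> Mat_tuples n m" by (simp add: zero_tuple_eq tuple_of_Mat)
  show "\<alpha> g (zero_tuple n m) \<in> Mat_tuples n m" by (rule action_closed[OF g z])
  have 0: "flatten n m (zero_tuple n m) = 0\<^sub>v N"
  proof (rule eq_vecI)
    fix q assume "q < dim_vec (0\<^sub>v N :: complex vec)"
    then show "flatten n m (zero_tuple n m) $ q = 0\<^sub>v N $ q"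
      by (simp add: zero_tuple_eq flatten_tuple_of)
  qed (simp add: flatten_def)
  have "\<rho> g *\<^sub>v 0\<^sub>v N = 0\<^sub>v N" using rho_carrier[OF g] by (intro eq_vecI) auto
  then show "flatten n m (\<alpha> g (zero_tuple n m)) = flatten n m (zero_tuple n m)"
    using action_flatten[OF g z] 0 by simp
qed

lemma action_entry:
  assumes g: "g \<in> G" and X: "X \<in> Mat_tuples n m" and ijl: "l < m" "i < n" "j < n"
  shows "(\<alpha> g X ! l) $$ (i, j) = (\<Sum>q<N. \<rho> g $$ (l * n\<^sup>2 + i * n + j, q) * flatten n m X $ q)"
proof -
  note idx = flatten_index[OF ijl]
  have "(\<alpha> g X ! l) $$ (i, j) = (\<rho> g *\<^sub>v flatten n m X) $ (l * n\<^sup>2 + i * n + j)"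
    using idx(2)[of "\<alpha> g X"] action_flatten[OF g X] by simp
  also have "\<dots> = (\<Sum>q<N. \<rho> g $$ (l * n\<^sup>2 + i * n + j, q) * flatten n m X $ q)"
    using idx(1) rho_carrier[OF g] flatten_carrier[of n m X]
    by (auto simp: scalar_prod_def lessThan_atLeast0 intro!: sum.cong)
  finally show ?thesis .
qed

lemma coord_separated:
  assumes "c \<in> tuple_coords n m"
  shows "\<exists>xs. separated k G (Mat_tuples n m) (tuple_coords n m) \<alpha> c xs"
proof -
  obtain l i j where ijl: "l < m" "i < n" "j < n" and c: "c = (\<lambda>X. (X ! l) $$ (i, j))"
    using assms by (auto simp: tuple_coords_def)
  let ?x = "l * n\<^sup>2 + i * n + j"
  define xs where "xs = map (\<lambda>q. (\<lambda>g. \<rho> g $$ (?x, q), \<lambda>X. flatten n m X $ q)) [0..<N]"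
  have "regular_on k G (\<lambda>g. \<rho> g $$ (?x, q))" if "q < N" for q
    using rep flatten_index(1)[OF ijl] that unfolding rational_rep_def by blast
  moreover have "(\<lambda>X. flatten n m X $ q) \<in> gen_algebra (tuple_coords n m)" if q: "q < N" for q
  proof -
    have n: "0 < n" using q by (cases n) auto
    have "q div n\<^sup>2 < m" using q by (simp add: less_mult_imp_div_less)
    moreover have "q mod n\<^sup>2 < n * n" using n by (simp add: power2_eq_square)
    then have "q mod n\<^sup>2 div n < n" by (rule less_mult_imp_div_less)
    ultimately have "(\<lambda>X. (X ! (q div n\<^sup>2)) $$ (q mod n\<^sup>2 div n, q mod n)) \<in> tuple_coords n m"
      unfolding tuple_coords_def using n
      by (intro CollectI exI[of _ "q div n\<^sup>2"] exI[of _ "q mod n\<^sup>2 div n"] exI[of _ "q mod n"] conjI refl) auto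
    then show ?thesis using q by (simp add: flatten_def gen_algebra.coord)
  qed
  moreover have "c (\<alpha> g X) = (\<Sum>(a, b)\<leftarrow>xs. a g * b X)" if "g \<in> G" "X \<in> Mat_tuples n m" for g X
    using action_entry[OF that ijl]
    by (simp add: c xs_def comp_def interv_sum_list_conv_sum_set_nat lessThan_atLeast0)
  ultimately have "separated k G (Mat_tuples n m) (tuple_coords n m) \<alpha> c xs"
    unfolding separated_def by (auto simp: xs_def)
  then show ?thesis by blast
qed

sublocale group_action k G "Mat_tuples n m" "tuple_coords n m" \<alpha> "zero_tuple n m"
  by unfold_locales
    (simp_all add: red action_closed action_mult action_one coord_separated action_zero zero_tuple_Mat)

definition on_tensors :: "complex mat \<Rightarrow> tensor \<Rightarrow> tensor" where
  "on_tensors g T = tensor_of n m (\<alpha> g (tuple_of n m T))"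

lemma tuple_of_on_tensors: "g \<in> G \<Longrightarrow> tuple_of n m (on_tensors g T) = \<alpha> g (tuple_of n m T)"
  unfolding on_tensors_def by (rule tuple_of_tensor_of[OF action_closed[OF _ tuple_of_Mat]])

lemma on_tensors_entry:
  assumes "g \<in> G" "i < n" "j < n" "l < m"
  shows "on_tensors g T i j l =
    (\<Sum>q<N. \<rho> g $$ (l * n\<^sup>2 + i * n + j, q) * T (q mod n\<^sup>2 div n) (q mod n) (q div n\<^sup>2))"
proof -
  have "on_tensors g T i j l = (\<alpha> g (tuple_of n m T) ! l) $$ (i, j)"
    using assms by (simp add: on_tensors_def tensor_of_def)
  also have "\<dots> = (\<Sum>q<N. \<rho> g $$ (l * n\<^sup>2 + i * n + j, q) * flatten n m (tuple_of n m T) $ q)"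
    by (rule action_entry[OF assms(1) tuple_of_Mat assms(4,2,3)])
  also have "\<dots> = (\<Sum>q<N. \<rho> g $$ (l * n\<^sup>2 + i * n + j, q) * T (q mod n\<^sup>2 div n) (q mod n) (q div n\<^sup>2))"
    by (rule sum.cong) (auto simp: flatten_tuple_of)
  finally show ?thesis .
qed

lemma on_tensors_tensors: "on_tensors g T \<in> tensors n m"
  unfolding on_tensors_def by (rule tensor_of_tensors)

lemma on_tensors_linear:
  assumes g: "g \<in> G"
  shows "linear_on n m (on_tensors g)"
  unfolding linear_on_def
proof (intro ballI conjI allI)
  fix T assume T: "T \<in> tensors n m"
  show "on_tensors g T \<in> tensors n m" by (rule on_tensors_tensors)
  show "on_tensors g (tscale c T) = tscale c (on_tensors g T)" for c
    by (rule tensor_eqI[of _ n m])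
      (simp_all add: on_tensors_tensors, simp add: tscale_def on_tensors_entry[OF g] sum_distrib_left algebra_simps)
  show "on_tensors g (tplus S T) = tplus (on_tensors g S) (on_tensors g T)" for S
    by (rule tensor_eqI[of _ n m])
      (simp_all add: on_tensors_tensors, simp add: tplus_def on_tensors_entry[OF g] sum.distrib algebra_simps)
qed

lemma on_tensors_inverse:
  assumes g: "g \<in> G" and h: "h \<in> G" and gh: "g * h = 1\<^sub>m k" and T: "T \<in> tensors n m"
  shows "on_tensors g (on_tensors h T) = T"
proof -
  have "on_tensors g (on_tensors h T) = tensor_of n m (\<alpha> (g * h) (tuple_of n m T))"
    unfolding on_tensors_def[of g] tuple_of_on_tensors[OF h] by (simp add: action_mult[OF g h tuple_of_Mat])
  then show ?thesis by (simp add: gh action_one[OF tuple_of_Mat] tensor_of_tuple_of[OF T])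
qed

text \<open>The orbits of X and of \<open>\<alpha> g X\<close> coincide and so have the same
  closure.\<close>

lemma null_cone_stable:
  assumes X: "X \<in> null_cone G n m \<alpha>" and g: "g \<in> G"
  shows "\<alpha> g X \<in> null_cone G n m \<alpha>"
proof -
  have XM: "X \<in> Mat_tuples n m" using X by (simp add: null_cone_def)
  have "{\<alpha> h (\<alpha> g X) |h. h \<in> G} = {\<alpha> h X |h. h \<in> G}"
  proof (intro equalityI subsetI)
    fix Y assume "Y \<in> {\<alpha> h (\<alpha> g X) |h. h \<in> G}"
    then obtain h where h: "h \<in> G" "Y = \<alpha> h (\<alpha> g X)" by blast
    then have "Y = \<alpha> (h * g) X" using action_mult[OF h(1) g XM] by simp
    then show "Y \<in> {\<alpha> h X |h. h \<in> G}" using mult_G[OF h(1) g] by (intro CollectI exI[of _ "h * g"] conjI)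
  next
    fix Y assume "Y \<in> {\<alpha> h X |h. h \<in> G}"
    then obtain h where h: "h \<in> G" "Y = \<alpha> h X" by blast
    have i: "ginv g \<in> G" by (rule G_inv[OF g])
    have "(h * ginv g) * g = h * (ginv g * g)"
      by (rule assoc_mult_mat[OF G_carrier[OF h(1)] G_carrier[OF i] G_carrier[OF g]])
    also have "\<dots> = h" using GL_inv(2)[OF G_GL[OF g]] G_carrier[OF h(1)] by (simp add: right_mult_one_mat[of _ k k])
    finally have "Y = \<alpha> (h * ginv g) (\<alpha> g X)" using h action_mult[OF mult_G[OF h(1) i] g XM] by simp
    then show "Y \<in> {\<alpha> h (\<alpha> g X) |h. h \<in> G}"
      using mult_G[OF h(1) i] by (intro CollectI exI[of _ "h * ginv g"] conjI)
  qed
  then show ?thesis using X action_closed[OF g XM] by (simp add: null_cone_def)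
qed

lemma on_tensors_good:
  assumes eq: "null_cone G n m \<alpha> = SING n m" and g: "g \<in> G"
  shows "good n m (on_tensors g) (on_tensors (ginv g))"
proof -
  have ks: "keeps_singular n m (on_tensors g)" if g: "g \<in> G" for g
    unfolding keeps_singular_def
  proof (intro ballI impI allI)
    fix T t assume "row_degenerate n m T \<or> row_degenerate n m (flip T)"
    then have "tuple_of n m T \<in> SING n m" using row_degenerate_SING flip_row_degenerate_SING by blast
    then have "\<alpha> g (tuple_of n m T) \<in> SING n m" using null_cone_stable[OF _ g] eq by blast
    then show "det (comb n m t (on_tensors g T)) = 0" unfolding on_tensors_def by (rule SING_imp_det_comb)
  qed
  have i: "ginv g \<in> G" by (rule G_inv[OF g])
  show ?thesis
    unfolding good_def
    using on_tensors_linear[OF g] on_tensors_linear[OF i] ks[OF g] ks[OF i]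
      on_tensors_inverse[OF g i GL_inv(3)[OF G_GL[OF g]]] on_tensors_inverse[OF i g GL_inv(2)[OF G_GL[OF g]]]
    by blast
qed

text \<open>A closed set that contains the orbit but not 0 provides a polynomial vanishing on the
  orbit and not at 0. Scaled to the value 1 at 0, it is turned into an invariant by
  \<open>invariant_exists\<close>.\<close>

lemma separating_invariant:
  assumes X: "X \<in> Mat_tuples n m" "X \<notin> null_cone G n m \<alpha>"
  obtains f where "f \<in> gen_algebra (tuple_coords n m)" "\<And>g v. g \<in> G \<Longrightarrow> v \<in> Mat_tuples n m \<Longrightarrow> f (\<alpha> g v) = f v"
    "f X = 0" "f (zero_tuple n m) = 1"
proof -
  let ?O = "{\<alpha> g X |g. g \<in> G}"
  from X have "zero_tuple n m \<notin> zariski_closure (tuple_coords n m) (Mat_tuples n m) ?O" by (simp add: null_cone_def)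
  then obtain T where T: "zariski_closed (tuple_coords n m) (Mat_tuples n m) T" "?O \<subseteq> T" "zero_tuple n m \<notin> T"
    unfolding zariski_closure_def by blast
  obtain P where P: "P \<subseteq> gen_algebra (tuple_coords n m)" "T = {x \<in> Mat_tuples n m. \<forall>p\<in>P. p x = 0}"
    using T(1) unfolding zariski_closed_def by blast
  obtain p where p: "p \<in> P" "p (zero_tuple n m) \<noteq> 0" using T(3) P(2) origin by blast
  define p' where "p' x = (1 / p (zero_tuple n m)) * p x" for x
  have "p' \<in> gen_algebra (tuple_coords n m)"
    unfolding p'_def using p(1) P(1) by (intro gen_algebra.mult gen_algebra.const) blast
  moreover have "p' (\<alpha> g X) = 0" if "g \<in> G" for g
  proof -
    have "\<alpha> g X \<in> T" using T(2) that by blast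
    then show ?thesis using P(2) p(1) by (simp add: p'_def)
  qed
  moreover have "p' (zero_tuple n m) = 1" using p(2) by (simp add: p'_def)
  ultimately have "\<exists>f\<in>gen_algebra (tuple_coords n m). (\<forall>g\<in>G. \<forall>v\<in>Mat_tuples n m. f (\<alpha> g v) = f v) \<and> f X = 0 \<and> f (zero_tuple n m) = 1"
    by (rule invariant_exists[OF _ X(1)])
  then show ?thesis using that by blast
qed

text \<open>Since 0 lies in the closure of the orbit, a polynomial vanishing on the orbit vanishes
  at 0. So the value at 0 depends only on the restriction to the orbit, which is
  single-valuedness.\<close>

lemma limit_ring_of_orbit:
  assumes S: "S \<in> null_cone G n m \<alpha>" and r: "range r = G"
  shows "limit_ring {((\<lambda>w. p (\<alpha> (r w) S)), p (zero_tuple n m)) | p. p \<in> gen_algebra (tuple_coords n m)}"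
    (is "limit_ring ?R")
  unfolding limit_ring_def
proof (intro conjI allI impI)
  show "(\<lambda>_. c, c) \<in> ?R" for c
    using gen_algebra.const[of c "tuple_coords n m"] by auto
next
  fix x c y d assume "(x, c) \<in> ?R" "(y, d) \<in> ?R"
  then obtain p q where pq: "p \<in> gen_algebra (tuple_coords n m)" "q \<in> gen_algebra (tuple_coords n m)"
    "x = (\<lambda>w. p (\<alpha> (r w) S))" "c = p (zero_tuple n m)" "y = (\<lambda>w. q (\<alpha> (r w) S))" "d = q (zero_tuple n m)" by blast
  show "(x + y, c + d) \<in> ?R"
    using gen_algebra.add[OF pq(1,2)] by (auto simp: pq(3-) plus_fun_def intro!: exI[of _ "\<lambda>x. p x + q x"])
  show "(x * y, c * d) \<in> ?R"
    using gen_algebra.mult[OF pq(1,2)] by (auto simp: pq(3-) times_fun_def intro!: exI[of _ "\<lambda>x. p x * q x"])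
next
  fix c assume "(0, c) \<in> ?R"
  then obtain p where p: "p \<in> gen_algebra (tuple_coords n m)" "0 = (\<lambda>w. p (\<alpha> (r w) S))" "c = p (zero_tuple n m)" by blast
  let ?T = "{x \<in> Mat_tuples n m. \<forall>q\<in>{p}. q x = 0}"
  have SM: "S \<in> Mat_tuples n m" using S by (simp add: null_cone_def)
  have "zariski_closed (tuple_coords n m) (Mat_tuples n m) ?T"
    unfolding zariski_closed_def using p(1) by (intro exI[of _ "{p}"]) auto
  moreover have "{\<alpha> g S |g. g \<in> G} \<subseteq> ?T"
  proof (clarify, intro conjI ballI)
    fix g assume g: "g \<in> G"
    show "\<alpha> g S \<in> Mat_tuples n m" by (rule action_closed[OF g SM])
    obtain w where "g = r w" using g r by blast
    then show "q (\<alpha> g S) = 0" if "q \<in> {p}" for q using that fun_cong[OF p(2), of w] by simp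
  qed
  ultimately have "zero_tuple n m \<in> ?T" using S unfolding null_cone_def zariski_closure_def by blast
  then show "c = 0" using p(3) by simp
qed

theorem null_cone_not_SING:
  assumes n: "n \<ge> 3" and m: "m \<ge> 3"
  shows "null_cone G n m \<alpha> \<noteq> SING n m"
proof
  assume eq: "null_cone G n m \<alpha> = SING n m"
  define S where "S = tuple_of n m (skew 1 n m)"
  have S: "S \<in> null_cone G n m \<alpha>" unfolding eq S_def by (rule skew_SING[OF n m])
  \<comment> \<open>Places are defined for functions on a whole type; elements outside G are sent to
    the identity.\<close>
  define r where "r w = (if w \<in> G then w else 1\<^sub>m k)" for w
  have rG: "r w \<in> G" for w using one_G by (simp add: r_def)
  have range: "range r = G"
  proof (intro equalityI subsetI)
    fix g assume "g \<in> G"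
    then have "g = r g" by (simp add: r_def)
    then show "g \<in> range r" by blast
  qed (use rG in blast)
  have "\<exists>lim. place lim \<and>
      (\<forall>p\<in>gen_algebra (tuple_coords n m). lim (\<lambda>w. p (\<alpha> (r w) S)) (p (zero_tuple n m)))"
  proof (rule place_extends[OF limit_ring_of_orbit[OF S range]])
    fix lim assume *: "place lim"
      "\<And>x c. (x, c) \<in> {((\<lambda>w. p (\<alpha> (r w) S)), p (zero_tuple n m)) | p. p \<in> gen_algebra (tuple_coords n m)} \<Longrightarrow> lim x c"
    show ?thesis by (intro exI[of _ lim] conjI ballI *) blast
  qed
  then obtain lim where "place lim"
    and lim0: "\<forall>p\<in>gen_algebra (tuple_coords n m). lim (\<lambda>w. p (\<alpha> (r w) S)) (p (zero_tuple n m))" by blast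
  interpret place lim by fact
  have "\<forall>w. \<exists>P Q A. (\<forall>T\<in>tensors n m. on_tensors (r w) T = act n m P Q A T) \<or>
      (\<forall>T\<in>tensors n m. on_tensors (r w) T = act n m P Q A (flip T))"
    using singularity_preserver[OF _ _ on_tensors_good[OF eq rG]] n m by simp
  then obtain P Q A where PQA: "\<And>w. (\<forall>T\<in>tensors n m. on_tensors (r w) T = act n m (P w) (Q w) (A w) T) \<or>
      (\<forall>T\<in>tensors n m. on_tensors (r w) T = act n m (P w) (Q w) (A w) (flip T))" by metis
  define type where "type \<sigma> w \<longleftrightarrow> (\<forall>T\<in>tensors n m. on_tensors (r w) T = act n m (P w) (Q w) (A w) (\<sigma> T))" for \<sigma> w
  \<comment> \<open>The ultrafilter settles one of the two alternatives for almost all w.\<close>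
  have "ev (type id) \<or> ev (type flip)"
  proof (cases "ev (type id)")
    case False
    then have "ev (\<lambda>w. \<not> type id w)" using ev_or_not by blast
    then have "ev (type flip)" by (rule ev_mono) (use PQA in \<open>auto simp: type_def\<close>)
    then show ?thesis by simp
  qed simp
  then obtain \<sigma> and e :: complex where type: "ev (type \<sigma>)" and \<sigma>: "\<sigma> = id \<and> e = 1 \<or> \<sigma> = flip \<and> e = - 1" by blast
  have e: "e \<noteq> 0" and \<sigma>_skew: "\<sigma> (skew 1 n m) = skew e n m" using \<sigma> by (auto simp: flip_skew)
  have \<sigma>\<sigma>: "\<sigma> (\<sigma> T) = T" and \<sigma>V: "\<sigma> T \<in> tensors n m \<longleftrightarrow> T \<in> tensors n m"
    and \<sigma>S: "tuple_of n m (\<sigma> T) \<in> SING n m \<longleftrightarrow> tuple_of n m T \<in> SING n m" for T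
    using \<sigma> by (auto simp: SING_flip)
  have \<sigma>lim: "tlim n m (\<lambda>w. \<sigma> (X w)) (\<sigma> X0)" if "tlim n m X X0" for X X0
    using \<sigma> that by (auto simp: tlim_def flip_apply)
  have n0: "n > 0" "m > 0" using n m by auto
  have "tlim n m (\<lambda>w. on_tensors (r w) (skew 1 n m)) (\<lambda>_ _ _. 0)"
    unfolding tlim_def
  proof (intro allI impI)
    fix i j l assume ijl: "i < n" "j < n" "l < m"
    let ?p = "\<lambda>X :: complex mat list. (X ! l) $$ (i, j)"
    have "?p \<in> gen_algebra (tuple_coords n m)"
      by (rule gen_algebra.coord) (use ijl in \<open>auto simp: tuple_coords_def\<close>)
    then have "lim (\<lambda>w. ?p (\<alpha> (r w) S)) (?p (zero_tuple n m))" by (rule bspec[OF lim0])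
    then show "lim (\<lambda>w. on_tensors (r w) (skew 1 n m) i j l) 0"
      using ijl by (simp add: on_tensors_def tensor_of_def S_def zero_tuple_eq tuple_of_entry)
  qed
  moreover have "ev (\<lambda>w. on_tensors (r w) (skew 1 n m) = act n m (P w) (Q w) (A w) (skew e n m))"
    by (rule ev_mono[OF type]) (simp add: type_def skew_tensors \<sigma>_skew)
  ultimately have "tlim n m (\<lambda>w. act n m (P w) (Q w) (A w) (skew e n m)) (\<lambda>_ _ _. 0)"
    by (rule tlim_cong_ev[rotated])
  from tensor_dichotomy[OF n0 skew_tensors this] show False
  proof (elim disjE exE conjE)
    fix R K a
    assume "R \<in> carrier_mat n n" "det R \<noteq> 0" "K \<in> carrier_mat n n" "det K \<noteq> 0" "a < n"
      and block: "\<forall>i j l. i \<le> a \<longrightarrow> j < n - a \<longrightarrow> l < m \<longrightarrow> (\<Sum>x<n. \<Sum>y<n. R $$ (i, x) * K $$ (j, y) * skew e n m x y l) = 0"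
    then show False by (intro skew_no_block[OF n m e, of R K a]) auto
  next
    fix X X0 t
    assume XV: "\<forall>w. X w \<in> tensors n m" and X0: "X0 \<in> tensors n m" and XX0: "tlim n m X X0"
      and det: "det (comb n m t X0) \<noteq> 0" and XP: "tlim n m (\<lambda>w. act n m (P w) (Q w) (A w) (X w)) (\<lambda>_ _ _. 0)"
    have "tuple_of n m X0 \<notin> SING n m"
      using SING_imp_det_comb[of "tuple_of n m X0" n m t] det tensor_of_tuple_of[OF X0] by auto
    then have "tuple_of n m (\<sigma> X0) \<notin> null_cone G n m \<alpha>" using \<sigma>S eq by simp
    then obtain f where f: "f \<in> gen_algebra (tuple_coords n m)"
      and f_inv: "\<And>g v. g \<in> G \<Longrightarrow> v \<in> Mat_tuples n m \<Longrightarrow> f (\<alpha> g v) = f v"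
      and f0: "f (tuple_of n m (\<sigma> X0)) = 0" "f (zero_tuple n m) = 1"
      using separating_invariant[OF tuple_of_Mat] by metis
    \<comment> \<open>The invariant f takes the same value before and after the action, but the
      first value tends to 0 and the second to the value 1 at the origin. The family is
      \<open>\<sigma> (X w)\<close> because the action itself contains the involution \<sigma>,
      which then cancels.\<close>
    have "lim (\<lambda>w. f (tuple_of n m (\<sigma> (X w)))) 0"
      using lim_gen_algebra[OF f \<sigma>lim[OF XX0]] f0(1) by simp
    moreover have "f (tuple_of n m (on_tensors (r w) (\<sigma> (X w)))) = f (tuple_of n m (\<sigma> (X w)))" for w
      unfolding tuple_of_on_tensors[OF rG] by (rule f_inv[OF rG tuple_of_Mat])
    ultimately have "lim (\<lambda>w. f (tuple_of n m (on_tensors (r w) (\<sigma> (X w))))) 0" by simp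
    moreover have "ev (\<lambda>w. f (tuple_of n m (on_tensors (r w) (\<sigma> (X w)))) =
        f (tuple_of n m (act n m (P w) (Q w) (A w) (X w))))"
      by (rule ev_mono[OF type]) (use XV in \<open>simp add: type_def \<sigma>V \<sigma>\<sigma>\<close>)
    ultimately have "lim (\<lambda>w. f (tuple_of n m (act n m (P w) (Q w) (A w) (X w)))) 0"
      by (rule lim_cong_ev[rotated])
    moreover have "lim (\<lambda>w. f (tuple_of n m (act n m (P w) (Q w) (A w) (X w)))) 1"
      using lim_gen_algebra[OF f XP] f0(2) by (simp add: zero_tuple_eq)
    ultimately show False using lim_unique by fastforce
  qed
qed

end

theorem theorem1p8:
  fixes n m k :: nat
    and G :: "complex mat set"
    and \<alpha> :: "complex mat \<Rightarrow> complex mat list \<Rightarrow> complex mat list"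
  assumes "n \<ge> 3" and "m \<ge> 3"
    and "reductive_group k G"
    and "algebraic_linear_action k G n m \<alpha>"
  shows "null_cone G n m \<alpha> \<noteq> SING n m"
proof -
  obtain \<rho> where "rational_rep k G (m * n\<^sup>2) \<rho>"
    "\<forall>g\<in>G. \<forall>X\<in>Mat_tuples n m. \<alpha> g X \<in> Mat_tuples n m \<and> flatten n m (\<alpha> g X) = \<rho> g *\<^sub>v flatten n m X"
    using assms(4) unfolding algebraic_linear_action_def by blast
  then interpret tuple_action n m k G \<alpha> \<rho>
    by unfold_locales (use assms(3) in auto)
  show ?thesis by (rule null_cone_not_SING[OF assms(1,2)])
qed

end
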